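(* For every positive integer $n$, the slow Tamari lattice $\operatorname{sTam}_n$ is (1) semidistributive; (2) extremal; (3) trim; (4) polygonal, and each of its polygons is either a quadrilateral (both maximal chains of length $2$) or a hexagon (one maximal chain of length $2$ and the other of length $4$); (5) congruence uniform.
   Context: Let $n$ be a positive integer. The board of size $n$ is the Ferrers diagram of shape $(n,n,n-1,n-2,\dots,3,2)$ (a single cell $(1,1)$ if $n=1$). Its cells are written $(i,j)$, where $i$ is the row, numbered from the top, and $j$ is the column label, the columns being labelled $n,n-1,\dots,1$ from left to right. So the cells are $(1,j)$ for $1\le j\le n$ and $(i,j)$ for $2\le i\le n$, $i-1\le j\le n$. The root is $(1,n)$ (top-left cell); the border cells are $(i,i-1)$ for $2\le i\le n$ (the rightmost cells of rows $2,\dots,n$). An fb-tableau of size $n$ is a filling in which each cell is either empty or nonempty such that the root and all border cells are nonempty, and every nonempty cell other than the root has a nonempty cell strictly to its left in the same row or strictly above it in the same column. In an fb-tableau, a nonempty cell different from the root is called a left-arrow if there is no nonempty cell strictly to its left in its row, an up-arrow if there is no nonempty cell strictly above it in its column, and a dot otherwise; the root is also a dot. (Each of rows $2,\dots,n$ has exactly one left-arrow, each of columns $1,\dots,n-1$ has exactly one up-arrow.) A cell is free in $T$ if it lies strictly below an up-arrow (same column) and strictly to the right of a left-arrow (same row); a free cell is either empty or contains a dot. $\operatorname{Row}(T)$ is the set of cells lying weakly to the right of a left-arrow or of the root in the same row; $\operatorname{Col}(T)$ is the set of cells lying weakly below an up-arrow or the root in the same column. For fb-tableaux $S,T$ of size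 $n$, write $S\lhd T$ if (1) $\operatorname{Col}(S)\subseteq\operatorname{Col}(T)$; (2) $\operatorname{Row}(T)\subseteq\operatorname{Row}(S)$; (3) for every cell $c$ that is free in both $S$ and $T$, if $c$ contains a dot in $S$ then $c$ contains a dot in $T$. An fb-tableau is small if its only dot is the root (equivalently, all its free cells are empty). The slow Tamari lattice $\operatorname{sTam}_n$ is the set of small fb-tableaux of size $n$ ordered by $\lhd$; it is a finite lattice. Lattice notions, for a finite lattice $L$. The length of a chain is its number of elements minus one. An element is join-irreducible (resp. meet-irreducible) if it covers (resp. is covered by) exactly one element. $L$ is semidistributive if for all $x,y,z$: $x\vee z=y\vee z$ implies $(x\wedge y)\vee z=x\vee z$, and $x\wedge z=y\wedge z$ implies $(x\vee y)\wedge z=x\wedge z$. $L$ is extremal if the length of its longest chain equals both its number of join-irreducible and its number of meet-irreducible elements. An element $x$ is left modular if $(y\wedge x)\vee z=y\vee(x\wedge z)$ for all $y\le z$; $L$ is left modular if it has a maximal chain all of whose elements are left modular; $L$ is trim if it is left modular and extremal. A polygon is an interval $[x,y]$ that is the union of two distinct maximal chains from $x$ to $y$ which intersect only at $x$ and $y$. $L$ is polygonal if: whenever $y_1\neq y_2$ both cover $x$, $[x,y_1\vee y_2]$ is a polygon; and whenever $y_1\ne y_2$ are both covered by $x$, $[y_1\wedge y_2,x]$ is a polygon. A congruence is an equivalence relation compatible with $\wedge$ and $\vee$; the congruences form a lattice $\operatorname{Con}L$ under inclusion, and $\operatorname{con}(x,y)$ is the smallest congruence identifying $x$ and $y$. For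 $\mathbf j$ join-irreducible with unique lower cover $\mathbf j_*$ put $\operatorname{con}(\mathbf j)=\operatorname{con}(\mathbf j_*,\mathbf j)$; for $\mathbf m$ meet-irreducible with unique upper cover $\mathbf m^*$ put $\operatorname{con}(\mathbf m)=\operatorname{con}(\mathbf m,\mathbf m^* )$. $L$ is congruence uniform if $\mathbf j\mapsto\operatorname{con}(\mathbf j)$ and $\mathbf m\mapsto\operatorname{con}(\mathbf m)$ are bijections from the join-irreducible, resp. meet-irreducible, elements of $L$ onto the join-irreducible elements of $\operatorname{Con}L$.
   Formalization: Left modularity uses the standard law (y∨x)∧z = y∨(x∧z) for y≤z, as the printed law holds only for the top element; a polygon's two chains must be all maximal chains of the interval, else a 2-chain times 3-chain interval in sTam_4 (lengths 3,3) refutes (4). *)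

theory Defs
  imports "HOL-Algebra.Lattice"
begin

section \<open>Fb-tableaux and the slow Tamari lattice\<close>

text \<open>A cell \<open>(i, j)\<close> is given by its row \<open>i\<close> (numbered from the top) and its column label \<open>j\<close>.
  Column labels decrease from left to right: left of \<open>(i, j)\<close> means a larger label.\<close>

type_synonym cell = "nat \<times> nat"

definition board :: "nat \<Rightarrow> cell set" where
  "board n = {(1, j) | j. 1 \<le> j \<and> j \<le> n} \<union> {(i, j). 2 \<le> i \<and> i \<le> n \<and> i - 1 \<le> j \<and> j \<le> n}"

definition root :: "nat \<Rightarrow> cell" where
  "root n = (1, n)"

definition border :: "nat \<Rightarrow> cell set" where
  "border n = {(i, i - 1) | i. 2 \<le> i \<and> i \<le> n}"

definition strictly_left :: "cell \<Rightarrow> cell \<Rightarrow> bool" where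
  "strictly_left d c \<longleftrightarrow> fst d = fst c \<and> snd d > snd c"

definition strictly_above :: "cell \<Rightarrow> cell \<Rightarrow> bool" where
  "strictly_above d c \<longleftrightarrow> snd d = snd c \<and> fst d < fst c"

text \<open>A filling is identified with its set \<open>T\<close> of nonempty cells.\<close>

definition fb_tableau :: "nat \<Rightarrow> cell set \<Rightarrow> bool" where
  "fb_tableau n T \<longleftrightarrow>
     T \<subseteq> board n \<and> root n \<in> T \<and> border n \<subseteq> T \<and>
     (\<forall>c\<in>T. c \<noteq> root n \<longrightarrow> (\<exists>d\<in>T. strictly_left d c \<or> strictly_above d c))"

definition left_arrow :: "nat \<Rightarrow> cell set \<Rightarrow> cell \<Rightarrow> bool" where
  "left_arrow n T c \<longleftrightarrow> c \<in> T \<and> c \<noteq> root n \<and> \<not> (\<exists>d\<in>T. strictly_left d c)"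

definition up_arrow :: "nat \<Rightarrow> cell set \<Rightarrow> cell \<Rightarrow> bool" where
  "up_arrow n T c \<longleftrightarrow> c \<in> T \<and> c \<noteq> root n \<and> \<not> (\<exists>d\<in>T. strictly_above d c)"

text \<open>The root is never an arrow, hence it counts as a dot.\<close>

definition dot :: "nat \<Rightarrow> cell set \<Rightarrow> cell \<Rightarrow> bool" where
  "dot n T c \<longleftrightarrow> c \<in> T \<and> \<not> left_arrow n T c \<and> \<not> up_arrow n T c"

definition free_cell :: "nat \<Rightarrow> cell set \<Rightarrow> cell \<Rightarrow> bool" where
  "free_cell n T c \<longleftrightarrow> c \<in> board n \<and>
     (\<exists>u. up_arrow n T u \<and> strictly_above u c) \<and> (\<exists>l. left_arrow n T l \<and> strictly_left l c)"

definition Row :: "nat \<Rightarrow> cell set \<Rightarrow> cell set" where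
  "Row n T = {c \<in> board n. \<exists>d. (left_arrow n T d \<or> d = root n) \<and> (d = c \<or> strictly_left d c)}"

definition Col :: "nat \<Rightarrow> cell set \<Rightarrow> cell set" where
  "Col n T = {c \<in> board n. \<exists>d. (up_arrow n T d \<or> d = root n) \<and> (d = c \<or> strictly_above d c)}"

definition fb_le :: "nat \<Rightarrow> cell set \<Rightarrow> cell set \<Rightarrow> bool" where
  "fb_le n S T \<longleftrightarrow>
     Col n S \<subseteq> Col n T \<and> Row n T \<subseteq> Row n S \<and>
     (\<forall>c. free_cell n S c \<and> free_cell n T c \<and> dot n S c \<longrightarrow> dot n T c)"

definition small :: "nat \<Rightarrow> cell set \<Rightarrow> bool" where
  "small n T \<longleftrightarrow> fb_tableau n T \<and> (\<forall>c. dot n T c \<longrightarrow> c = root n)"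

definition sTam :: "nat \<Rightarrow> cell set gorder" where
  "sTam n = \<lparr>carrier = {T. small n T}, eq = (=), le = fb_le n\<rparr>"

section \<open>Notions for finite lattices\<close>

definition covers :: "('a, 'b) gorder_scheme \<Rightarrow> 'a \<Rightarrow> 'a \<Rightarrow> bool" where
  \<comment> \<open>\<open>covers L y x\<close>: the element \<open>y\<close> covers \<open>x\<close>\<close>
  "covers L y x \<longleftrightarrow> x \<in> carrier L \<and> y \<in> carrier L \<and> x \<sqsubset>\<^bsub>L\<^esub> y \<and>
     \<not> (\<exists>z\<in>carrier L. x \<sqsubset>\<^bsub>L\<^esub> z \<and> z \<sqsubset>\<^bsub>L\<^esub> y)"

definition join_irreducible :: "('a, 'b) gorder_scheme \<Rightarrow> 'a \<Rightarrow> bool" where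
  "join_irreducible L j \<longleftrightarrow> j \<in> carrier L \<and> (\<exists>!x. covers L j x)"

definition meet_irreducible :: "('a, 'b) gorder_scheme \<Rightarrow> 'a \<Rightarrow> bool" where
  "meet_irreducible L m \<longleftrightarrow> m \<in> carrier L \<and> (\<exists>!x. covers L x m)"

definition lower_cover :: "('a, 'b) gorder_scheme \<Rightarrow> 'a \<Rightarrow> 'a" where
  "lower_cover L j = (THE x. covers L j x)"

definition upper_cover :: "('a, 'b) gorder_scheme \<Rightarrow> 'a \<Rightarrow> 'a" where
  "upper_cover L m = (THE x. covers L x m)"

definition chain_in :: "('a, 'b) gorder_scheme \<Rightarrow> 'a set \<Rightarrow> bool" where
  "chain_in L C \<longleftrightarrow> C \<noteq> {} \<and> C \<subseteq> carrier L \<and> (\<forall>x\<in>C. \<forall>y\<in>C. x \<sqsubseteq>\<^bsub>L\<^esub> y \<or> y \<sqsubseteq>\<^bsub>L\<^esub> x)"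

definition chain_length :: "'a set \<Rightarrow> nat" where
  "chain_length C = card C - 1"

text \<open>Maximality is with respect to inclusion among the chains contained in \<open>A\<close>.\<close>

definition maximal_chain :: "('a, 'b) gorder_scheme \<Rightarrow> 'a set \<Rightarrow> 'a set \<Rightarrow> bool" where
  "maximal_chain L A C \<longleftrightarrow> chain_in L C \<and> C \<subseteq> A \<and>
     (\<forall>D. chain_in L D \<and> D \<subseteq> A \<and> C \<subseteq> D \<longrightarrow> D = C)"

definition semidistributive :: "('a, 'b) gorder_scheme \<Rightarrow> bool" where
  "semidistributive L \<longleftrightarrow>
     (\<forall>x\<in>carrier L. \<forall>y\<in>carrier L. \<forall>z\<in>carrier L.
        (x \<squnion>\<^bsub>L\<^esub> z = y \<squnion>\<^bsub>L\<^esub> z \<longrightarrow> (x \<sqinter>\<^bsub>L\<^esub> y) \<squnion>\<^bsub>L\<^esub> z = x \<squnion>\<^bsub>L\<^esub> z) \<and>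
        (x \<sqinter>\<^bsub>L\<^esub> z = y \<sqinter>\<^bsub>L\<^esub> z \<longrightarrow> (x \<squnion>\<^bsub>L\<^esub> y) \<sqinter>\<^bsub>L\<^esub> z = x \<sqinter>\<^bsub>L\<^esub> z))"

definition extremal :: "('a, 'b) gorder_scheme \<Rightarrow> bool" where
  "extremal L \<longleftrightarrow>
     Max (chain_length ` {C. chain_in L C}) = card {j. join_irreducible L j} \<and>
     Max (chain_length ` {C. chain_in L C}) = card {m. meet_irreducible L m}"

text \<open>The modular law for \<open>x\<close>. (With \<open>(y \<sqinter> x) \<squnion> z\<close> as left-hand side, which is just \<open>z\<close>, only the
  top element would qualify.)\<close>

definition left_modular_element :: "('a, 'b) gorder_scheme \<Rightarrow> 'a \<Rightarrow> bool" where
  "left_modular_element L x \<longleftrightarrow> x \<in> carrier L \<and>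
     (\<forall>y\<in>carrier L. \<forall>z\<in>carrier L. y \<sqsubseteq>\<^bsub>L\<^esub> z \<longrightarrow>
        (y \<squnion>\<^bsub>L\<^esub> x) \<sqinter>\<^bsub>L\<^esub> z = y \<squnion>\<^bsub>L\<^esub> (x \<sqinter>\<^bsub>L\<^esub> z))"

definition left_modular :: "('a, 'b) gorder_scheme \<Rightarrow> bool" where
  "left_modular L \<longleftrightarrow>
     (\<exists>C. maximal_chain L (carrier L) C \<and> (\<forall>x\<in>C. left_modular_element L x))"

definition trim :: "('a, 'b) gorder_scheme \<Rightarrow> bool" where
  "trim L \<longleftrightarrow> left_modular L \<and> extremal L"

text \<open>The chains \<open>C\<close> and \<open>D\<close> bounding a polygon are required to be all the maximal chains of the
  interval. The other clauses do not imply this: the product of a 2-element and a 3-element chain is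
  also the union of two maximal chains meeting only at the ends. For intervals of the form
  \<open>[x, y\<^sub>1 \<squnion> y\<^sub>2]\<close> with \<open>y\<^sub>1 \<noteq> y\<^sub>2\<close> covering \<open>x\<close>, and dually, it is automatic.\<close>

definition polygon_chains :: "('a, 'b) gorder_scheme \<Rightarrow> 'a \<Rightarrow> 'a \<Rightarrow> 'a set \<Rightarrow> 'a set \<Rightarrow> bool" where
  "polygon_chains L x y C D \<longleftrightarrow>
     x \<in> carrier L \<and> y \<in> carrier L \<and> x \<sqsubseteq>\<^bsub>L\<^esub> y \<and> C \<noteq> D \<and>
     {E. maximal_chain L \<lbrace>x..y\<rbrace>\<^bsub>L\<^esub> E} = {C, D} \<and>
     \<lbrace>x..y\<rbrace>\<^bsub>L\<^esub> = C \<union> D \<and> C \<inter> D = {x, y}"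

definition polygon :: "('a, 'b) gorder_scheme \<Rightarrow> 'a \<Rightarrow> 'a \<Rightarrow> bool" where
  "polygon L x y \<longleftrightarrow> (\<exists>C D. polygon_chains L x y C D)"

definition polygonal :: "('a, 'b) gorder_scheme \<Rightarrow> bool" where
  "polygonal L \<longleftrightarrow>
     (\<forall>x y\<^sub>1 y\<^sub>2. covers L y\<^sub>1 x \<and> covers L y\<^sub>2 x \<and> y\<^sub>1 \<noteq> y\<^sub>2 \<longrightarrow> polygon L x (y\<^sub>1 \<squnion>\<^bsub>L\<^esub> y\<^sub>2)) \<and>
     (\<forall>x y\<^sub>1 y\<^sub>2. covers L x y\<^sub>1 \<and> covers L x y\<^sub>2 \<and> y\<^sub>1 \<noteq> y\<^sub>2 \<longrightarrow> polygon L (y\<^sub>1 \<sqinter>\<^bsub>L\<^esub> y\<^sub>2) x)"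

definition quadrilateral :: "('a, 'b) gorder_scheme \<Rightarrow> 'a \<Rightarrow> 'a \<Rightarrow> bool" where
  "quadrilateral L x y \<longleftrightarrow>
     (\<exists>C D. polygon_chains L x y C D \<and> chain_length C = 2 \<and> chain_length D = 2)"

definition hexagon :: "('a, 'b) gorder_scheme \<Rightarrow> 'a \<Rightarrow> 'a \<Rightarrow> bool" where
  "hexagon L x y \<longleftrightarrow>
     (\<exists>C D. polygon_chains L x y C D \<and> chain_length C = 2 \<and> chain_length D = 4)"

definition lattice_congruence :: "('a, 'b) gorder_scheme \<Rightarrow> ('a \<times> 'a) set \<Rightarrow> bool" where
  "lattice_congruence L \<theta> \<longleftrightarrow> equiv (carrier L) \<theta> \<and>
     (\<forall>a b c d. (a, b) \<in> \<theta> \<and> (c, d) \<in> \<theta> \<longrightarrow>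
        (a \<sqinter>\<^bsub>L\<^esub> c, b \<sqinter>\<^bsub>L\<^esub> d) \<in> \<theta> \<and> (a \<squnion>\<^bsub>L\<^esub> c, b \<squnion>\<^bsub>L\<^esub> d) \<in> \<theta>)"

definition Con :: "('a, 'b) gorder_scheme \<Rightarrow> ('a \<times> 'a) set gorder" where
  "Con L = \<lparr>carrier = {\<theta>. lattice_congruence L \<theta>}, eq = (=), le = (\<subseteq>)\<rparr>"

definition con :: "('a, 'b) gorder_scheme \<Rightarrow> 'a \<Rightarrow> 'a \<Rightarrow> ('a \<times> 'a) set" where
  "con L x y = \<Inter> {\<theta>. lattice_congruence L \<theta> \<and> (x, y) \<in> \<theta>}"

definition congruence_uniform :: "('a, 'b) gorder_scheme \<Rightarrow> bool" where
  "congruence_uniform L \<longleftrightarrow>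
     bij_betw (\<lambda>j. con L (lower_cover L j) j)
       {j. join_irreducible L j} {\<theta>. join_irreducible (Con L) \<theta>} \<and>
     bij_betw (\<lambda>m. con L m (upper_cover L m))
       {m. meet_irreducible L m} {\<theta>. join_irreducible (Con L) \<theta>}"

end

theory Submission
  imports Defs
begin

text \<open>
  A small tableau is determined by the column \<open>f i\<close> of the left-arrow of each row \<open>i \<ge> 2\<close> and the
  row \<open>g j\<close> of the up-arrow of each column \<open>j < n\<close>, and \<open>S \<lhd> T\<close> says that \<open>f\<close> and \<open>g\<close> decrease
  pointwise. Encode \<open>f\<close> and \<open>g\<close> by the bits \<open>a(k, j) = [f (k + 1) \<le> j]\<close> and \<open>c(k, j) = [g j \<le> k]\<close>
  for \<open>1 \<le> k \<le> j < n\<close>; then \<open>a(j, j) = c(j, j)\<close>, and there are \<open>(n - 1)\<^sup>2\<close> bits. For \<open>k < j\<close> the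
  tableau conditions say that \<open>x = a(k, j - 1)\<close> and \<open>y = c(k + 1, j)\<close> force
  \<open>(a(k, j), c(k, j)) = (x, y)\<close> unless \<open>(x, y) = (0, 1)\<close>, in which case any of
  \<open>(0, 0) < (0, 1) < (1, 1)\<close> may occur. The tableaux with \<open>(x, y) = (0, 1)\<close> form an interval, so the
  lattice arises from a point by \<open>(n - 1)\<^sup>2\<close> interval doublings, one for each bit.

  Semidistributivity is inherited by doublings. The first bit changed by a cover labels it; covers
  with the same label are perspective to the cover below the unique join-irreducible with that label,
  which identifies the join-irreducibles, the bits, and the join-irreducible congruences. The chain
  that switches on the columns from the last to the first changes one bit at a time, so it passes
  through every doubled interval, and this makes its elements left modular.

  A cover changes only bits of one row \<open>k + 1\<close> and of the column \<open>k\<close>. Hence, as the bits of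
  \<open>[x, y\<^sub>1 \<squnion> y\<^sub>2]\<close> are revealed one after the other, the only doublings that can enlarge the square are
  the two at the cell whose row is changed by one cover and whose column by the other. They triple a
  single vertex of the square, the one with \<open>(x, y) = (0, 1)\<close>, which gives a hexagon. Transposing the
  board and complementing all bits is an anti-automorphism, which yields the dual halves of all
  statements.
\<close>

section \<open>Towers of interval doublings\<close>

text \<open>Joins and meets are not the union and intersection of bit sets, because bits already set
  can force others. What replaces a formula is one observation: if \<open>x\<close> lies strictly
  below \<open>y\<close>, the first bit where they differ was open both ways in both of them, so
  their common prefix lies in the interval doubled at that bit; and the elements whose prefix lies
  there are closed under joins and meets. Semidistributivity, left modularity and the behaviour of
  covers all come from comparing two elements at such a bit and carrying its freedom along a join or
  a meet.

  The three values at a cell are not one doubling of an interval but two: \<open>c\<close> doubles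
  where \<open>(x, y) = (0, 1)\<close>, and \<open>a\<close> then doubles only the copy with
  \<open>c = 1\<close>. A diagonal bit doubles the whole lattice. With \<open>n - 1\<close> diagonal
  bits and two bits for each of the \<open>(n - 1) (n - 2) / 2\<close> other positions this gives
  \<open>(n - 1)\<^sup>2\<close>.\<close>

abbreviation cut :: "nat \<Rightarrow> nat set \<Rightarrow> nat set" where
  "cut m S \<equiv> S \<inter> {..<m}"

text \<open>\<open>U i S\<close> and \<open>D i S\<close> say that bit \<open>i\<close> may be set, respectively clear, given the bits
  of \<open>S\<close> below \<open>i\<close>. Where both hold, bit \<open>i\<close> doubles.\<close>

definition tower :: "(nat \<Rightarrow> nat set \<Rightarrow> bool) \<Rightarrow> (nat \<Rightarrow> nat set \<Rightarrow> bool) \<Rightarrow> nat \<Rightarrow> nat set set" where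
  "tower U D m = {S. S \<subseteq> {..<m} \<and> (\<forall>i<m. (i \<in> S \<longrightarrow> U i S) \<and> (i \<notin> S \<longrightarrow> D i S))}"

text \<open>Because the first two assumptions compare only the bits below \<open>m\<close>,
  \<open>U m\<close> and \<open>D m\<close> cannot see later bits, and cutting off the later bits
  maps each level of the tower to an earlier one. The assumption \<open>interval\<close> makes the
  step from level \<open>m\<close> to level \<open>Suc m\<close> a doubling in the sense of
  Day.\<close>

locale doubling =
  fixes U D :: "nat \<Rightarrow> nat set \<Rightarrow> bool"
  assumes U_mono: "cut m S \<subseteq> cut m T \<Longrightarrow> U m S \<Longrightarrow> U m T"
    and D_antimono: "cut m S \<subseteq> cut m T \<Longrightarrow> D m T \<Longrightarrow> D m S"
    and total: "U m S \<or> D m S"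
    and interval: "\<exists>p\<in>tower U D m. \<exists>q\<in>tower U D m. p \<subseteq> q \<and>
      (\<forall>S\<in>tower U D m. U m S \<and> D m S \<longleftrightarrow> p \<subseteq> S \<and> S \<subseteq> q)"
begin

abbreviation F :: "nat \<Rightarrow> nat set set" where "F \<equiv> tower U D"

lemma U_cong: "cut m S = cut m T \<Longrightarrow> U m S = U m T"
  using U_mono by blast

lemma D_cong: "cut m S = cut m T \<Longrightarrow> D m S = D m T"
  using D_antimono by blast

lemma tower_cut:
  assumes "S \<in> F n" "m \<le> n"
  shows "cut m S \<in> F m"
  unfolding tower_def
proof (intro CollectI conjI allI impI)
  fix i assume "i < m"
  then have "cut i (cut m S) = cut i S" by auto
  then have "U i (cut m S) = U i S" "D i (cut m S) = D i S" by (rule U_cong, rule D_cong)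
  with assms \<open>i < m\<close> show "i \<in> cut m S \<Longrightarrow> U i (cut m S)" "i \<notin> cut m S \<Longrightarrow> D i (cut m S)"
    by (auto simp: tower_def)
qed auto

lemma tower_insert:
  assumes "S \<in> F m" "U m S"
  shows "insert m S \<in> F (Suc m)"
  unfolding tower_def
proof (intro CollectI conjI allI impI)
  fix i assume "i < Suc m"
  then have "cut i (insert m S) = cut i S" by auto
  then have "U i (insert m S) = U i S" "D i (insert m S) = D i S" by (rule U_cong, rule D_cong)
  with assms \<open>i < Suc m\<close> show "i \<in> insert m S \<Longrightarrow> U i (insert m S)"
    "i \<notin> insert m S \<Longrightarrow> D i (insert m S)"
    by (auto simp: tower_def less_Suc_eq)
qed (use assms in \<open>auto simp: tower_def\<close>)

lemma tower_same:
  assumes "S \<in> F m" "D m S"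
  shows "S \<in> F (Suc m)"
  using assms by (auto simp: tower_def less_Suc_eq)

lemma tower_subset: "S \<in> F m \<Longrightarrow> S \<subseteq> {..<m}"
  by (simp add: tower_def)

lemma tower_UD:
  "S \<in> F n \<Longrightarrow> m < n \<Longrightarrow> m \<in> S \<Longrightarrow> U m S"
  "S \<in> F n \<Longrightarrow> m < n \<Longrightarrow> m \<notin> S \<Longrightarrow> D m S"
  by (auto simp: tower_def)

lemma finite_tower: "finite (F m)"
  by (rule finite_subset[of _ "Pow {..<m}"]) (auto simp: tower_def)

lemma cut_Suc: "cut (Suc m) S = (if m \<in> S then insert m (cut m S) else cut m S)"
  by (auto simp: less_Suc_eq)

text \<open>The remaining bits are decided one at a time: a bit of \<open>X\<close> can be set by
  monotonicity of \<open>U\<close>, a bit outside \<open>Y\<close> can be cleared by antitonicity of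
  \<open>D\<close>, and any other bit takes a value that totality permits. So restriction maps
  intervals onto intervals; in particular nothing new can appear between the prefixes of a
  cover.\<close>

lemma extend_between:
  assumes "X \<in> F N" "Y \<in> F N" "X \<subseteq> Y" "m \<le> N" "S \<in> F m" "cut m X \<subseteq> S" "S \<subseteq> cut m Y"
  shows "\<exists>Z\<in>F N. X \<subseteq> Z \<and> Z \<subseteq> Y \<and> cut m Z = S"
proof -
  have "\<exists>Z\<in>F n. cut n X \<subseteq> Z \<and> Z \<subseteq> cut n Y \<and> cut m Z = S" if "m \<le> n" "n \<le> N" for n
    using that
  proof (induction n rule: dec_induct)
    case base
    then show ?case using assms tower_subset by blast
  next
    case (step n)
    then obtain Z where Z: "Z \<in> F n" "cut n X \<subseteq> Z" "Z \<subseteq> cut n Y" "cut m Z = S" by auto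
    have cZ: "cut n Z = Z" using tower_subset[OF Z(1)] by auto
    have a: "cut m (insert n Z) = S" using Z \<open>m \<le> n\<close> by auto
    consider "n \<in> X" | "n \<notin> Y" | "n \<notin> X" "n \<in> Y" "U n Z" | "n \<notin> X" "n \<in> Y" "D n Z"
      using total by blast
    then show ?case
    proof cases
      case 1
      then have "U n Z" using tower_UD(1)[OF assms(1), of n] step(2,4) Z(2) cZ U_mono[of X n Z]
        by auto
      with Z a 1 \<open>X \<subseteq> Y\<close> show ?thesis
        by (intro bexI[of _ "insert n Z"]) (auto simp: cut_Suc tower_insert)
    next
      case 2
      then have "D n Z" using tower_UD(2)[OF assms(2), of n] step(2,4) Z(3) cZ D_antimono[of Z n Y]
        by auto
      with Z 2 \<open>X \<subseteq> Y\<close> show ?thesis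
        by (intro bexI[of _ Z]) (auto simp: cut_Suc tower_same)
    next
      case 3
      with Z a show ?thesis
        by (intro bexI[of _ "insert n Z"]) (auto simp: cut_Suc tower_insert)
    next
      case 4
      with Z show ?thesis
        by (intro bexI[of _ Z]) (auto simp: cut_Suc tower_same)
    qed
  qed
  from this[of N] assms obtain Z where Z: "Z \<in> F N" "cut N X \<subseteq> Z" "Z \<subseteq> cut N Y" "cut m Z = S"
    by auto
  moreover have "cut N X = X" "cut N Y = Y"
    using tower_subset[OF assms(1)] tower_subset[OF assms(2)] by auto
  ultimately show ?thesis by auto
qed

lemma extend:
  assumes "S \<in> F m" "m \<le> N"
  shows "\<exists>Z\<in>F N. cut m Z = S"
  using assms(2)
proof (induction N rule: dec_induct)
  case base
  then show ?case using assms tower_subset by blast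
next
  case (step n)
  then obtain Z where "Z \<in> F n" "cut m Z = S" by auto
  moreover have "cut m (insert n Z) = cut m Z" using step by auto
  ultimately show ?case using total[of n Z] tower_insert[of Z n] tower_same[of Z n] by blast
qed

section \<open>Joins and meets, computed bit by bit\<close>

fun join_bits :: "nat \<Rightarrow> nat set \<Rightarrow> nat set \<Rightarrow> nat set" where
  "join_bits 0 S T = {}"
| "join_bits (Suc m) S T = (if m \<in> S \<or> m \<in> T \<or> \<not> D m (join_bits m S T) then insert m (join_bits m S T) else join_bits m S T)"

fun meet_bits :: "nat \<Rightarrow> nat set \<Rightarrow> nat set \<Rightarrow> nat set" where
  "meet_bits 0 S T = {}"
| "meet_bits (Suc m) S T = (if m \<in> S \<and> m \<in> T \<and> U m (meet_bits m S T) then insert m (meet_bits m S T) else meet_bits m S T)"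

lemma join_bits_subset: "join_bits m S T \<subseteq> {..<m}"
  by (induction m) auto

lemma meet_bits_subset: "meet_bits m S T \<subseteq> {..<m}"
  by (induction m) auto

text \<open>This and its analogue for meets make the restriction to a level a lattice homomorphism;
  its kernel is the congruence \<open>agree\<close> below.\<close>

lemma cut_join_bits: "m \<le> n \<Longrightarrow> cut m (join_bits n S T) = join_bits m S T"
proof (induction n rule: dec_induct)
  case base
  then show ?case using join_bits_subset by blast
next
  case (step n)
  then show ?case by auto
qed

lemma cut_meet_bits: "m \<le> n \<Longrightarrow> cut m (meet_bits n S T) = meet_bits m S T"
proof (induction n rule: dec_induct)
  case base
  then show ?case using meet_bits_subset by blast
next
  case (step n)
  then show ?case by auto
qed

text \<open>No bit leaves a choice. It has to be set if an argument has it or if it cannot be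
  cleared, and then \<open>U\<close> holds by monotonicity or totality. An upper bound
  \<open>Q\<close> must have the bit too: where \<open>D\<close> fails for the smaller prefix it
  fails for that of \<open>Q\<close>.\<close>

lemma join_bits_lub:
  assumes "S \<in> F N" "T \<in> F N" "m \<le> N"
  shows "join_bits m S T \<in> F m" "cut m S \<subseteq> join_bits m S T" "cut m T \<subseteq> join_bits m S T"
    "Q \<in> F m \<Longrightarrow> cut m S \<subseteq> Q \<Longrightarrow> cut m T \<subseteq> Q \<Longrightarrow> join_bits m S T \<subseteq> Q"
proof -
  have "join_bits m S T \<in> F m \<and> cut m S \<subseteq> join_bits m S T \<and> cut m T \<subseteq> join_bits m S T \<and>
    (\<forall>Q\<in>F m. cut m S \<subseteq> Q \<and> cut m T \<subseteq> Q \<longrightarrow> join_bits m S T \<subseteq> Q)"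
    using assms(3)
  proof (induction m)
    case 0
    then show ?case by (auto simp: tower_def)
  next
    case (Suc m)
    let ?R = "join_bits m S T"
    from Suc have IH: "?R \<in> F m" "cut m S \<subseteq> ?R" "cut m T \<subseteq> ?R"
      "\<And>Q. Q \<in> F m \<Longrightarrow> cut m S \<subseteq> Q \<Longrightarrow> cut m T \<subseteq> Q \<Longrightarrow> ?R \<subseteq> Q" by auto
    have cR: "cut m ?R = ?R" using join_bits_subset by blast
    have U: "U m ?R" if "m \<in> S \<or> m \<in> T \<or> \<not> D m ?R"
      using that U_mono[of S m ?R] U_mono[of T m ?R] IH(1-3) total[of m ?R] cR Suc(2)
        tower_UD(1)[OF assms(1), of m] tower_UD(1)[OF assms(2), of m] by auto
    have "join_bits (Suc m) S T \<in> F (Suc m)"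
      using U IH tower_insert tower_same by auto
    moreover have "join_bits (Suc m) S T \<subseteq> Q"
      if Q: "Q \<in> F (Suc m)" "cut (Suc m) S \<subseteq> Q" "cut (Suc m) T \<subseteq> Q" for Q
    proof -
      have "cut m Q \<in> F m" using tower_cut[OF Q(1), of m] by simp
      then have R: "?R \<subseteq> cut m Q" using IH(4) Q by (auto simp: cut_Suc split: if_splits)
      have "m \<in> Q" if "m \<in> S \<or> m \<in> T \<or> \<not> D m ?R"
        using that Q R cR D_antimono[of ?R m Q] tower_UD(2)[OF Q(1), of m] by auto
      with R show ?thesis by auto
    qed
    ultimately show ?case using IH(2,3) by (auto simp: cut_Suc)
  qed
  then show "join_bits m S T \<in> F m" "cut m S \<subseteq> join_bits m S T" "cut m T \<subseteq> join_bits m S T"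
    "Q \<in> F m \<Longrightarrow> cut m S \<subseteq> Q \<Longrightarrow> cut m T \<subseteq> Q \<Longrightarrow> join_bits m S T \<subseteq> Q" by auto
qed

lemma meet_bits_glb:
  assumes "S \<in> F N" "T \<in> F N" "m \<le> N"
  shows "meet_bits m S T \<in> F m" "meet_bits m S T \<subseteq> S" "meet_bits m S T \<subseteq> T"
    "Q \<in> F m \<Longrightarrow> Q \<subseteq> S \<Longrightarrow> Q \<subseteq> T \<Longrightarrow> Q \<subseteq> meet_bits m S T"
proof -
  have "meet_bits m S T \<in> F m \<and> meet_bits m S T \<subseteq> S \<and> meet_bits m S T \<subseteq> T \<and>
    (\<forall>Q\<in>F m. Q \<subseteq> S \<and> Q \<subseteq> T \<longrightarrow> Q \<subseteq> meet_bits m S T)"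
    using assms(3)
  proof (induction m)
    case 0
    then show ?case by (auto simp: tower_def)
  next
    case (Suc m)
    let ?R = "meet_bits m S T"
    from Suc have IH: "?R \<in> F m" "?R \<subseteq> S" "?R \<subseteq> T"
      "\<And>Q. Q \<in> F m \<Longrightarrow> Q \<subseteq> S \<Longrightarrow> Q \<subseteq> T \<Longrightarrow> Q \<subseteq> ?R" by auto
    have D: "D m ?R" if "\<not> (m \<in> S \<and> m \<in> T \<and> U m ?R)"
      using that D_antimono[of ?R m S] D_antimono[of ?R m T] IH(1-3) total[of m ?R] Suc(2)
        tower_UD(2)[OF assms(1), of m] tower_UD(2)[OF assms(2), of m] by auto
    have "meet_bits (Suc m) S T \<in> F (Suc m)"
      using D IH tower_insert tower_same by auto
    moreover have "Q \<subseteq> meet_bits (Suc m) S T"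
      if Q: "Q \<in> F (Suc m)" "Q \<subseteq> S" "Q \<subseteq> T" for Q
    proof -
      have "cut m Q \<in> F m" using tower_cut[OF Q(1), of m] by simp
      then have R: "cut m Q \<subseteq> ?R" using IH(4) Q by auto
      have "U m ?R" if "m \<in> Q"
        using that R U_mono[of Q m ?R] tower_UD(1)[OF Q(1), of m] by auto
      moreover have "Q = cut (Suc m) Q" using tower_subset[OF Q(1)] by auto
      ultimately show ?thesis using R Q by (auto simp: cut_Suc split: if_splits)
    qed
    ultimately show ?case using IH(2,3) by auto
  qed
  then show "meet_bits m S T \<in> F m" "meet_bits m S T \<subseteq> S" "meet_bits m S T \<subseteq> T"
    "Q \<in> F m \<Longrightarrow> Q \<subseteq> S \<Longrightarrow> Q \<subseteq> T \<Longrightarrow> Q \<subseteq> meet_bits m S T" by auto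
qed

end

text \<open>The coordinates \<open>h\<close> are kept apart from the elements so that a lattice and
  its order dual, with transposed and complemented coordinates, are both instances.\<close>

locale doubled_lattice = doubling +
  fixes L :: "'a gorder" (structure) and h :: "'a \<Rightarrow> nat set" and N :: nat
  assumes bij_h: "bij_betw h (carrier L) (F N)"
    and le_iff: "x \<in> carrier L \<Longrightarrow> y \<in> carrier L \<Longrightarrow> x \<sqsubseteq> y \<longleftrightarrow> h x \<subseteq> h y"
    and eq_L: "eq L = (=)"
begin

abbreviation C :: "'a set" where "C \<equiv> carrier L"

abbreviation pre :: "nat \<Rightarrow> 'a \<Rightarrow> nat set" where
  "pre m x \<equiv> cut m (h x)"

lemma h_tower: "x \<in> C \<Longrightarrow> h x \<in> F N"
  using bij_h by (auto simp: bij_betw_def)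

lemma h_inj: "x \<in> C \<Longrightarrow> y \<in> C \<Longrightarrow> h x = h y \<longleftrightarrow> x = y"
  using bij_h by (auto simp: bij_betw_def inj_on_def)

lemma h_surj: "S \<in> F N \<Longrightarrow> \<exists>x\<in>C. h x = S"
  unfolding bij_betw_imp_surj_on[OF bij_h, symmetric] by (auto simp only: image_iff)

lemma h_subset: "x \<in> C \<Longrightarrow> h x \<subseteq> {..<N}"
  using h_tower tower_subset by blast

lemma h_UD:
  "x \<in> C \<Longrightarrow> m \<in> h x \<Longrightarrow> U m (h x)"
  "x \<in> C \<Longrightarrow> m < N \<Longrightarrow> m \<notin> h x \<Longrightarrow> D m (h x)"
  using h_tower tower_UD h_subset by blast+

lemma finite_L: "finite (carrier L)"
  using bij_h finite_tower bij_betw_finite by blast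

lemma partial_order_L: "partial_order L"
proof
  show "(.=) = (=)" by (rule eq_L)
  fix x y z w
  show "x \<sqsubseteq> y \<Longrightarrow> y \<sqsubseteq> x \<Longrightarrow> x \<in> C \<Longrightarrow> y \<in> C \<Longrightarrow> x .= y"
    using h_inj by (auto simp: le_iff eq_L)
qed (auto simp: le_iff eq_L)

lemma lub_L:
  assumes "x \<in> C" "y \<in> C" "z \<in> C" "h z = join_bits N (h x) (h y)"
  shows "least L z (Upper L {x, y})"
proof (rule least_UpperI)
  have c: "pre N w = h w" if "w \<in> C" for w using h_subset[OF that] by auto
  note l = join_bits_lub[OF h_tower[OF assms(1)] h_tower[OF assms(2)] order_refl]
  show "w \<sqsubseteq> z" if "w \<in> {x, y}" for w
    using that assms l(2,3) le_iff c by auto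
  show "z \<sqsubseteq> w" if "w \<in> Upper L {x, y}" for w
  proof -
    from that assms have w: "w \<in> C" "x \<sqsubseteq> w" "y \<sqsubseteq> w" by (auto simp: Upper_def)
    then show ?thesis using assms l(4)[OF h_tower[OF w(1)]] le_iff c by auto
  qed
qed (use assms in auto)

lemma glb_L:
  assumes "x \<in> C" "y \<in> C" "z \<in> C" "h z = meet_bits N (h x) (h y)"
  shows "greatest L z (Lower L {x, y})"
proof (rule greatest_LowerI)
  note l = meet_bits_glb[OF h_tower[OF assms(1)] h_tower[OF assms(2)] order_refl]
  show "z \<sqsubseteq> w" if "w \<in> {x, y}" for w
    using that assms l(2,3) le_iff by auto
  show "w \<sqsubseteq> z" if "w \<in> Lower L {x, y}" for w
  proof -
    from that assms have w: "w \<in> C" "w \<sqsubseteq> x" "w \<sqsubseteq> y" by (auto simp: Lower_def)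
    then show ?thesis using assms l(4)[OF h_tower[OF w(1)]] le_iff by auto
  qed
qed (use assms in auto)

sublocale lattice L
proof -
  interpret partial_order L by (rule partial_order_L)
  show "lattice L"
  proof
    fix x y assume xy: "x \<in> C" "y \<in> C"
    show "\<exists>s. least L s (Upper L {x, y})"
      using lub_L[OF xy] h_surj[OF join_bits_lub(1)[OF h_tower[OF xy(1)] h_tower[OF xy(2)] order_refl]]
      by blast
    show "\<exists>s. greatest L s (Lower L {x, y})"
      using glb_L[OF xy] h_surj[OF meet_bits_glb(1)[OF h_tower[OF xy(1)] h_tower[OF xy(2)] order_refl]]
      by blast
  qed
qed

lemma h_join:
  assumes "x \<in> C" "y \<in> C"
  shows "h (x \<squnion> y) = join_bits N (h x) (h y)"
proof -
  obtain z where z: "z \<in> C" "h z = join_bits N (h x) (h y)"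
    using h_surj[OF join_bits_lub(1)[OF h_tower[OF assms(1)] h_tower[OF assms(2)] order_refl]] by blast
  then have "least L z (Upper L {x, y})" using lub_L assms by simp
  then have "x \<squnion> y = z"
    using least_unique[OF _ sup_of_two_least[OF assms]] unfolding join_def by simp
  with z show ?thesis by simp
qed

lemma h_meet:
  assumes "x \<in> C" "y \<in> C"
  shows "h (x \<sqinter> y) = meet_bits N (h x) (h y)"
proof -
  obtain z where z: "z \<in> C" "h z = meet_bits N (h x) (h y)"
    using h_surj[OF meet_bits_glb(1)[OF h_tower[OF assms(1)] h_tower[OF assms(2)] order_refl]] by blast
  then have "greatest L z (Lower L {x, y})" using glb_L assms by simp
  then have "x \<sqinter> y = z"
    using greatest_unique[OF _ inf_of_two_greatest[OF assms]] unfolding meet_def by simp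
  with z show ?thesis by simp
qed

text \<open>The substitute for union. Whether the bit is forced may be tested on the join itself
  rather than on a partial result, since \<open>D m\<close> looks only at bits below
  \<open>m\<close>.\<close>

lemma bit_join:
  assumes "x \<in> C" "y \<in> C" "m < N"
  shows "m \<in> h (x \<squnion> y) \<longleftrightarrow> m \<in> h x \<or> m \<in> h y \<or> \<not> D m (h (x \<squnion> y))"
proof -
  let ?J = "join_bits N (h x) (h y)"
  have "m \<in> ?J \<longleftrightarrow> m \<in> cut (Suc m) ?J" by simp
  also have "cut (Suc m) ?J = join_bits (Suc m) (h x) (h y)" using assms(3) by (intro cut_join_bits) simp
  also have "m \<in> \<dots> \<longleftrightarrow> m \<in> h x \<or> m \<in> h y \<or> \<not> D m (join_bits m (h x) (h y))"
    using join_bits_subset[of m "h x" "h y"] by auto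
  also have "D m (join_bits m (h x) (h y)) = D m ?J"
    using assms(3) cut_join_bits[of m N] join_bits_subset[of m] by (intro D_cong) fastforce
  finally show ?thesis using h_join assms by simp
qed

lemma bit_meet:
  assumes "x \<in> C" "y \<in> C" "m < N"
  shows "m \<in> h (x \<sqinter> y) \<longleftrightarrow> m \<in> h x \<and> m \<in> h y \<and> U m (h (x \<sqinter> y))"
proof -
  let ?J = "meet_bits N (h x) (h y)"
  have "m \<in> ?J \<longleftrightarrow> m \<in> cut (Suc m) ?J" by simp
  also have "cut (Suc m) ?J = meet_bits (Suc m) (h x) (h y)" using assms(3) by (intro cut_meet_bits) simp
  also have "m \<in> \<dots> \<longleftrightarrow> m \<in> h x \<and> m \<in> h y \<and> U m (meet_bits m (h x) (h y))"
    using meet_bits_subset[of m "h x" "h y"] by auto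
  also have "U m (meet_bits m (h x) (h y)) = U m ?J"
    using assms(3) cut_meet_bits[of m N] meet_bits_subset[of m] by (intro U_cong) fastforce
  finally show ?thesis using h_meet assms by simp
qed

lemma cut_join_least:
  assumes "x \<in> C" "y \<in> C" "m \<le> N" "Q \<in> F m" "pre m x \<subseteq> Q" "pre m y \<subseteq> Q"
  shows "pre m (x \<squnion> y) \<subseteq> Q"
  using assms join_bits_lub(4)[OF h_tower h_tower] by (simp add: h_join cut_join_bits)

lemma cut_meet_greatest:
  assumes "x \<in> C" "y \<in> C" "m \<le> N" "Q \<in> F m" "Q \<subseteq> h x" "Q \<subseteq> h y"
  shows "Q \<subseteq> h (x \<sqinter> y)"
proof -
  have "Q \<subseteq> pre m (x \<sqinter> y)"
    using assms meet_bits_glb(4)[OF h_tower h_tower] by (simp add: h_meet cut_meet_bits)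
  then show ?thesis by simp
qed

lemma h_join_ge:
  assumes "x \<in> C" "y \<in> C"
  shows "h x \<subseteq> h (x \<squnion> y)" "h y \<subseteq> h (x \<squnion> y)"
  using assms join_left[of x y] join_right[of x y] le_iff[of x] le_iff[of y] by simp_all

lemma h_meet_le:
  assumes "x \<in> C" "y \<in> C"
  shows "h (x \<sqinter> y) \<subseteq> h x" "h (x \<sqinter> y) \<subseteq> h y"
  using assms meet_left[of x y] meet_right[of x y] le_iff[of _ x] le_iff[of _ y] by simp_all

lemma h_join_least:
  assumes "x \<in> C" "y \<in> C" "z \<in> C" "h x \<subseteq> h z" "h y \<subseteq> h z"
  shows "h (x \<squnion> y) \<subseteq> h z"
  using assms join_le[of x z y] le_iff[of _ z] by simp

lemma h_meet_greatest:
  assumes "x \<in> C" "y \<in> C" "z \<in> C" "h z \<subseteq> h x" "h z \<subseteq> h y"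
  shows "h z \<subseteq> h (x \<sqinter> y)"
  using assms meet_le[of z x y] le_iff[of z] by simp

section \<open>Doubled intervals, first differences, and their consequences\<close>

lemma U_sub: "S \<subseteq> T \<Longrightarrow> U m S \<Longrightarrow> U m T"
  using U_mono[of S m T] by auto

lemma D_sub: "S \<subseteq> T \<Longrightarrow> D m T \<Longrightarrow> D m S"
  using D_antimono[of S m T] by auto

text \<open>The prefix of \<open>x\<close> belongs to the interval that bit \<open>m\<close>
  doubles; the value of the bit in \<open>x\<close> itself is left open.\<close>

definition split_at :: "nat \<Rightarrow> 'a \<Rightarrow> bool" where
  "split_at m x \<longleftrightarrow> U m (h x) \<and> D m (h x)"

lemma split_at_obtain:
  assumes "m < N"
  obtains p q where "p \<in> F m" "q \<in> F m" "p \<subseteq> q" "U m p" "D m p"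
    "\<And>x. x \<in> C \<Longrightarrow> split_at m x \<longleftrightarrow> p \<subseteq> h x \<and> pre m x \<subseteq> q"
proof -
  from interval[of m] obtain p q where pq: "p \<in> F m" "q \<in> F m" "p \<subseteq> q"
    and "\<forall>S\<in>F m. U m S \<and> D m S \<longleftrightarrow> p \<subseteq> S \<and> S \<subseteq> q"
    by (elim bexE conjE)
  then have pq4: "U m S \<and> D m S \<longleftrightarrow> p \<subseteq> S \<and> S \<subseteq> q" if "S \<in> F m" for S
    using that by simp
  have "split_at m x \<longleftrightarrow> p \<subseteq> h x \<and> pre m x \<subseteq> q" if "x \<in> C" for x
  proof -
    have "U m (pre m x) = U m (h x)" "D m (pre m x) = D m (h x)"
      by (rule U_cong, simp, rule D_cong, simp)
    then show ?thesis
      using pq4[OF tower_cut[OF h_tower[OF that]]] assms tower_subset[OF pq(1)]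
      unfolding split_at_def by auto
  qed
  moreover have "U m p" "D m p" using pq4[OF pq(1)] pq(3) by auto
  ultimately show thesis using that[OF pq] by simp
qed

text \<open>Both ends of the doubled interval belong to level \<open>m\<close>, so its upper end
  bounds the prefix of the join as soon as it bounds the prefixes of both arguments.\<close>

lemma split_at_join:
  assumes "x \<in> C" "y \<in> C" "m < N" "split_at m x" "split_at m y"
  shows "split_at m (x \<squnion> y)"
proof -
  obtain p q where pq: "q \<in> F m"
    "\<And>x. x \<in> C \<Longrightarrow> split_at m x \<longleftrightarrow> p \<subseteq> h x \<and> pre m x \<subseteq> q"
    using split_at_obtain[OF assms(3)] by metis
  have "p \<subseteq> h (x \<squnion> y)" using h_join_ge assms pq(2) by blast
  moreover have "pre m (x \<squnion> y) \<subseteq> q"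
    using cut_join_least[OF assms(1,2) less_imp_le[OF assms(3)] pq(1)] assms pq(2) by simp
  ultimately show ?thesis using pq(2) assms by simp
qed

lemma split_at_meet:
  assumes "x \<in> C" "y \<in> C" "m < N" "split_at m x" "split_at m y"
  shows "split_at m (x \<sqinter> y)"
proof -
  obtain p q where pq: "p \<in> F m"
    "\<And>x. x \<in> C \<Longrightarrow> split_at m x \<longleftrightarrow> p \<subseteq> h x \<and> pre m x \<subseteq> q"
    using split_at_obtain[OF assms(3)] by metis
  have "pre m (x \<sqinter> y) \<subseteq> pre m x" using h_meet_le assms by blast
  then have "pre m (x \<sqinter> y) \<subseteq> q" using assms pq(2) by auto
  moreover have "p \<subseteq> h (x \<sqinter> y)"
    using cut_meet_greatest[OF assms(1,2) less_imp_le[OF assms(3)] pq(1)] assms pq(2) by simp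
  ultimately show ?thesis using pq(2) assms by simp
qed

lemma first_difference:
  assumes "x \<in> C" "y \<in> C" "x \<sqsubseteq> y" "x \<noteq> y"
  obtains m where "m < N" "m \<in> h y" "m \<notin> h x" "pre m x = pre m y"
    "split_at m x" "split_at m y"
proof -
  have sub: "h x \<subseteq> h y" using assms le_iff by simp
  then obtain k where "k \<in> h y - h x" using assms h_inj by blast
  define m where "m = (LEAST k. k \<in> h y - h x)"
  have m: "m \<in> h y - h x" using LeastI[of "\<lambda>k. k \<in> h y - h x", OF \<open>k \<in> _\<close>] m_def by simp
  have "k \<notin> h y - h x" if "k < m" for k using that not_less_Least unfolding m_def by blast
  then have c: "pre m x = pre m y" using sub by auto
  have "m < N" using m h_subset assms by auto
  moreover have "U m (h y)" "D m (h x)" using m h_UD assms \<open>m < N\<close> by auto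
  moreover have "U m (h x) = U m (h y)" "D m (h x) = D m (h y)"
    using U_cong[OF c] D_cong[OF c] by auto
  ultimately show thesis using that m c by (simp add: split_at_def)
qed

text \<open>At the first bit \<open>m\<close> where the sides differ, \<open>?w\<close> was free to
  leave it clear, so \<open>m\<close> is not forced there; \<open>z\<close> lacks it because
  \<open>?v\<close> does, hence both \<open>x\<close> and \<open>y\<close> have it. Both then lie in
  the doubled interval, so \<open>x \<sqinter> y\<close> does as well and must contain
  \<open>m\<close>, and with it \<open>?v\<close>: a contradiction.\<close>

lemma join_semidistributive:
  assumes C: "x \<in> C" "y \<in> C" "z \<in> C" and e: "x \<squnion> z = y \<squnion> z"
  shows "(x \<sqinter> y) \<squnion> z = x \<squnion> z"
proof (rule ccontr)
  let ?w = "x \<squnion> z" and ?v = "(x \<sqinter> y) \<squnion> z"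
  assume ne: "?v \<noteq> ?w"
  have wC: "?w \<in> C" and vC: "?v \<in> C" and xyC: "x \<sqinter> y \<in> C"
    using C by auto
  have hw: "h x \<subseteq> h ?w" "h y \<subseteq> h ?w" "h z \<subseteq> h ?w"
    using h_join_ge[OF C(1,3)] h_join_ge[OF C(2,3)] e by auto
  have "h (x \<sqinter> y) \<subseteq> h ?w" using h_meet_le[OF C(1,2)] hw by auto
  then have "h ?v \<subseteq> h ?w" using h_join_least[OF xyC C(3) wC] hw by simp
  then have le: "?v \<sqsubseteq> ?w" using le_iff vC wC by simp
  obtain m where m: "m < N" "m \<in> h ?w" "m \<notin> h ?v" "split_at m ?v" "split_at m ?w"
    using first_difference[OF vC wC le ne] by metis
  have z: "m \<notin> h z" "m \<notin> h (x \<sqinter> y)" using m bit_join[OF xyC C(3) m(1)] by auto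
  have Dw: "D m (h ?w)" using m by (simp add: split_at_def)
  have mx: "m \<in> h x" using m z Dw bit_join[OF C(1,3) m(1)] by auto
  have my: "m \<in> h y" using m z Dw e bit_join[OF C(2,3) m(1)] by auto
  have "D m (h x)" "D m (h y)" using Dw D_sub hw by blast+
  then have "split_at m x" "split_at m y" using C h_UD mx my by (auto simp: split_at_def)
  then have "U m (h (x \<sqinter> y))" using split_at_meet C m by (auto simp: split_at_def)
  then have "m \<in> h (x \<sqinter> y)" using bit_meet[OF C(1,2) m(1)] mx my by simp
  then show False using z by simp
qed

text \<open>The element \<open>w\<close> carries the freedom at the failing bit \<open>m\<close>
  over to \<open>x\<close>. If \<open>x\<close> is below \<open>w\<close>, then \<open>D m\<close>
  holds at \<open>?u \<squnion> w\<close> and hence at \<open>?yx\<close>, so \<open>m\<close> is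
  not forced there and comes from \<open>x\<close>. Now \<open>x\<close> itself lies in the doubled
  interval, \<open>U m\<close> holds at \<open>?v \<sqinter> x\<close>, hence at \<open>?xz\<close>,
  and \<open>m\<close> belongs to \<open>?xz\<close> after all. If \<open>w\<close> is below
  \<open>x\<close>, the dual argument applies.\<close>

lemma left_modular_elementI:
  assumes x: "x \<in> C"
    and comp: "\<And>m. m < N \<Longrightarrow> \<exists>w\<in>C. split_at m w \<and> (h x \<subseteq> h w \<or> h w \<subseteq> h x)"
  shows "left_modular_element L x"
  unfolding left_modular_element_def
proof (intro conjI ballI impI x)
  fix y z assume C: "y \<in> C" "z \<in> C" "y \<sqsubseteq> z"
  let ?xz = "x \<sqinter> z" and ?yx = "y \<squnion> x"
  let ?u = "y \<squnion> ?xz" and ?v = "?yx \<sqinter> z"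
  have xzC: "?xz \<in> C" and yxC: "?yx \<in> C"
    and uC: "?u \<in> C" and vC: "?v \<in> C" using x C by auto
  have yz: "h y \<subseteq> h z" using C le_iff by simp
  note xz = h_meet_le[OF x C(2)] and yx = h_join_ge[OF C(1) x]
    and u = h_join_ge[OF C(1) xzC] and v = h_meet_le[OF yxC C(2)]
  have "h ?u \<subseteq> h ?yx" "h ?u \<subseteq> h z"
    using h_join_least[OF C(1) xzC yxC] h_join_least[OF C(1) xzC C(2)] xz yx yz by auto
  then have "h ?u \<subseteq> h ?v" using h_meet_greatest[OF yxC C(2) uC] by simp
  then have le: "?u \<sqsubseteq> ?v" using le_iff uC vC by simp
  show "?v = ?u"
  proof (rule ccontr)
    assume "?v \<noteq> ?u"
    then obtain m where m: "m < N" "m \<in> h ?v" "m \<notin> h ?u" "split_at m ?u" "split_at m ?v"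
      using first_difference[OF uC vC le] by metis
    have mz: "m \<in> h z" "m \<in> h ?yx" using m v by auto
    have my: "m \<notin> h y" "m \<notin> h ?xz" using m u by auto
    from comp[OF m(1)] obtain w where w: "w \<in> C" "split_at m w" "h x \<subseteq> h w \<or> h w \<subseteq> h x"
      by auto
    have uxC: "?u \<squnion> x \<in> C" and vxC: "?v \<sqinter> x \<in> C"
      and uwC: "?u \<squnion> w \<in> C" and vwC: "?v \<sqinter> w \<in> C"
      using x w uC vC by auto
    have yu: "h ?yx \<subseteq> h (?u \<squnion> x)"
      using h_join_least[OF C(1) x uxC] h_join_ge[OF uC x] u by auto
    have vx: "h (?v \<sqinter> x) \<subseteq> h ?xz"
      using h_meet_greatest[OF x C(2) vxC] h_meet_le[OF vC x] v by auto
    from w(3) show False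
    proof
      assume xw: "h x \<subseteq> h w"
      have "h (?u \<squnion> x) \<subseteq> h (?u \<squnion> w)"
        using h_join_least[OF uC x uwC] h_join_ge[OF uC w(1)] xw by auto
      moreover have "D m (h (?u \<squnion> w))"
        using split_at_join[OF uC w(1) m(1)] m w by (simp add: split_at_def)
      ultimately have "D m (h ?yx)" using yu D_sub by blast
      then have mx: "m \<in> h x" using mz my bit_join[OF C(1) x m(1)] by auto
      have "D m (h x)" using w xw D_sub by (auto simp: split_at_def)
      then have "split_at m x" using h_UD x mx by (auto simp: split_at_def)
      then have "U m (h (?v \<sqinter> x))"
        using split_at_meet[OF vC x m(1)] m by (simp add: split_at_def)
      then have "U m (h ?xz)" using U_sub vx by blast
      then show False using my mx mz bit_meet[OF x C(2) m(1)] by auto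
    next
      assume wx: "h w \<subseteq> h x"
      have "h (?v \<sqinter> w) \<subseteq> h (?v \<sqinter> x)"
        using h_meet_greatest[OF vC x vwC] h_meet_le[OF vC w(1)] wx by auto
      moreover have "U m (h (?v \<sqinter> w))"
        using split_at_meet[OF vC w(1) m(1)] m w by (simp add: split_at_def)
      ultimately have "U m (h ?xz)" using vx U_sub by blast
      then have mx: "m \<notin> h x" using mz my bit_meet[OF x C(2) m(1)] by auto
      have "U m (h x)" using w wx U_sub by (auto simp: split_at_def)
      then have "split_at m x" using h_UD x mx m by (auto simp: split_at_def)
      then have "D m (h (?u \<squnion> x))"
        using split_at_join[OF uC x m(1)] m by (simp add: split_at_def)
      then have "D m (h ?yx)" using D_sub yu by blast
      then show False using my mx mz bit_join[OF C(1) x m(1)] by auto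
    qed
  qed
qed

end

section \<open>Join-irreducible elements and congruences\<close>

context doubling
begin

lemma cut_Suc_eq: "cut (Suc m) S = cut (Suc m) T \<longleftrightarrow> cut m S = cut m T \<and> (m \<in> S \<longleftrightarrow> m \<in> T)"
  unfolding set_eq_iff Int_iff lessThan_iff less_Suc_eq by auto

lemma join_bits_cong:
  "cut m S = cut m S' \<Longrightarrow> cut m T = cut m T' \<Longrightarrow> join_bits m S T = join_bits m S' T'"
proof (induction m)
  case (Suc m)
  have "i \<in> S \<longleftrightarrow> i \<in> S'" "i \<in> T \<longleftrightarrow> i \<in> T'" if "i < Suc m" for i
    using that Suc(2,3) by (metis IntD1 IntI lessThan_iff)+
  then have e: "cut m S = cut m S'" "cut m T = cut m T'" "m \<in> S \<longleftrightarrow> m \<in> S'" "m \<in> T \<longleftrightarrow> m \<in> T'"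
    by auto
  show ?case using Suc.IH[OF e(1,2)] e(3,4) by simp
qed simp

lemma meet_bits_cong:
  "cut m S = cut m S' \<Longrightarrow> cut m T = cut m T' \<Longrightarrow> meet_bits m S T = meet_bits m S' T'"
proof (induction m)
  case (Suc m)
  have "i \<in> S \<longleftrightarrow> i \<in> S'" "i \<in> T \<longleftrightarrow> i \<in> T'" if "i < Suc m" for i
    using that Suc(2,3) by (metis IntD1 IntI lessThan_iff)+
  then have e: "cut m S = cut m S'" "cut m T = cut m T'" "m \<in> S \<longleftrightarrow> m \<in> S'" "m \<in> T \<longleftrightarrow> m \<in> T'"
    by auto
  show ?case using Suc.IH[OF e(1,2)] e(3,4) by simp
qed simp

end

lemma lattice_congruence_Int:
  assumes "lattice_congruence L \<alpha>" "lattice_congruence L \<beta>"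
  shows "lattice_congruence L (\<alpha> \<inter> \<beta>)"
proof -
  have "equiv (carrier L) (\<alpha> \<inter> \<beta>)"
    using assms unfolding lattice_congruence_def
    by (auto intro!: equivI refl_onI symI transI
        dest: equiv_class_eq_iff[THEN iffD1] elim: equivE refl_onD symE transE)
  then show ?thesis using assms unfolding lattice_congruence_def by auto
qed

lemma covers_Con_iff:
  "covers (Con L) \<theta> \<beta> \<longleftrightarrow> lattice_congruence L \<theta> \<and> lattice_congruence L \<beta> \<and> \<beta> \<subset> \<theta> \<and>
    \<not> (\<exists>\<alpha>. lattice_congruence L \<alpha> \<and> \<beta> \<subset> \<alpha> \<and> \<alpha> \<subset> \<theta>)"
  unfolding covers_def lless_def Con_def by auto

context doubled_lattice
begin

lemma less_iff: "x \<in> C \<Longrightarrow> y \<in> C \<Longrightarrow> x \<sqsubset> y \<longleftrightarrow> h x \<subset> h y"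
  using h_inj[of x y] by (auto simp: lless_eq le_iff)

lemma covers_iff:
  "covers L y x \<longleftrightarrow> x \<in> C \<and> y \<in> C \<and> h x \<subset> h y \<and> \<not> (\<exists>z\<in>C. h x \<subset> h z \<and> h z \<subset> h y)"
  unfolding covers_def by (auto simp: less_iff)

lemma finite_h: "x \<in> C \<Longrightarrow> finite (h x)"
  using h_subset finite_subset by blast

lemma join_of_le: "x \<in> C \<Longrightarrow> y \<in> C \<Longrightarrow> h x \<subseteq> h y \<Longrightarrow> x \<squnion> y = y \<and> y \<squnion> x = y"
  using le_iff_meet[of x y] le_iff[of x y] join_comm[of L x y] by metis

lemma meet_of_le: "x \<in> C \<Longrightarrow> y \<in> C \<Longrightarrow> h x \<subseteq> h y \<Longrightarrow> x \<sqinter> y = x \<and> y \<sqinter> x = x"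
  using le_iff_join[of x y] le_iff[of x y] meet_comm[of L x y] by metis

lemma meet_closed_minimum:
  assumes "A \<subseteq> C" "A \<noteq> {}" "\<And>x y. x \<in> A \<Longrightarrow> y \<in> A \<Longrightarrow> x \<sqinter> y \<in> A"
  shows "\<exists>j\<in>A. \<forall>z\<in>A. h j \<subseteq> h z"
proof -
  have "finite A" using assms(1) finite_L finite_subset by blast
  then obtain j where j: "is_arg_min (\<lambda>x. card (h x)) (\<lambda>x. x \<in> A) j"
    using ex_is_arg_min_if_finite[OF _ assms(2)] by blast
  have "h j \<subseteq> h z" if "z \<in> A" for z
  proof -
    have jA: "j \<in> A" using j by (simp add: is_arg_min_def)
    have jC: "j \<in> C" "z \<in> C" using jA that assms(1) by auto
    have "card (h j) \<le> card (h (j \<sqinter> z))"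
      using j assms(3)[OF jA that] by (simp add: is_arg_min_linorder)
    then have "h (j \<sqinter> z) = h j"
      by (intro card_seteq finite_h jC h_meet_le)
    then show ?thesis using h_meet_le(2)[OF jC] by simp
  qed
  then show ?thesis using j by (auto simp: is_arg_min_def)
qed

lemma join_closed_maximum:
  assumes "A \<subseteq> C" "A \<noteq> {}" "\<And>x y. x \<in> A \<Longrightarrow> y \<in> A \<Longrightarrow> x \<squnion> y \<in> A"
  shows "\<exists>j\<in>A. \<forall>z\<in>A. h z \<subseteq> h j"
proof -
  have "finite A" using assms(1) finite_L finite_subset by blast
  then obtain j where j: "is_arg_min (\<lambda>x. - int (card (h x))) (\<lambda>x. x \<in> A) j"
    using ex_is_arg_min_if_finite[OF _ assms(2)] by blast
  have "h z \<subseteq> h j" if "z \<in> A" for z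
  proof -
    have jA: "j \<in> A" using j by (simp add: is_arg_min_def)
    have jC: "j \<in> C" "z \<in> C" using jA that assms(1) by auto
    have "card (h (j \<squnion> z)) \<le> card (h j)"
      using j assms(3)[OF jA that] by (simp add: is_arg_min_linorder)
    then have "h j = h (j \<squnion> z)"
      using jC by (intro card_seteq finite_h join_closed h_join_ge)
    then show ?thesis using h_join_ge(2)[OF jC] by simp
  qed
  then show ?thesis using j by (auto simp: is_arg_min_def)
qed

text \<open>The cover of \<open>k\<close> by the join-irreducible \<open>j\<close> has the first changed bit \<open>m\<close>.\<close>

definition labels :: "nat \<Rightarrow> 'a \<Rightarrow> 'a \<Rightarrow> bool" where
  "labels m j k \<longleftrightarrow> j \<in> C \<and> k \<in> C \<and> m \<in> h j \<and> m \<notin> h k \<and> pre m j = pre m k \<and>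
    h k \<subset> h j \<and> (\<forall>z\<in>C. h z \<subset> h j \<longrightarrow> h z \<subseteq> h k) \<and>
    (\<forall>z\<in>C. split_at m z \<and> m \<in> h z \<longrightarrow> h j \<subseteq> h z)"

lemma labelD:
  assumes "labels m j k"
  shows "j \<in> C" "k \<in> C" "m \<in> h j" "m \<notin> h k" "pre m j = pre m k" "h k \<subset> h j"
    "z \<in> C \<Longrightarrow> h z \<subset> h j \<Longrightarrow> h z \<subseteq> h k"
    "z \<in> C \<Longrightarrow> split_at m z \<Longrightarrow> m \<in> h z \<Longrightarrow> h j \<subseteq> h z"
  using assms unfolding labels_def by simp_all

text \<open>Here \<open>j\<close> is the least element that contains the bottom \<open>p\<close> of
  the doubled interval and the bit \<open>m\<close>; it exists because \<open>U m p\<close> makes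
  these elements closed under meets. An element strictly below \<open>j\<close> that contained
  \<open>m\<close> would split at \<open>m\<close> and undercut \<open>j\<close>. So the elements
  strictly below \<open>j\<close> all lack \<open>m\<close>, and since \<open>D m\<close> holds at
  \<open>j\<close> they have a greatest one, namely \<open>k\<close>.\<close>

lemma labels_exists:
  assumes "m < N"
  shows "\<exists>j k. labels m j k"
proof -
  obtain p q where pF: "p \<in> F m" and qF: "q \<in> F m" and pq: "p \<subseteq> q" and pU: "U m p" and pD: "D m p"
    and sp: "\<And>x. x \<in> C \<Longrightarrow> split_at m x \<longleftrightarrow> p \<subseteq> h x \<and> pre m x \<subseteq> q"
    using split_at_obtain[OF assms] by metis
  have pm: "p \<subseteq> {..<m}" using tower_subset pF .
  obtain z1 where z1: "z1 \<in> C" "pre (Suc m) z1 = insert m p"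
    using extend[OF tower_insert[OF pF pU], of N] h_surj assms by (metis Suc_leI)
  obtain z0 where z0: "z0 \<in> C" "pre (Suc m) z0 = p"
    using extend[OF tower_same[OF pF pD], of N] h_surj assms by (metis Suc_leI)
  have mz1: "m \<in> h z1" and mz0: "m \<notin> h z0" and cz1: "pre m z1 = p" and cz0: "pre m z0 = p"
    using z1 z0 pm by (auto simp: cut_Suc split: if_splits)
  define A where "A = {z \<in> C. p \<subseteq> h z \<and> m \<in> h z}"
  have "x \<sqinter> y \<in> A" if "x \<in> A" "y \<in> A" for x y
  proof -
    from that have xy: "x \<in> C" "y \<in> C" "p \<subseteq> h x" "p \<subseteq> h y" "m \<in> h x" "m \<in> h y" by (auto simp: A_def)
    have "p \<subseteq> h (x \<sqinter> y)"
      using cut_meet_greatest[OF xy(1,2) less_imp_le[OF assms] pF] xy by simp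
    moreover from this have "m \<in> h (x \<sqinter> y)"
      using bit_meet[OF xy(1,2) assms] U_sub pU xy by blast
    ultimately show ?thesis using xy by (simp add: A_def)
  qed
  moreover have "z1 \<in> A" using z1 cz1 mz1 by (auto simp: A_def)
  ultimately obtain j where j: "j \<in> A" "\<And>z. z \<in> A \<Longrightarrow> h j \<subseteq> h z"
    using meet_closed_minimum[of A] by (auto simp: A_def)
  have jC: "j \<in> C" and mj: "m \<in> h j" and pj: "p \<subseteq> h j" using j by (auto simp: A_def)
  have cj: "pre m j = p" using j(2)[OF \<open>z1 \<in> A\<close>] cz1 pj pm by auto
  have Dj: "D m (h j)" using D_cong[of "h j" m p] cj pD pm by auto
  have below: "m \<notin> h z" if z: "z \<in> C" "h z \<subset> h j" for z
  proof
    assume "m \<in> h z"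
    then have "split_at m z" using h_UD(1)[OF z(1)] D_sub[OF _ Dj] z by (auto simp: split_at_def)
    then have "z \<in> A" using sp z \<open>m \<in> h z\<close> by (auto simp: A_def)
    then show False using j(2) z by blast
  qed
  define B where "B = {z \<in> C. h z \<subseteq> h j \<and> m \<notin> h z}"
  have "x \<squnion> y \<in> B" if "x \<in> B" "y \<in> B" for x y
  proof -
    from that have xy: "x \<in> C" "y \<in> C" "h x \<subseteq> h j" "h y \<subseteq> h j" "m \<notin> h x" "m \<notin> h y"
      by (auto simp: B_def)
    have "h (x \<squnion> y) \<subseteq> h j" using h_join_least[OF xy(1,2) jC] xy by simp
    moreover from this have "m \<notin> h (x \<squnion> y)"
      using bit_join[OF xy(1,2) assms] D_sub Dj xy by blast
    ultimately show ?thesis using xy by (simp add: B_def)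
  qed
  moreover
  have zj: "z0 \<sqinter> j \<in> B" "p \<subseteq> h (z0 \<sqinter> j)"
  proof -
    show "p \<subseteq> h (z0 \<sqinter> j)"
      using cut_meet_greatest[OF z0(1) jC less_imp_le[OF assms] pF] pj cz0 by auto
    show "z0 \<sqinter> j \<in> B" using h_meet_le[OF z0(1) jC] z0 jC mz0 by (auto simp: B_def)
  qed
  ultimately obtain k where k: "k \<in> B" "\<And>z. z \<in> B \<Longrightarrow> h z \<subseteq> h k"
    using join_closed_maximum[of B] by (auto simp: B_def)
  have kC: "k \<in> C" "h k \<subseteq> h j" "m \<notin> h k" using k by (auto simp: B_def)
  have "p \<subseteq> h k" using zj k by blast
  then have ck: "pre m j = pre m k" using cj kC pm by auto
  have "labels m j k"
    unfolding labels_def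
  proof (intro conjI ballI impI)
    fix z assume z: "z \<in> C"
    show "h z \<subseteq> h k" if "h z \<subset> h j"
      using k(2)[of z] below[OF z] that z by (auto simp: B_def)
    show "h j \<subseteq> h z" if "split_at m z \<and> m \<in> h z"
      using j(2)[of z] sp[OF z] that z by (auto simp: A_def)
  qed (use jC kC mj ck in auto)
  then show ?thesis by blast
qed

lemma labels_split: "m < N \<Longrightarrow> labels m j k \<Longrightarrow> split_at m j \<and> split_at m k"
  unfolding labels_def split_at_def using h_UD U_cong D_cong by metis

lemma labels_unique:
  assumes "m < N" "labels m j k" "labels m j' k'"
  shows "j = j'" "k = k'"
proof -
  note a = labelD[OF assms(2)] and b = labelD[OF assms(3)]
  have "h j \<subseteq> h j'" "h j' \<subseteq> h j"
    using a(8)[OF b(1) _ b(3)] b(8)[OF a(1) _ a(3)] labels_split[OF assms(1,2)] labels_split[OF assms(1,3)]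
    by simp_all
  then show j: "j = j'" using h_inj[OF a(1) b(1)] by simp
  have "h k \<subseteq> h k'" "h k' \<subseteq> h k" using a(7)[OF b(2)] b(7)[OF a(2)] a(6) b(6) j by simp_all
  then show "k = k'" using h_inj[OF a(2) b(2)] by simp
qed

lemma labels_index_unique: "labels m j k \<Longrightarrow> labels m' j k \<Longrightarrow> m = m'"
  unfolding labels_def by (metis IntD1 IntI lessThan_iff linorder_neqE_nat)

lemma labels_join_irreducible:
  assumes "labels m j k"
  shows "join_irreducible L j" "lower_cover L j = k"
proof -
  have cov: "covers L j x \<longleftrightarrow> x = k" for x
  proof
    assume "covers L j x"
    then have x: "x \<in> C" "h x \<subset> h j" "\<And>z. z \<in> C \<Longrightarrow> h x \<subset> h z \<Longrightarrow> \<not> h z \<subset> h j"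
      by (auto simp: covers_iff)
    have "h x \<subseteq> h k" using labelD(7)[OF assms x(1,2)] .
    then have "h x = h k" using x(3)[OF labelD(2)[OF assms]] labelD(6)[OF assms] by blast
    then show "x = k" using h_inj[OF x(1) labelD(2)[OF assms]] by simp
  next
    assume "x = k"
    moreover have "\<not> h z \<subset> h j" if "z \<in> C" "h k \<subset> h z" for z
      using labelD(7)[OF assms that(1)] that(2) by auto
    ultimately show "covers L j x" using labelD(1,2,6)[OF assms] by (auto simp: covers_iff)
  qed
  then show "join_irreducible L j" "lower_cover L j = k"
    using assms by (simp_all add: join_irreducible_def lower_cover_def labels_def)
qed

lemma lower_cover_above:
  assumes "j \<in> C" "z \<in> C" "h z \<subset> h j"
  obtains w where "covers L j w" "h z \<subseteq> h w"
proof -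
  let ?A = "{w \<in> C. h z \<subseteq> h w \<and> h w \<subset> h j}"
  have "finite ?A" "?A \<noteq> {}" using finite_L assms by auto
  then obtain w where w: "is_arg_min (\<lambda>x. - int (card (h x))) (\<lambda>x. x \<in> ?A) w"
    using ex_is_arg_min_if_finite by blast
  have wA: "w \<in> ?A" using w by (simp add: is_arg_min_def)
  have "\<not> (h w \<subset> h y \<and> h y \<subset> h j)" if "y \<in> C" for y
  proof
    assume y: "h w \<subset> h y \<and> h y \<subset> h j"
    then have "y \<in> ?A" using that wA by auto
    then have "card (h y) \<le> card (h w)" using w by (simp add: is_arg_min_linorder)
    then show False using y psubset_card_mono[OF finite_h[OF that], of "h w"] by simp
  qed
  then have "covers L j w" using wA assms(1) unfolding covers_iff by simp
  then show thesis using that wA by simp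
qed

text \<open>Take the first bit \<open>m\<close> in which \<open>j\<close> differs from its lower
  cover. The element \<open>j'\<close> that belongs to \<open>m\<close> is below \<open>j\<close>;
  if it were strictly below, it would be below the only lower cover, which lacks
  \<open>m\<close>.\<close>

lemma join_irreducible_labels:
  assumes "join_irreducible L j"
  obtains m where "m < N" "labels m j (lower_cover L j)"
proof -
  obtain x where x: "covers L j x" "\<And>y. covers L j y \<Longrightarrow> y = x"
    using assms unfolding join_irreducible_def by blast
  have C: "x \<in> C" "j \<in> C" "h x \<subset> h j" using x(1) unfolding covers_iff by auto
  obtain m where m: "m < N" "m \<in> h j" "m \<notin> h x" "split_at m j"
    using first_difference[OF C(1,2)] C(3) le_iff[OF C(1,2)] by (metis psubset_imp_subset psubsetE)
  obtain j' k where k: "labels m j' k" using labels_exists[OF m(1)] by blast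
  have "j' \<in> C" "h j' \<subseteq> h j" "m \<in> h j'" using labelD(1,3)[OF k] labelD(8)[OF k C(2) m(4,2)] by auto
  have "j' = j"
  proof (rule ccontr)
    assume "j' \<noteq> j"
    then have "h j' \<subset> h j" using \<open>h j' \<subseteq> h j\<close> h_inj[OF \<open>j' \<in> C\<close> C(2)] by blast
    then obtain w where "covers L j w" "h j' \<subseteq> h w"
      using lower_cover_above[OF C(2) \<open>j' \<in> C\<close>] by blast
    then show False using x(2) m \<open>m \<in> h j'\<close> by blast
  qed
  then have "labels m j (lower_cover L j)" using k labels_join_irreducible(2) by blast
  with m(1) that show thesis by blast
qed

definition ji_at :: "nat \<Rightarrow> 'a" where
  "ji_at m = (SOME j. \<exists>k. labels m j k)"

lemma ji_at: "m < N \<Longrightarrow> labels m (ji_at m) (lower_cover L (ji_at m))"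
proof -
  assume "m < N"
  then have "\<exists>k. labels m (ji_at m) k" unfolding ji_at_def by (rule someI_ex[OF labels_exists])
  then show ?thesis using labels_join_irreducible(2) by blast
qed

lemma bij_ji_at: "bij_betw ji_at {..<N} {j. join_irreducible L j}"
proof (rule bij_betw_imageI)
  show "inj_on ji_at {..<N}"
  proof (rule inj_onI)
    fix a b assume "a \<in> {..<N}" "b \<in> {..<N}" "ji_at a = ji_at b"
    then show "a = b" using ji_at[of a] ji_at[of b] labels_index_unique by simp
  qed
  have "join_irreducible L (ji_at m)" if "m < N" for m
    using labels_join_irreducible(1)[OF ji_at[OF that]] .
  moreover have "j \<in> ji_at ` {..<N}" if j: "join_irreducible L j" for j
  proof -
    obtain m where m: "m < N" "labels m j (lower_cover L j)" using join_irreducible_labels[OF j] .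
    then show ?thesis using labels_unique(1)[OF m ji_at[OF m(1)]] by blast
  qed
  ultimately show "ji_at ` {..<N} = {j. join_irreducible L j}" by auto
qed

lemma card_join_irreducible: "card {j. join_irreducible L j} = N"
  using bij_betw_same_card[OF bij_ji_at] by simp

section \<open>Congruences and the covers they collapse\<close>

lemma congD:
  assumes "lattice_congruence L \<theta>"
  shows "x \<in> C \<Longrightarrow> (x, x) \<in> \<theta>" "(x, y) \<in> \<theta> \<Longrightarrow> (y, x) \<in> \<theta>"
    "(x, y) \<in> \<theta> \<Longrightarrow> (y, z) \<in> \<theta> \<Longrightarrow> (x, z) \<in> \<theta>" "(x, y) \<in> \<theta> \<Longrightarrow> x \<in> C \<and> y \<in> C"
    "(x, y) \<in> \<theta> \<Longrightarrow> z \<in> C \<Longrightarrow> (x \<sqinter> z, y \<sqinter> z) \<in> \<theta>"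
    "(x, y) \<in> \<theta> \<Longrightarrow> z \<in> C \<Longrightarrow> (x \<squnion> z, y \<squnion> z) \<in> \<theta>"
proof -
  have e: "equiv C \<theta>" using assms by (simp add: lattice_congruence_def)
  show r: "x \<in> C \<Longrightarrow> (x, x) \<in> \<theta>" for x using e by (auto simp: equiv_def refl_on_def)
  show "(x, y) \<in> \<theta> \<Longrightarrow> (y, x) \<in> \<theta>" using e by (auto simp: equiv_def sym_def)
  show "(x, y) \<in> \<theta> \<Longrightarrow> (y, z) \<in> \<theta> \<Longrightarrow> (x, z) \<in> \<theta>" using e unfolding equiv_def trans_def by blast
  show "(x, y) \<in> \<theta> \<Longrightarrow> x \<in> C \<and> y \<in> C"
    using e equiv_type[OF e] by auto
  show "(x, y) \<in> \<theta> \<Longrightarrow> z \<in> C \<Longrightarrow> (x \<sqinter> z, y \<sqinter> z) \<in> \<theta>"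
    using assms r[of z] unfolding lattice_congruence_def by blast
  show "(x, y) \<in> \<theta> \<Longrightarrow> z \<in> C \<Longrightarrow> (x \<squnion> z, y \<squnion> z) \<in> \<theta>"
    using assms r[of z] unfolding lattice_congruence_def by blast
qed

lemma congruence_full: "lattice_congruence L (C \<times> C)"
  unfolding lattice_congruence_def
  by (auto intro!: equivI refl_onI symI transI)

lemma congruence_con:
  assumes "x \<in> C" "y \<in> C"
  shows "lattice_congruence L (con L x y)" "(x, y) \<in> con L x y"
proof -
  let ?S = "{\<theta>. lattice_congruence L \<theta> \<and> (x, y) \<in> \<theta>}"
  have full: "C \<times> C \<in> ?S" using congruence_full assms by simp
  have "equiv C (\<Inter> ?S)"
  proof (rule equivI)
    show "\<Inter> ?S \<subseteq> C \<times> C" using full by blast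
    show "refl_on C (\<Inter> ?S)" using congD(1) by (auto intro!: refl_onI)
    show "sym (\<Inter> ?S)" using congD(2) by (auto intro!: symI)
    show "trans (\<Inter> ?S)"
    proof (rule transI, rule InterI)
      fix a b c \<theta> assume "(a, b) \<in> \<Inter> ?S" "(b, c) \<in> \<Inter> ?S" "\<theta> \<in> ?S"
      then have "(a, b) \<in> \<theta>" "(b, c) \<in> \<theta>" "lattice_congruence L \<theta>" by auto
      then show "(a, c) \<in> \<theta>" using congD(3) by blast
    qed
  qed
  moreover have "(a \<sqinter> c, b \<sqinter> d) \<in> \<Inter> ?S \<and> (a \<squnion> c, b \<squnion> d) \<in> \<Inter> ?S"
    if "(a, b) \<in> \<Inter> ?S" "(c, d) \<in> \<Inter> ?S" for a b c d
  proof -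
    have "(a \<sqinter> c, b \<sqinter> d) \<in> \<theta> \<and> (a \<squnion> c, b \<squnion> d) \<in> \<theta>" if "\<theta> \<in> ?S" for \<theta>
    proof -
      have "(a, b) \<in> \<theta>" "(c, d) \<in> \<theta>" using \<open>(a, b) \<in> \<Inter> ?S\<close> \<open>(c, d) \<in> \<Inter> ?S\<close> that by blast+
      then show ?thesis using that unfolding lattice_congruence_def by blast
    qed
    then show ?thesis by blast
  qed
  ultimately show "lattice_congruence L (con L x y)"
    unfolding con_def lattice_congruence_def by blast
qed (auto simp: con_def)

lemma con_least: "lattice_congruence L \<theta> \<Longrightarrow> (x, y) \<in> \<theta> \<Longrightarrow> con L x y \<subseteq> \<theta>"
  unfolding con_def by blast

text \<open>Meeting the pair with \<open>j\<close> turns \<open>y\<close> into \<open>j\<close> and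
  \<open>x\<close> into something strictly below \<open>j\<close>, hence below \<open>k\<close>;
  joining with \<open>k\<close> then leaves exactly \<open>(k, j)\<close>.\<close>

lemma congruence_collapses_labels:
  assumes \<alpha>: "lattice_congruence L \<alpha>" and k: "labels m j k" "m < N"
    and xy: "(x, y) \<in> \<alpha>" "m \<in> h y" "m \<notin> h x" "split_at m y"
  shows "(k, j) \<in> \<alpha>"
proof -
  have C: "x \<in> C" "y \<in> C" "j \<in> C" "k \<in> C" using congD(4)[OF \<alpha> xy(1)] labelD(1,2)[OF k(1)] by auto
  have "h j \<subseteq> h y" using labelD(8)[OF k(1) C(2) xy(4,2)] .
  then have yj: "y \<sqinter> j = j" using meet_of_le[OF C(3,2)] by simp
  have "h (x \<sqinter> j) \<subset> h j"
    using h_meet_le[OF C(1,3)] xy(3) labelD(3)[OF k(1)] by blast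
  then have "h (x \<sqinter> j) \<subseteq> h k" using labelD(7)[OF k(1) meet_closed[OF C(1,3)]] by simp
  then have "(x \<sqinter> j) \<squnion> k = k" using join_of_le[OF meet_closed[OF C(1,3)] C(4)] by simp
  moreover have "j \<squnion> k = j" using join_of_le[OF C(4,3)] labelD(6)[OF k(1)] by simp
  moreover have "(x \<sqinter> j, j) \<in> \<alpha>" using congD(5)[OF \<alpha> xy(1) C(3)] yj by simp
  ultimately show ?thesis using congD(6)[OF \<alpha> _ C(4)] by metis
qed

text \<open>With \<open>m\<close> the first changed bit, \<open>k \<squnion> x\<close> still lacks
  \<open>m\<close> and \<open>j \<squnion> x\<close> has it. Both lie between \<open>x\<close> and
  \<open>y\<close>, so they equal \<open>x\<close> and \<open>y\<close>: the two covers are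
  perspective and collapse together.\<close>

lemma cover_con:
  assumes "covers L y x"
  obtains m where "m < N" "\<And>j k. labels m j k \<Longrightarrow> con L x y = con L k j"
proof -
  have C: "x \<in> C" "y \<in> C" "h x \<subset> h y" using assms unfolding covers_iff by auto
  obtain m where m: "m < N" "m \<in> h y" "m \<notin> h x" "pre m x = pre m y" "split_at m x" "split_at m y"
    using first_difference[OF C(1,2)] C(3) le_iff[OF C(1,2)] by (metis psubset_imp_subset psubsetE)
  have "con L x y = con L k j" if k: "labels m j k" for j k
  proof
    have K: "j \<in> C" "k \<in> C" "m \<notin> h k" "h k \<subseteq> h j" "h j \<subseteq> h y" "m \<in> h j"
      using labelD(1-4,6)[OF k] labelD(8)[OF k C(2) m(6,2)] by auto
    have "(k, j) \<in> con L x y"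
      using congruence_collapses_labels[OF congruence_con(1) k m(1) congruence_con(2)] C m by blast
    then show "con L k j \<subseteq> con L x y" using con_least congruence_con C by blast
    have "h (k \<squnion> x) \<subseteq> h y" using h_join_least[OF K(2) C(1,2)] K C by auto
    moreover from this have "D m (h (k \<squnion> x))" using D_sub m(6) by (auto simp: split_at_def)
    then have "m \<notin> h (k \<squnion> x)" using bit_join[OF K(2) C(1) m(1)] K m by simp
    ultimately have "h (k \<squnion> x) \<subset> h y" using m by blast
    moreover have "h x \<subseteq> h (k \<squnion> x)" using h_join_ge[OF K(2) C(1)] by simp
    ultimately have "h (k \<squnion> x) = h x"
      using assms join_closed[OF K(2) C(1)] unfolding covers_iff by blast
    then have kx: "k \<squnion> x = x" using h_inj K C by simp
    have "h (j \<squnion> x) \<subseteq> h y" using h_join_least[OF K(1) C(1,2)] K C by auto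
    moreover have "h x \<subset> h (j \<squnion> x)" using h_join_ge[OF K(1) C(1)] K m by blast
    ultimately have "h (j \<squnion> x) = h y"
      using assms join_closed[OF K(1) C(1)] unfolding covers_iff by blast
    then have jx: "j \<squnion> x = y" using h_inj K C by simp
    have "(x, y) \<in> con L k j"
      using congD(6)[OF congruence_con(1)[OF K(2,1)] congruence_con(2)[OF K(2,1)] C(1)] kx jx by simp
    then show "con L x y \<subseteq> con L k j" using con_least congruence_con K by blast
  qed
  then show thesis using that m by blast
qed

text \<open>The kernel of the restriction to level \<open>m\<close>. These congruences shrink as
  \<open>m\<close> grows, and they tell the labels of different levels apart.\<close>

definition agree :: "nat \<Rightarrow> ('a \<times> 'a) set" where
  "agree m = {(x, y). x \<in> C \<and> y \<in> C \<and> pre m x = pre m y}"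

lemma congruence_agree:
  assumes "m \<le> N"
  shows "lattice_congruence L (agree m)"
proof -
  have "equiv C (agree m)"
    by (auto simp: agree_def intro!: equivI refl_onI symI transI)
  moreover have "pre m (a \<sqinter> c) = pre m (b \<sqinter> d) \<and> pre m (a \<squnion> c) = pre m (b \<squnion> d)"
    if "a \<in> C" "b \<in> C" "c \<in> C" "d \<in> C" "pre m a = pre m b" "pre m c = pre m d"
    for a b c d
    using that by (simp add: h_join h_meet cut_join_bits[OF assms] cut_meet_bits[OF assms] join_bits_cong[OF that(5,6)]
        meet_bits_cong[OF that(5,6)])
  ultimately show ?thesis unfolding lattice_congruence_def agree_def by auto
qed

lemma con_labels_agree:
  assumes "m < N" "labels m j k"
  shows "con L k j \<subseteq> agree m" "(k, j) \<notin> agree (Suc m)"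
proof -
  have "(k, j) \<in> agree m" using assms(2) by (auto simp: agree_def labels_def)
  then show "con L k j \<subseteq> agree m" using con_least congruence_agree assms(1) by simp
  show "(k, j) \<notin> agree (Suc m)" using labelD(3,4)[OF assms(2)] by (simp add: agree_def cut_Suc_eq)
qed

lemma agree_mono: "m \<le> n \<Longrightarrow> agree n \<subseteq> agree m"
proof
  fix p assume "m \<le> n" "p \<in> agree n"
  moreover have "cut m S = cut m (cut n S)" for S using \<open>m \<le> n\<close> by auto
  ultimately show "p \<in> agree m" unfolding agree_def by (smt (verit) case_prodE case_prodI mem_Collect_eq)
qed

text \<open>The only lower cover is \<open>?\<beta>\<close>, the part of \<open>?\<theta>\<close>
  that respects bit \<open>m\<close>. A smaller congruence outside \<open>?\<beta>\<close> relates
  two elements with equal prefixes that differ in bit \<open>m\<close>; they split at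
  \<open>m\<close>, so it collapses \<open>(k, j)\<close> and contains all of
  \<open>?\<theta>\<close>.\<close>

lemma con_labels_join_irreducible:
  assumes m: "m < N" and k: "labels m j k"
  shows "join_irreducible (Con L) (con L k j)"
proof -
  let ?\<theta> = "con L k j"
  let ?\<beta> = "?\<theta> \<inter> agree (Suc m)"
  have K: "j \<in> C" "k \<in> C" using k by (auto simp: labels_def)
  have \<theta>: "lattice_congruence L ?\<theta>" "(k, j) \<in> ?\<theta>" using congruence_con K by auto
  have \<beta>: "lattice_congruence L ?\<beta>" using lattice_congruence_Int[OF \<theta>(1) congruence_agree] m by simp
  have sub: "?\<beta> \<subset> ?\<theta>" using \<theta> con_labels_agree(2)[OF m k] by blast
  have le: "\<alpha> \<subseteq> ?\<beta>" if \<alpha>: "lattice_congruence L \<alpha>" "\<alpha> \<subset> ?\<theta>" for \<alpha>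
  proof (rule ccontr)
    assume "\<not> \<alpha> \<subseteq> ?\<beta>"
    then obtain x y where xy: "(x, y) \<in> \<alpha>" "(x, y) \<notin> agree (Suc m)" using \<alpha> by auto
    then have lev: "x \<in> C" "y \<in> C" "pre m x = pre m y"
      using con_labels_agree(1)[OF m k] \<alpha> by (auto simp: agree_def)
    have UD: "U m (h x) = U m (h y)" "D m (h x) = D m (h y)"
      using U_cong[OF lev(3)] D_cong[OF lev(3)] by auto
    have "(k, j) \<in> \<alpha>"
    proof (cases "m \<in> h y")
      case True
      then have "m \<notin> h x" using xy(2) lev by (simp add: agree_def cut_Suc_eq)
      moreover have "split_at m y" using True \<open>m \<notin> h x\<close> UD h_UD lev m by (auto simp: split_at_def)
      ultimately show ?thesis using congruence_collapses_labels[OF \<alpha>(1) k m xy(1)] True by simp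
    next
      case False
      then have "m \<in> h x" using xy(2) lev by (simp add: agree_def cut_Suc_eq)
      moreover have "split_at m x" using False \<open>m \<in> h x\<close> UD h_UD lev m by (auto simp: split_at_def)
      ultimately show ?thesis
        using congruence_collapses_labels[OF \<alpha>(1) k m congD(2)[OF \<alpha>(1) xy(1)]] False by simp
    qed
    then show False using con_least \<alpha> by blast
  qed
  have "covers (Con L) ?\<theta> \<alpha> \<longleftrightarrow> \<alpha> = ?\<beta>" for \<alpha>
  proof
    assume "covers (Con L) ?\<theta> \<alpha>"
    then show "\<alpha> = ?\<beta>" using le \<beta> sub unfolding covers_Con_iff by (metis psubsetI)
  next
    assume "\<alpha> = ?\<beta>"
    then show "covers (Con L) ?\<theta> \<alpha>" using le \<beta> sub \<theta> unfolding covers_Con_iff by blast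
  qed
  then show ?thesis using \<theta> by (simp add: join_irreducible_def Con_def)
qed

text \<open>A separating pair may be replaced by its meet and join, which are comparable. Among
  comparable separating pairs one with the fewest differing bits is a cover, since an element in
  between would yield a closer separating pair.\<close>

lemma cover_separating_congruences:
  assumes \<theta>: "lattice_congruence L \<theta>" and \<beta>: "lattice_congruence L \<beta>" and "\<not> \<theta> \<subseteq> \<beta>"
  obtains u v where "covers L v u" "(u, v) \<in> \<theta>" "(u, v) \<notin> \<beta>"
proof -
  let ?S = "{(u, v). u \<in> C \<and> v \<in> C \<and> h u \<subseteq> h v \<and> (u, v) \<in> \<theta> \<and> (u, v) \<notin> \<beta>}"
  obtain x y where xy: "(x, y) \<in> \<theta>" "(x, y) \<notin> \<beta>" using assms by auto
  then have C: "x \<in> C" "y \<in> C" using congD(4)[OF \<theta>] by auto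
  have mC: "x \<sqinter> y \<in> C" and jC: "x \<squnion> y \<in> C" using C by auto
  have e: "x \<sqinter> y \<squnion> x = x" "x \<sqinter> y \<squnion> y = y" "x \<squnion> y \<squnion> x = x \<squnion> y" "x \<squnion> y \<squnion> y = x \<squnion> y"
    using join_of_le[OF mC C(1)] join_of_le[OF mC C(2)] join_of_le[OF C(1) jC] join_of_le[OF C(2) jC]
      h_meet_le[OF C] h_join_ge[OF C] by auto
  have i: "x \<sqinter> x = x" "y \<sqinter> y = y" "y \<squnion> y = y" using C meet_of_le join_of_le by auto
  have "(x \<sqinter> y, y) \<in> \<theta>" using congD(5)[OF \<theta> xy(1) C(2)] i by simp
  moreover have "(x \<squnion> y, y) \<in> \<theta>" using congD(6)[OF \<theta> xy(1) C(2)] i by simp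
  ultimately have "(x \<sqinter> y, x \<squnion> y) \<in> \<theta>" using congD(2,3)[OF \<theta>] by blast
  moreover have "(x \<sqinter> y, x \<squnion> y) \<notin> \<beta>"
  proof
    assume a: "(x \<sqinter> y, x \<squnion> y) \<in> \<beta>"
    have "(x, x \<squnion> y) \<in> \<beta>" "(y, x \<squnion> y) \<in> \<beta>"
      using congD(6)[OF \<beta> a C(1)] congD(6)[OF \<beta> a C(2)] e by simp_all
    then show False using congD(2,3)[OF \<beta>] xy by blast
  qed
  ultimately have "(x \<sqinter> y, x \<squnion> y) \<in> ?S"
    using C mC jC h_meet_le[OF C] h_join_ge[OF C] by auto
  then have ne: "?S \<noteq> {}" by blast
  have "finite ?S" by (rule finite_subset[of _ "C \<times> C"]) (use finite_L in auto)
  then obtain p where "is_arg_min (\<lambda>(u, v). card (h v - h u)) (\<lambda>p. p \<in> ?S) p"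
    using ex_is_arg_min_if_finite ne by blast
  then obtain u v where uvS: "(u, v) \<in> ?S"
    and min: "\<And>u' v'. (u', v') \<in> ?S \<Longrightarrow> card (h v - h u) \<le> card (h v' - h u')"
    by (cases p) (auto simp: is_arg_min_linorder)
  then have uv: "u \<in> C" "v \<in> C" "h u \<subseteq> h v" "(u, v) \<in> \<theta>" "(u, v) \<notin> \<beta>" by auto
  have "u \<noteq> v" using uv congD(1)[OF \<beta>] by auto
  then have less: "h u \<subset> h v" using uv h_inj by blast
  have "False" if z: "z \<in> C" "h u \<subset> h z" "h z \<subset> h v" for z
  proof -
    have "(u, z) \<in> \<theta>"
      using congD(5)[OF \<theta> uv(4) z(1)] meet_of_le[OF uv(1) z(1)] meet_of_le[OF z(1) uv(2)] z by auto
    moreover have "(z, v) \<in> \<theta>"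
      using congD(6)[OF \<theta> uv(4) z(1)] join_of_le[OF uv(1) z(1)] join_of_le[OF z(1) uv(2)] z by auto
    moreover have "(u, z) \<notin> \<beta> \<or> (z, v) \<notin> \<beta>" using uv congD(3)[OF \<beta>] by blast
    ultimately have "(u, z) \<in> ?S \<or> (z, v) \<in> ?S" using uv z by auto
    moreover have "card (h z - h u) < card (h v - h u)" "card (h v - h z) < card (h v - h u)"
      using z finite_h[OF uv(2)] by (auto intro!: psubset_card_mono)
    ultimately show False using min[of u z] min[of z v] by auto
  qed
  then have "covers L v u" using uv less unfolding covers_iff by blast
  then show thesis using that uv by blast
qed

lemma finite_congruences: "finite {\<theta>. lattice_congruence L \<theta>}"
  by (rule finite_subset[of _ "Pow (C \<times> C)"])
    (use finite_L congD(4) in \<open>auto simp: subset_iff\<close>)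

text \<open>A cover collapsed by \<open>\<theta>\<close> but not by its unique lower cover
  \<open>\<beta>\<close> generates \<open>\<theta>\<close>: if it generated less, that congruence
  would lie below some lower cover of \<open>\<theta>\<close>, and there is only
  \<open>\<beta>\<close>.\<close>

lemma Con_join_irreducible_labels:
  assumes "join_irreducible (Con L) \<theta>"
  obtains m j k where "m < N" "labels m j k" "\<theta> = con L k j"
proof -
  obtain \<beta> where \<beta>: "covers (Con L) \<theta> \<beta>" "\<And>\<alpha>. covers (Con L) \<theta> \<alpha> \<Longrightarrow> \<alpha> = \<beta>"
    using assms unfolding join_irreducible_def by blast
  have c: "lattice_congruence L \<theta>" "lattice_congruence L \<beta>" "\<beta> \<subset> \<theta>"
    using \<beta>(1) unfolding covers_Con_iff by auto
  then obtain u v where uv: "covers L v u" "(u, v) \<in> \<theta>" "(u, v) \<notin> \<beta>"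
    using cover_separating_congruences by blast
  have C: "u \<in> C" "v \<in> C" using uv(1) unfolding covers_iff by auto
  have "con L u v = \<theta>"
  proof (rule ccontr)
    assume ne: "con L u v \<noteq> \<theta>"
    let ?A = "{\<alpha>. lattice_congruence L \<alpha> \<and> con L u v \<subseteq> \<alpha> \<and> \<alpha> \<subset> \<theta>}"
    have mem: "con L u v \<in> ?A" using ne con_least[OF c(1) uv(2)] congruence_con[OF C] by auto
    have "finite ?A" using finite_congruences by (rule rev_finite_subset) auto
    from finite_has_maximal2[OF this mem] obtain \<alpha>
      where \<alpha>: "\<alpha> \<in> ?A" "\<forall>\<gamma>\<in>?A. \<alpha> \<subseteq> \<gamma> \<longrightarrow> \<alpha> = \<gamma>"
      by (elim bexE conjE)
    have "covers (Con L) \<theta> \<alpha>" unfolding covers_Con_iff using \<alpha> c(1) by blast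
    then have "\<alpha> = \<beta>" using \<beta>(2) by blast
    then show False using \<alpha>(1) uv(3) congruence_con(2)[OF C] by blast
  qed
  moreover obtain m where m: "m < N" "\<And>j k. labels m j k \<Longrightarrow> con L u v = con L k j"
    using cover_con[OF uv(1)] by blast
  ultimately show thesis using that labels_exists[OF m(1)] by metis
qed

lemma con_bij_join_irreducible:
  "bij_betw (\<lambda>j. con L (lower_cover L j) j) {j. join_irreducible L j} {\<theta>. join_irreducible (Con L) \<theta>}"
proof (rule bij_betw_imageI)
  show "inj_on (\<lambda>j. con L (lower_cover L j) j) {j. join_irreducible L j}"
  proof (rule inj_onI, unfold mem_Collect_eq)
    fix i j assume i: "join_irreducible L i" and j: "join_irreducible L j"
      and e: "con L (lower_cover L i) i = con L (lower_cover L j) j"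
    obtain m where m: "m < N" "labels m i (lower_cover L i)" using join_irreducible_labels[OF i] .
    obtain m' where m': "m' < N" "labels m' j (lower_cover L j)" using join_irreducible_labels[OF j] .
    \<comment> \<open>Congruences of different levels differ: the one of the later level
      \<open>b\<close> lies inside \<open>agree (Suc a)\<close>, the one of level \<open>a\<close>
      does not.\<close>
    have "\<not> a < b" if "a < N" "b < N" "labels a x x'" "labels b y y'" "con L x' x = con L y' y" for a b x x' y y'
    proof
      assume "a < b"
      have "con L y' y \<subseteq> agree (Suc a)"
        using con_labels_agree(1)[OF that(2,4)] agree_mono[of "Suc a" b] \<open>a < b\<close> by auto
      moreover have "(x', x) \<in> con L x' x" using congruence_con(2) labelD(1,2)[OF that(3)] by simp
      ultimately show False using con_labels_agree(2)[OF that(1,3)] that(5) by auto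
    qed
    from this[OF m(1) m'(1) m(2) m'(2) e] this[OF m'(1) m(1) m'(2) m(2) e[symmetric]]
    have "m = m'" by simp
    then show "i = j" using labels_unique(1)[OF m(1,2)] m' by simp
  qed
  have "join_irreducible (Con L) (con L (lower_cover L j) j)" if j: "join_irreducible L j" for j
  proof -
    obtain m where m: "m < N" "labels m j (lower_cover L j)" using join_irreducible_labels[OF j] .
    then show ?thesis by (rule con_labels_join_irreducible)
  qed
  moreover have "\<theta> \<in> (\<lambda>j. con L (lower_cover L j) j) ` {j. join_irreducible L j}"
    if \<theta>: "join_irreducible (Con L) \<theta>" for \<theta>
  proof -
    obtain m j k where k: "labels m j k" "\<theta> = con L k j"
      using Con_join_irreducible_labels[OF \<theta>] by metis
    then show ?thesis using labels_join_irreducible[OF k(1)] by (intro image_eqI[of _ _ j]) auto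
  qed
  ultimately show "(\<lambda>j. con L (lower_cover L j) j) ` {j. join_irreducible L j} =
    {\<theta>. join_irreducible (Con L) \<theta>}" by auto
qed

end

section \<open>Long chains and duality\<close>

context doubled_lattice
begin

text \<open>\<open>N\<close> steps that each add one bit can only lead from no bits to all
  \<open>N\<close> bits, so every bit has a step of its own. The two elements at the step of
  \<open>m\<close> have the same prefix, so the lower one splits at \<open>m\<close>, and it is
  comparable to the whole chain. No chain is longer because on a chain the number of set bits
  determines the element.\<close>

lemma flag:
  assumes s: "\<And>k. k \<le> N \<Longrightarrow> s k \<in> C"
    and step: "\<And>k. k < N \<Longrightarrow> \<exists>b. b \<notin> h (s k) \<and> h (s (Suc k)) = insert b (h (s k))"
  shows "Max (chain_length ` {K. chain_in L K}) = N" "left_modular L"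
proof -
  have card: "card (h (s k)) = card (h (s 0)) + k" if "k \<le> N" for k
    using that
  proof (induction k)
    case (Suc k)
    then obtain b where "b \<notin> h (s k)" "h (s (Suc k)) = insert b (h (s k))" using step[of k] by auto
    then show ?case using Suc finite_h[OF s[of k]] by simp
  qed simp
  have le: "card (h x) \<le> N" if "x \<in> C" for x
    using card_mono[OF _ h_subset[OF that]] by simp
  have "card (h (s 0)) = 0" "card (h (s N)) = N"
    using card[of N] le[OF s[of N]] by auto
  then have h0: "h (s 0) = {}" and hN: "h (s N) = {..<N}"
    using finite_h[OF s[of 0]] card_subset_eq[OF _ h_subset[OF s[of N]]] by auto
  have mono: "h (s i) \<subseteq> h (s j)" if "i \<le> j" "j \<le> N" for i j
    using that
  proof (induction j rule: dec_induct)
    case (step j)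
    then show ?case using assms(2)[of j] by auto
  qed simp
  have inj: "inj_on s {..N}"
  proof (rule inj_onI)
    fix i j assume "i \<in> {..N}" "j \<in> {..N}" "s i = s j"
    then have "card (h (s 0)) + i = card (h (s 0)) + j" using card by (metis atMost_iff)
    then show "i = j" by simp
  qed
  let ?K = "s ` {..N}"
  have cardK: "card ?K = Suc N" using card_image[OF inj] by simp
  have K: "chain_in L ?K"
    unfolding chain_in_def
  proof (intro conjI ballI)
    show "?K \<subseteq> C" using s by auto
    fix x y assume "x \<in> ?K" "y \<in> ?K"
    then obtain i j where "x = s i" "y = s j" "i \<le> N" "j \<le> N" by auto
    then show "x \<sqsubseteq> y \<or> y \<sqsubseteq> x" using mono[of i j] mono[of j i] s le_iff by (cases "i \<le> j") auto
  qed simp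
  have bound: "card Q \<le> Suc N" if Q: "chain_in L Q" for Q
  proof -
    have sub: "Q \<subseteq> C" using Q by (simp add: chain_in_def)
    have "inj_on (\<lambda>x. card (h x)) Q"
    proof (rule inj_onI)
      fix x y assume xy: "x \<in> Q" "y \<in> Q" "card (h x) = card (h y)"
      then have "x \<in> C" "y \<in> C" using sub by auto
      moreover have "h x \<subseteq> h y \<or> h y \<subseteq> h x" using Q xy le_iff sub unfolding chain_in_def by blast
      ultimately show "x = y"
        using card_subset_eq[OF finite_h, of y "h x"] card_subset_eq[OF finite_h, of x "h y"] xy h_inj
        by metis
    qed
    moreover have "(\<lambda>x. card (h x)) ` Q \<subseteq> {..N}" using le sub by auto
    ultimately have "card Q \<le> card {..N}" by (rule card_inj_on_le) simp
    then show ?thesis by simp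
  qed
  show "Max (chain_length ` {K. chain_in L K}) = N"
  proof (rule Max_eqI)
    have "finite {K. chain_in L K}"
      by (rule finite_subset[of _ "Pow C"]) (use finite_L in \<open>auto simp: chain_in_def\<close>)
    then show "finite (chain_length ` {K. chain_in L K})" by simp
    show "y \<le> N" if y: "y \<in> chain_length ` {K. chain_in L K}" for y
    proof -
      obtain Q where "chain_in L Q" "y = chain_length Q" using y by blast
      then show ?thesis using bound[of Q] by (simp add: chain_length_def)
    qed
    have "chain_length ?K = N" using cardK by (simp add: chain_length_def)
    then show "N \<in> chain_length ` {K. chain_in L K}" using K by (metis (mono_tags) imageI mem_Collect_eq)
  qed
  have "maximal_chain L C ?K"
    unfolding maximal_chain_def
  proof (intro conjI allI impI K)
    show "?K \<subseteq> C" using s by auto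
    fix Q assume Q: "chain_in L Q \<and> Q \<subseteq> C \<and> ?K \<subseteq> Q"
    then have "finite Q" using finite_L finite_subset by metis
    then show "Q = ?K" using card_seteq[of Q ?K] bound[of Q] Q cardK by simp
  qed
  moreover have "left_modular_element L x" if x: "x \<in> ?K" for x
  proof (rule left_modular_elementI)
    obtain i where i: "x = s i" "i \<le> N" using x by auto
    then show "x \<in> C" using s by simp
    fix m assume m: "m < N"
    have "\<exists>k<N. m \<notin> h (s k) \<and> m \<in> h (s (Suc k))"
    proof (rule ccontr)
      assume "\<not> ?thesis"
      then have a: "m \<in> h (s k) \<or> m \<notin> h (s (Suc k))" if "Suc k \<le> N" for k
        using that by (metis Suc_le_eq)
      have "m \<notin> h (s k)" if "k \<le> N" for k
        using that by (induction k) (use h0 a in auto)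
      then show False using hN m by blast
    qed
    then obtain k where k: "k < N" "m \<notin> h (s k)" "m \<in> h (s (Suc k))" by auto
    then have "h (s (Suc k)) = insert m (h (s k))" using step[of k] by auto
    then have "cut m (h (s (Suc k))) = cut m (h (s k))" by auto
    then have "split_at m (s k)"
      using h_UD[OF s] k m U_cong unfolding split_at_def by (metis Suc_leI less_imp_le)
    moreover have "h x \<subseteq> h (s k) \<or> h (s k) \<subseteq> h x"
      using mono[of i k] mono[of k i] i k by (cases "i \<le> k") auto
    ultimately show "\<exists>w\<in>C. split_at m w \<and> (h x \<subseteq> h w \<or> h w \<subseteq> h x)" using s k by auto
  qed
  ultimately show "left_modular L" unfolding left_modular_def by blast
qed

end

section \<open>Order duality of the lattice notions\<close>

lemma covers_dual:
  "eq L = (=) \<Longrightarrow> covers (inv_gorder L) x = (\<lambda>y. covers L y x)"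
  unfolding covers_def lless_def by (intro ext) auto

lemma join_irreducible_dual:
  assumes "eq L = (=)"
  shows "join_irreducible (inv_gorder L) x = meet_irreducible L x"
  unfolding join_irreducible_def meet_irreducible_def covers_dual[OF assms] by simp

lemma lower_cover_dual:
  assumes "eq L = (=)"
  shows "lower_cover (inv_gorder L) x = upper_cover L x"
  unfolding lower_cover_def upper_cover_def covers_dual[OF assms] ..

lemma lattice_congruence_dual: "lattice_congruence (inv_gorder L) = lattice_congruence L"
  by (rule ext) (auto simp: lattice_congruence_def)

lemma Con_dual: "Con (inv_gorder L) = Con L"
  by (simp add: Con_def lattice_congruence_dual)

lemma con_dual: "con (inv_gorder L) x y = con L y x"
proof -
  have "(x, y) \<in> \<theta> \<longleftrightarrow> (y, x) \<in> \<theta>" if "lattice_congruence L \<theta>" for \<theta>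
    using that unfolding lattice_congruence_def equiv_def sym_def by blast
  then show ?thesis unfolding con_def lattice_congruence_dual by metis
qed

lemma interval_dual: "at_least_at_most (inv_gorder L) x y = at_least_at_most L y x"
  by (auto simp: at_least_at_most_def)

lemma chain_in_dual: "chain_in (inv_gorder L) = chain_in L"
  by (rule ext) (auto simp: chain_in_def)

lemma maximal_chain_dual: "maximal_chain (inv_gorder L) = maximal_chain L"
  by (intro ext) (simp add: maximal_chain_def chain_in_dual)

lemma polygon_dual: "polygon (inv_gorder L) x y = polygon L y x"
proof -
  have "polygon_chains (inv_gorder L) x y A B = polygon_chains L y x A B" for A B
    unfolding polygon_chains_def interval_dual maximal_chain_dual by auto
  then show ?thesis by (simp add: polygon_def)
qed

section \<open>The bits of the slow Tamari lattice\<close>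

text \<open>\<open>rbit j d\<close> and \<open>cbit j d\<close>, for \<open>d \<le> j\<close>, are the numbers of the bits \<open>a(j - d + 1, j + 1)\<close> and
  \<open>c(j - d + 1, j + 1)\<close>. The columns are numbered one after the other, each one upwards from the
  diagonal, so that every bit comes after those it depends on; \<open>rbit j 0 = cbit j 0\<close>.\<close>

definition rbit :: "nat \<Rightarrow> nat \<Rightarrow> nat" where
  "rbit j d = j * j + 2 * d"

fun cbit :: "nat \<Rightarrow> nat \<Rightarrow> nat" where
  "cbit j 0 = j * j"
| "cbit j (Suc d) = j * j + 2 * d + 1"

lemma rbit_0: "rbit j 0 = cbit j 0"
  by (simp add: rbit_def)

text \<open>Column \<open>j\<close> occupies the block from \<open>j * j\<close> to
  \<open>j * j + 2 * j\<close>: one diagonal bit and two more for each distance from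
  \<open>1\<close> to \<open>j\<close>. The next block starts at the next square.\<close>

lemma column_unique:
  fixes i j m :: nat
  assumes "i * i \<le> m" "m \<le> i * i + 2 * i" "j * j \<le> m" "m \<le> j * j + 2 * j"
  shows "i = j"
proof -
  have "\<not> i < j" if "j * j \<le> m" "m \<le> i * i + 2 * i" for i j
  proof
    assume "i < j"
    then have "Suc i * Suc i \<le> j * j" by (intro mult_le_mono) auto
    with that show False by simp
  qed
  from this[OF assms(3,2)] this[OF assms(1,4)] show ?thesis by simp
qed

lemma square_bracket: "\<exists>i::nat. i * i \<le> m \<and> m < Suc i * Suc i"
proof (induction m)
  case 0
  show ?case by (rule exI[of _ 0]) simp
next
  case (Suc m)
  then obtain i where i: "i * i \<le> m" "m < Suc i * Suc i" by blast
  show ?case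
  proof (cases "Suc m < Suc i * Suc i")
    case True
    then show ?thesis using i by (intro exI[of _ i]) simp
  next
    case False
    then show ?thesis using i by (intro exI[of _ "Suc i"]) simp
  qed
qed

lemma rbit_bounds: "d \<le> j \<Longrightarrow> j * j \<le> rbit j d \<and> rbit j d \<le> j * j + 2 * j"
  by (simp add: rbit_def)

lemma cbit_bounds: "d \<le> j \<Longrightarrow> j * j \<le> cbit j d \<and> cbit j d \<le> j * j + 2 * j"
  by (cases d) auto

lemma rbit_eq_iff: "d \<le> j \<Longrightarrow> d' \<le> j' \<Longrightarrow> rbit j d = rbit j' d' \<longleftrightarrow> j = j' \<and> d = d'"
  using column_unique[of j "rbit j d" j'] rbit_bounds[of d j] rbit_bounds[of d' j'] by (auto simp: rbit_def)

lemma cbit_eq_iff: "d \<le> j \<Longrightarrow> d' \<le> j' \<Longrightarrow> cbit j d = cbit j' d' \<longleftrightarrow> j = j' \<and> d = d'"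
  using column_unique[of j "cbit j d" j'] cbit_bounds[of d j] cbit_bounds[of d' j']
  by (cases d; cases d') auto

lemma rbit_eq_cbit_iff:
  assumes "d \<le> j" "d' \<le> j'"
  shows "rbit j d = cbit j' d' \<longleftrightarrow> j = j' \<and> d = 0 \<and> d' = 0"
proof
  assume e: "rbit j d = cbit j' d'"
  then have j: "j = j'"
    using column_unique[of j "rbit j d" j'] rbit_bounds[OF assms(1)] cbit_bounds[OF assms(2)] by simp
  show "j = j' \<and> d = 0 \<and> d' = 0"
  proof (cases d')
    case 0
    then show ?thesis using e j by (simp add: rbit_def)
  next
    case (Suc n)
    then have "2 * d = 2 * n + 1" using e j by (simp add: rbit_def)
    then show ?thesis by presburger
  qed
qed (simp add: rbit_def)

lemmas ix_eq_iff = rbit_eq_iff cbit_eq_iff rbit_eq_cbit_iff rbit_eq_cbit_iff[THEN trans[OF eq_commute]]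

lemma ix_less:
  assumes "d \<le> j"
  shows "cbit (Suc j) d < cbit (Suc j) (Suc d)" "rbit j d < cbit (Suc j) (Suc d)"
    "cbit (Suc j) (Suc d) < rbit (Suc j) (Suc d)" "cbit (Suc j) d < rbit (Suc j) (Suc d)"
    "rbit j d < rbit (Suc j) (Suc d)" "rbit (Suc j) (Suc d) = Suc (cbit (Suc j) (Suc d))"
  using assms by (cases d; simp add: rbit_def)+

lemma ix_less_square:
  assumes "d \<le> j"
  shows "rbit j d < r * r \<longleftrightarrow> j < r" "cbit j d < r * r \<longleftrightarrow> j < r"
proof -
  have "r * r \<le> j * j" if "\<not> j < r" using that by (intro mult_le_mono) auto
  moreover have "Suc j * Suc j \<le> r * r" if "j < r" using that by (intro mult_le_mono) auto
  ultimately show "rbit j d < r * r \<longleftrightarrow> j < r" "cbit j d < r * r \<longleftrightarrow> j < r"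
    using rbit_bounds[OF assms] cbit_bounds[OF assms] by fastforce+
qed

text \<open>Within a block the offset from the square reveals the kind of bit: zero is the diagonal
  bit, an odd offset a \<open>c\<close>-bit, a positive even one an \<open>a\<close>-bit.\<close>

lemma bit_cases:
  obtains (diag) j where "m = rbit j 0"
  | (col) j d where "d \<le> j" "m = cbit (Suc j) (Suc d)"
  | (row) j d where "d \<le> j" "m = rbit (Suc j) (Suc d)"
proof -
  obtain i where i: "i * i \<le> m" "m < Suc i * Suc i" using square_bracket by blast
  define p where "p = m - i * i"
  have m: "m = i * i + p" "p \<le> 2 * i" using i by (auto simp: p_def)
  show thesis
  proof (cases "p = 0")
    case True
    then show thesis using m diag[of i] by (simp add: rbit_def)
  next
    case False
    then obtain j where j: "i = Suc j" using m by (cases i) auto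
    show thesis
    proof (cases "even p")
      case True
      then obtain d where "p = 2 * d" by (auto elim: evenE)
      with False obtain e where "p = 2 * Suc e" by (cases d) auto
      then show thesis using row[of e j] m j by (simp add: rbit_def)
    next
      case odd: False
      then obtain d where "p = 2 * d + 1" by (auto elim: oddE)
      then show thesis using col[of d j] m j by simp
    qed
  qed
qed

text \<open>For the cell with bits \<open>c = cbit (Suc j) (Suc d)\<close> and
  \<open>a = rbit (Suc j) (Suc d)\<close> put \<open>x = rbit j d\<close> and
  \<open>y = cbit (Suc j) d\<close>. As \<open>c\<close> is decided before \<open>a\<close>, the
  rule for the pair splits into \<open>x \<and> y \<le> c \<le> y\<close> and then
  \<open>x \<le> a \<le> x \<or> c\<close>; the upper bounds are stated here, the lower ones in
  \<open>can_clear\<close>. Diagonal bits match no pattern and stay unconstrained.\<close>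

definition can_set :: "nat \<Rightarrow> nat set \<Rightarrow> bool" where
  "can_set m S \<longleftrightarrow> (\<forall>j d. d \<le> j \<longrightarrow> (m = cbit (Suc j) (Suc d) \<longrightarrow> cbit (Suc j) d \<in> S) \<and>
     (m = rbit (Suc j) (Suc d) \<longrightarrow> rbit j d \<in> S \<or> cbit (Suc j) (Suc d) \<in> S))"

definition can_clear :: "nat \<Rightarrow> nat set \<Rightarrow> bool" where
  "can_clear m S \<longleftrightarrow> (\<forall>j d. d \<le> j \<longrightarrow> (m = cbit (Suc j) (Suc d) \<longrightarrow> rbit j d \<notin> S \<or> cbit (Suc j) d \<notin> S) \<and>
     (m = rbit (Suc j) (Suc d) \<longrightarrow> rbit j d \<notin> S))"

lemma can_simps_diag: "can_set (rbit j 0) S" "can_clear (rbit j 0) S"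
  unfolding can_set_def can_clear_def by (simp_all add: rbit_eq_iff rbit_eq_cbit_iff del: cbit.simps)

lemma can_simps_col:
  assumes "d \<le> j"
  shows "can_set (cbit (Suc j) (Suc d)) S \<longleftrightarrow> cbit (Suc j) d \<in> S"
    "can_clear (cbit (Suc j) (Suc d)) S \<longleftrightarrow> rbit j d \<notin> S \<or> cbit (Suc j) d \<notin> S"
  using assms unfolding can_set_def can_clear_def by (auto simp: ix_eq_iff simp del: cbit.simps)

lemma can_simps_row:
  assumes "d \<le> j"
  shows "can_set (rbit (Suc j) (Suc d)) S \<longleftrightarrow> rbit j d \<in> S \<or> cbit (Suc j) (Suc d) \<in> S"
    "can_clear (rbit (Suc j) (Suc d)) S \<longleftrightarrow> rbit j d \<notin> S"
  using assms unfolding can_set_def can_clear_def by (auto simp: ix_eq_iff simp del: cbit.simps)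

lemmas can_simps = can_simps_diag can_simps_col can_simps_row

declare cbit.simps [simp del]

text \<open>The bits that are clear as soon as \<open>rbit j (j - k)\<close> is.\<close>

definition row_col :: "nat \<Rightarrow> nat \<Rightarrow> nat set" where
  "row_col k j = {rbit (k + e) e | e. k + e \<le> j} \<union> {cbit k e | e. e \<le> k}"

lemma rbit_row_col: "d \<le> i \<Longrightarrow> rbit i d \<in> row_col k j \<longleftrightarrow> i = k + d \<and> (i \<le> j \<or> d = 0)"
  by (cases "d = 0") (auto simp: row_col_def ix_eq_iff rbit_0 intro: exI[of _ 0])

lemma cbit_row_col: "d \<le> i \<Longrightarrow> k \<le> j \<Longrightarrow> cbit i d \<in> row_col k j \<longleftrightarrow> i = k"
  by (auto simp: row_col_def ix_eq_iff)

text \<open>These are the bits that \<open>cbit (Suc j) d\<close> forces within its column; they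
  form the bottom of a doubled interval. Their diagonal bit is also an \<open>a\<close>-bit and
  would spread into the next column, which the bound on \<open>m\<close> keeps out of range.\<close>

lemma tower_lower:
  assumes "d \<le> Suc j" "m \<le> Suc (Suc j) * Suc (Suc j)" "cbit (Suc j) d < m"
  shows "{cbit (Suc j) e | e. e \<le> d} \<in> tower can_set can_clear m"
proof -
  let ?p = "{cbit (Suc j) e | e. e \<le> d}"
  have le: "cbit (Suc j) e \<le> cbit (Suc j) d" if "e \<le> d" for e
    using that by (cases e; cases d) (auto simp: cbit.simps)
  have pc: "cbit i e \<in> ?p \<longleftrightarrow> i = Suc j \<and> e \<le> d" if "e \<le> i" for i e
    using that assms(1) by (auto simp: ix_eq_iff)
  have pa: "rbit i e \<in> ?p \<longleftrightarrow> i = Suc j \<and> e = 0" if "e \<le> i" for i e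
    using that assms(1) by (cases "e = 0") (auto simp: ix_eq_iff rbit_0)
  have "(b \<in> ?p \<longrightarrow> can_set b ?p) \<and> (b \<notin> ?p \<longrightarrow> can_clear b ?p)" if b: "b < m" for b
  proof (cases b rule: bit_cases)
    case (diag i)
    then show ?thesis by (simp add: can_simps)
  next
    case (col i e)
    have "i \<noteq> Suc j" using b col assms(2) ix_less_square(2)[of "Suc e" "Suc i" "Suc (Suc j)"] by auto
    then show ?thesis using col pc[of "Suc e" "Suc i"] pc[of e "Suc i"] pa[of e i] by (auto simp: can_simps)
  next
    case (row i e)
    have "i \<noteq> Suc j" using b row assms(2) ix_less_square(1)[of "Suc e" "Suc i" "Suc (Suc j)"] by auto
    then show ?thesis using row pa[of "Suc e" "Suc i"] pa[of e i] by (auto simp: can_simps)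
  qed
  moreover have "?p \<subseteq> {..<m}" using le assms(3) by fastforce
  ultimately show ?thesis unfolding tower_def by blast
qed

text \<open>The top of a doubled interval: a clear \<open>rbit j d\<close> clears its row back to
  the diagonal and, from there, the column that starts at the same diagonal bit. The level ends
  before \<open>rbit (Suc j) (Suc d)\<close>, so no remaining \<open>a\<close>-bit has its
  predecessor in the row removed.\<close>

lemma tower_upper:
  assumes "d \<le> j" "m \<le> rbit (Suc j) (Suc d)"
  shows "{..<m} - row_col (j - d) j \<in> tower can_set can_clear m"
proof -
  let ?q = "{..<m} - row_col (j - d) j"
  have k: "j - d \<le> j" by simp
  note cq = cbit_row_col[OF _ k]
  have "(b \<in> ?q \<longrightarrow> can_set b ?q) \<and> (b \<notin> ?q \<longrightarrow> can_clear b ?q)" if b: "b < m" for b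
  proof (cases b rule: bit_cases)
    case (diag i)
    then show ?thesis by (simp add: can_simps)
  next
    case (col i e)
    show ?thesis
      using b ix_less[OF col(1)] cq[of "Suc e" "Suc i"] cq[of e "Suc i"] col(1)
      unfolding col(2) can_simps_col[OF col(1)] by auto
  next
    case (row i e)
    have "can_set b ?q" if "b \<notin> row_col (j - d) j"
    proof (cases "i = j - d + e")
      case True
      then have "\<not> Suc i \<le> j" using that row rbit_row_col[of "Suc e" "Suc i" "j - d" j] by simp
      then have "e \<ge> d" "i \<ge> j" using True assms(1) by auto
      then have "rbit (Suc j) (Suc d) \<le> b" using row by (simp add: rbit_def add_mono mult_le_mono)
      then show ?thesis using b assms(2) by simp
    next
      case False
      then show ?thesis using row b ix_less(1-5)[of e i] rbit_row_col[of e i "j - d" j] by (auto simp: can_simps)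
    qed
    moreover have "can_clear b ?q" if "b \<in> row_col (j - d) j"
      using that row rbit_row_col[of "Suc e" "Suc i" "j - d" j] rbit_row_col[of e i "j - d" j]
      by (auto simp: can_simps)
    ultimately show ?thesis using b by blast
  qed
  then show ?thesis unfolding tower_def by blast
qed

lemma towerD:
  assumes "S \<in> tower can_set can_clear m" "d \<le> j"
  shows "cbit (Suc j) (Suc d) \<in> S \<Longrightarrow> cbit (Suc j) d \<in> S"
    "cbit (Suc j) (Suc d) < m \<Longrightarrow> rbit j d \<in> S \<Longrightarrow> cbit (Suc j) d \<in> S \<Longrightarrow> cbit (Suc j) (Suc d) \<in> S"
    "rbit (Suc j) (Suc d) \<in> S \<Longrightarrow> rbit j d \<in> S \<or> cbit (Suc j) (Suc d) \<in> S"
    "rbit (Suc j) (Suc d) < m \<Longrightarrow> rbit j d \<in> S \<Longrightarrow> rbit (Suc j) (Suc d) \<in> S"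
  using assms(1) can_simps_col[OF assms(2), of S] can_simps_row[OF assms(2), of S]
  unfolding tower_def by blast+

lemma tower_column:
  assumes "S \<in> tower can_set can_clear m" "d \<le> Suc j" "cbit (Suc j) d \<in> S" "e \<le> d"
  shows "cbit (Suc j) e \<in> S"
  using assms(4,2,3)
proof (induction d rule: dec_induct)
  case (step d)
  then show ?case using towerD(1)[OF assms(1), of d j] by simp
qed simp

lemma tower_row:
  assumes "S \<in> tower can_set can_clear m" "rbit (k + d) d \<notin> S" "rbit (k + d) d < m" "e \<le> d"
  shows "rbit (k + e) e \<notin> S"
  using assms(4,2,3)
proof (induction d rule: dec_induct)
  case (step d)
  then show ?case using towerD(4)[OF assms(1), of d "k + d"] ix_less(5)[of d "k + d"] by auto
qed simp

lemma tower_row_col: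
  assumes S: "S \<in> tower can_set can_clear m" and d: "d \<le> j" and m: "rbit j d < m"
  shows "rbit j d \<notin> S \<longleftrightarrow> S \<subseteq> {..<m} - row_col (j - d) j"
proof
  assume "S \<subseteq> {..<m} - row_col (j - d) j"
  moreover have "rbit j d \<in> row_col (j - d) j" using rbit_row_col[OF d, of "j - d" j] d by simp
  ultimately show "rbit j d \<notin> S" by blast
next
  assume n: "rbit j d \<notin> S"
  define k where "k = j - d"
  have j: "j = k + d" using d by (simp add: k_def)
  have r: "rbit (k + e) e \<notin> S" if "e \<le> d" for e
    using tower_row[OF S, of k d e] n m that j by simp
  have "cbit k e \<notin> S" if "e \<le> k" for e
  proof
    assume "cbit k e \<in> S"
    then have "cbit k 0 \<in> S" using tower_column[OF S, of e "k - 1" 0] that by (cases k) auto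
    then show False using r[of 0] by (simp add: rbit_0)
  qed
  then have "S \<inter> row_col k j = {}" using r j by (auto simp: row_col_def)
  then show "S \<subseteq> {..<m} - row_col (j - d) j" using S k_def by (auto simp: tower_def)
qed

text \<open>Only \<open>interval\<close> needs work. A diagonal bit is free everywhere, so the whole
  level is doubled. For the other bits, being free means that a certain \<open>c\<close>-bit of
  column \<open>Suc j\<close> is set and that \<open>rbit j d\<close> is clear; by
  \<open>tower_column\<close> and \<open>tower_row_col\<close> these are the inclusions above
  \<open>?p\<close> and below \<open>?q\<close>.\<close>

interpretation growth: doubling can_set can_clear
proof
  fix m :: nat and S T :: "nat set"
  show "can_set m S \<or> can_clear m S"
    by (cases m rule: bit_cases) (auto simp: can_simps)
  show "can_set m T" if "cut m S \<subseteq> cut m T" "can_set m S"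
    using that ix_less(1-5) by (cases m rule: bit_cases) (auto simp: can_simps subset_iff)
  show "can_clear m S" if "cut m S \<subseteq> cut m T" "can_clear m T"
    using that ix_less(1-5) by (cases m rule: bit_cases) (auto simp: can_simps subset_iff)
  show "\<exists>p\<in>tower can_set can_clear m. \<exists>q\<in>tower can_set can_clear m. p \<subseteq> q \<and>
      (\<forall>S\<in>tower can_set can_clear m. can_set m S \<and> can_clear m S \<longleftrightarrow> p \<subseteq> S \<and> S \<subseteq> q)"
  proof (cases m rule: bit_cases)
    case (diag j)
    have "(b \<in> {..<m} \<longrightarrow> can_set b {..<m}) \<and> (b \<notin> {} \<longrightarrow> can_clear b {})" if "b < m" for b
    proof (cases b rule: bit_cases)
      case (col i e)
      then show ?thesis using that ix_less(1-5)[OF col(1)] unfolding col(2) can_simps_col[OF col(1)] by auto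
    next
      case (row i e)
      then show ?thesis using that ix_less(1-5)[OF row(1)] unfolding row(2) can_simps_row[OF row(1)] by auto
    qed (simp add: can_simps)
    then have "{} \<in> tower can_set can_clear m" "{..<m} \<in> tower can_set can_clear m" by (auto simp: tower_def)
    then show ?thesis using diag by (intro bexI[of _ "{}"] bexI[of _ "{..<m}"]) (auto simp: can_simps tower_def)
  next
    case (col j d)
    let ?p = "{cbit (Suc j) e | e. e \<le> d}" and ?q = "{..<m} - row_col (j - d) j"
    have lt: "cbit (Suc j) d < m" "rbit j d < m" using ix_less[OF col(1)] col(2) by auto
    have p: "?p \<in> tower can_set can_clear m"
      using col lt cbit_bounds[of "Suc d" "Suc j"] by (intro tower_lower) auto
    have q: "?q \<in> tower can_set can_clear m" using col ix_less[OF col(1)] by (intro tower_upper) auto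
    have "?p \<subseteq> ?q"
    proof -
      have "cbit (Suc j) e \<notin> row_col (j - d) j" if "e \<le> d" for e
        using cbit_row_col[of e "Suc j" "j - d" j] col that by simp
      then show ?thesis using p by (auto simp: tower_def)
    qed
    moreover have "can_set m S \<and> can_clear m S \<longleftrightarrow> ?p \<subseteq> S \<and> S \<subseteq> ?q" if S: "S \<in> tower can_set can_clear m" for S
    proof -
      have "cbit (Suc j) d \<in> S \<longleftrightarrow> ?p \<subseteq> S"
        using tower_column[OF S, of d j] col by auto
      moreover have "rbit j d \<notin> S \<longleftrightarrow> S \<subseteq> ?q" using tower_row_col[OF S col(1) lt(2)] .
      ultimately show ?thesis unfolding col(2) can_simps_col[OF col(1)] by argo
    qed
    ultimately show ?thesis by (intro bexI[OF _ p] bexI[OF _ q] conjI ballI)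
  next
    case (row j d)
    let ?p = "{cbit (Suc j) e | e. e \<le> Suc d}" and ?q = "{..<m} - row_col (j - d) j"
    have lt: "cbit (Suc j) (Suc d) < m" "rbit j d < m" using ix_less[OF row(1)] row(2) by auto
    have p: "?p \<in> tower can_set can_clear m"
      using row lt rbit_bounds[of "Suc d" "Suc j"] by (intro tower_lower) auto
    have q: "?q \<in> tower can_set can_clear m" using row by (intro tower_upper) auto
    have "?p \<subseteq> ?q"
    proof -
      have "cbit (Suc j) e \<notin> row_col (j - d) j" if "e \<le> Suc d" for e
        using cbit_row_col[of e "Suc j" "j - d" j] row that by simp
      then show ?thesis using p by (auto simp: tower_def)
    qed
    moreover have "can_set m S \<and> can_clear m S \<longleftrightarrow> ?p \<subseteq> S \<and> S \<subseteq> ?q" if S: "S \<in> tower can_set can_clear m" for S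
    proof -
      have "cbit (Suc j) (Suc d) \<in> S \<longleftrightarrow> ?p \<subseteq> S"
        using tower_column[OF S, of "Suc d" j] row by auto
      moreover have "rbit j d \<notin> S \<longleftrightarrow> S \<subseteq> ?q" using tower_row_col[OF S row(1) lt(2)] .
      ultimately show ?thesis unfolding row(2) can_simps_row[OF row(1)] by argo
    qed
    ultimately show ?thesis by (intro bexI[OF _ p] bexI[OF _ q] conjI ballI)
  qed
qed

section \<open>A chain through all bits, and the anti-automorphism\<close>

lemma tower_squareI:
  assumes "S \<subseteq> {..<r * r}"
    and "\<And>j d. d \<le> j \<Longrightarrow> Suc j < r \<Longrightarrow> cbit (Suc j) (Suc d) \<in> S \<Longrightarrow> cbit (Suc j) d \<in> S"
    and "\<And>j d. d \<le> j \<Longrightarrow> Suc j < r \<Longrightarrow> rbit j d \<in> S \<Longrightarrow> cbit (Suc j) d \<in> S \<Longrightarrow> cbit (Suc j) (Suc d) \<in> S"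
    and "\<And>j d. d \<le> j \<Longrightarrow> Suc j < r \<Longrightarrow> rbit (Suc j) (Suc d) \<in> S \<Longrightarrow> rbit j d \<in> S \<or> cbit (Suc j) (Suc d) \<in> S"
    and "\<And>j d. d \<le> j \<Longrightarrow> Suc j < r \<Longrightarrow> rbit j d \<in> S \<Longrightarrow> rbit (Suc j) (Suc d) \<in> S"
  shows "S \<in> tower can_set can_clear (r * r)"
proof -
  have "(b \<in> S \<longrightarrow> can_set b S) \<and> (b \<notin> S \<longrightarrow> can_clear b S)" if b: "b < r * r" for b
  proof (cases b rule: bit_cases)
    case (diag i)
    then show ?thesis by (simp add: can_simps)
  next
    case (col j d)
    then have "Suc j < r" using b ix_less_square(2)[of "Suc d" "Suc j" r] by simp
    then show ?thesis using col assms(2,3)[of d j] by (auto simp: can_simps)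
  next
    case (row j d)
    then have "Suc j < r" using b ix_less_square(1)[of "Suc d" "Suc j" r] by simp
    then show ?thesis using row assms(4,5)[of d j] by (auto simp: can_simps)
  qed
  then show ?thesis using assms(1) by (simp add: tower_def)
qed

text \<open>The number of bits in the columns after \<open>j\<close>, because the columns up to
  \<open>j\<close> hold \<open>Suc j * Suc j\<close> bits together.\<close>

definition flag_base :: "nat \<Rightarrow> nat \<Rightarrow> nat" where
  "flag_base r j = r * r - Suc j * Suc j"

text \<open>The first \<open>k\<close> bits when the columns are filled from the last to the first, and in each column
  the \<open>c\<close>-bits before the \<open>a\<close>-bits.\<close>

definition flag_set :: "nat \<Rightarrow> nat \<Rightarrow> nat set" where
  "flag_set r k = {cbit j d | j d. d \<le> j \<and> j < r \<and> flag_base r j + d < k} \<union>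
     {rbit j d | j d. 0 < d \<and> d \<le> j \<and> j < r \<and> flag_base r j + j + d < k}"

lemma flag_base_Suc:
  assumes "Suc j < r"
  shows "flag_base r j = flag_base r (Suc j) + 2 * j + 3"
proof -
  have "Suc (Suc j) * Suc (Suc j) \<le> r * r" using assms by (intro mult_le_mono) auto
  then show ?thesis by (simp add: flag_base_def)
qed

lemma cbit_flag_set: "d \<le> j \<Longrightarrow> cbit j d \<in> flag_set r k \<longleftrightarrow> j < r \<and> flag_base r j + d < k"
  by (auto simp: flag_set_def ix_eq_iff)

lemma rbit_flag_set:
  "0 < d \<Longrightarrow> d \<le> j \<Longrightarrow> rbit j d \<in> flag_set r k \<longleftrightarrow> j < r \<and> flag_base r j + j + d < k"
  by (auto simp: flag_set_def ix_eq_iff)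

lemma flag_set_tower: "flag_set r k \<in> tower can_set can_clear (r * r)"
proof (rule tower_squareI)
  show "flag_set r k \<subseteq> {..<r * r}"
    unfolding flag_set_def using ix_less_square by auto
  fix j d assume d: "d \<le> j" and j: "Suc j < r"
  let ?S = "flag_set r k"
  have c: "cbit (Suc j) (Suc d) \<in> ?S \<longleftrightarrow> flag_base r (Suc j) + Suc d < k"
    and y: "cbit (Suc j) d \<in> ?S \<longleftrightarrow> flag_base r (Suc j) + d < k"
    and a: "rbit (Suc j) (Suc d) \<in> ?S \<longleftrightarrow> flag_base r (Suc j) + Suc j + Suc d < k"
    using cbit_flag_set[of "Suc d" "Suc j" r k] cbit_flag_set[of d "Suc j" r k]
      rbit_flag_set[of "Suc d" "Suc j" r k] d j by auto
  have x: "rbit j d \<in> ?S \<Longrightarrow> flag_base r (Suc j) + 2 * j + 3 < k"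
    using cbit_flag_set[of 0 j r k] rbit_flag_set[of d j r k] d flag_base_Suc[OF j]
    by (cases "d = 0") (auto simp: rbit_0)
  show "cbit (Suc j) (Suc d) \<in> ?S \<Longrightarrow> cbit (Suc j) d \<in> ?S" using c y by simp
  show "rbit j d \<in> ?S \<Longrightarrow> cbit (Suc j) d \<in> ?S \<Longrightarrow> cbit (Suc j) (Suc d) \<in> ?S" using c x d by simp
  show "rbit (Suc j) (Suc d) \<in> ?S \<Longrightarrow> rbit j d \<in> ?S \<or> cbit (Suc j) (Suc d) \<in> ?S" using c a by simp
  show "rbit j d \<in> ?S \<Longrightarrow> rbit (Suc j) (Suc d) \<in> ?S" using a x d by simp
qed

lemma flag_set_step:
  assumes k: "k < r * r"
  shows "\<exists>b. b \<notin> flag_set r k \<and> flag_set r (Suc k) = insert b (flag_set r k)"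
proof -
  \<comment> \<open>The columns are filled from the last one, so it is the position counted from the
    end that falls into the block of the column \<open>i\<close> where step \<open>k\<close> takes
    place.\<close>
  define m where "m = r * r - Suc k"
  obtain i where i: "i * i \<le> m" "m < Suc i * Suc i" using square_bracket by blast
  have ir: "i < r"
  proof (rule ccontr)
    assume "\<not> i < r"
    then have "r * r \<le> i * i" by (intro mult_le_mono) auto
    then show False using i k by (simp add: m_def)
  qed
  have sq: "Suc j * Suc j \<le> r * r" if "j < r" for j using that by (intro mult_le_mono) auto
  define p where "p = k - flag_base r i"
  have p: "k = flag_base r i + p" "p \<le> 2 * i"
    using i k sq[OF ir] by (auto simp: p_def flag_base_def m_def)
  have col: "j = i \<and> q = p" if "j < r" "flag_base r j + q = k" "q \<le> 2 * j" for j q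
  proof -
    have "j * j \<le> m" "m \<le> j * j + 2 * j" using that sq[OF that(1)] k by (auto simp: flag_base_def m_def)
    then have "j = i" using column_unique[of j m i] i by simp
    then show ?thesis using that p by simp
  qed
  define b where "b = (if p \<le> i then cbit i p else rbit i (p - i))"
  have "b \<notin> flag_set r k"
    using cbit_flag_set[of p i r k] rbit_flag_set[of "p - i" i r k] p by (auto simp: b_def)
  moreover have "b \<in> flag_set r (Suc k)"
    using cbit_flag_set[of p i r "Suc k"] rbit_flag_set[of "p - i" i r "Suc k"] p ir by (auto simp: b_def)
  moreover have "flag_set r k \<subseteq> flag_set r (Suc k)" unfolding flag_set_def by fastforce
  moreover have "flag_set r (Suc k) \<subseteq> insert b (flag_set r k)"
  proof
    fix c assume "c \<in> flag_set r (Suc k)"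
    then consider j d where "c = cbit j d" "d \<le> j" "j < r" "flag_base r j + d < Suc k"
      | j d where "c = rbit j d" "0 < d" "d \<le> j" "j < r" "flag_base r j + j + d < Suc k"
      unfolding flag_set_def by blast
    then show "c \<in> insert b (flag_set r k)"
    proof cases
      case 1
      then show ?thesis using cbit_flag_set[of d j r k] col[of j d] by (auto simp: b_def less_Suc_eq)
    next
      case 2
      then show ?thesis using rbit_flag_set[of d j r k] col[of j "j + d"] by (auto simp: b_def less_Suc_eq)
    qed
  qed
  ultimately show ?thesis by blast
qed

text \<open>With indices from 0, the \<open>a\<close>-bit of row \<open>j - d\<close> and column
  \<open>j\<close> becomes the complement of the \<open>c\<close>-bit of row
  \<open>r - 1 - j\<close> and column \<open>r - 1 - j + d\<close>, and vice versa. The distance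
  \<open>d\<close> to the diagonal is preserved, which makes the map an involution.\<close>

definition reflect :: "nat \<Rightarrow> nat set \<Rightarrow> nat set" where
  "reflect r S = {cbit (r - 1 - j + d) d | j d. d \<le> j \<and> j < r \<and> rbit j d \<notin> S} \<union>
     {rbit (r - 1 - j + d) d | j d. d \<le> j \<and> j < r \<and> cbit j d \<notin> S}"

lemma reflect_bound:
  fixes d j r :: nat
  assumes "d \<le> j" "j < r"
  shows "d \<le> r - 1 - j + d" "r - 1 - j + d < r" "r - 1 - (r - 1 - j + d) + d = j"
  using assms by auto

lemma rbit_reflect:
  assumes "d \<le> j" "j < r"
  shows "rbit j d \<in> reflect r S \<longleftrightarrow> cbit (r - 1 - j + d) d \<notin> S"
proof
  note b = reflect_bound[OF assms]
  show "cbit (r - 1 - j + d) d \<notin> S \<Longrightarrow> rbit j d \<in> reflect r S"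
    unfolding reflect_def using b by (intro UnI2 CollectI exI[of _ "r - 1 - j + d"] exI[of _ d]) auto
  assume "rbit j d \<in> reflect r S"
  then consider j' d' where "rbit j d = cbit (r - 1 - j' + d') d'" "d' \<le> j'" "j' < r" "rbit j' d' \<notin> S"
    | j' d' where "rbit j d = rbit (r - 1 - j' + d') d'" "d' \<le> j'" "j' < r" "cbit j' d' \<notin> S"
    unfolding reflect_def by blast
  then show "cbit (r - 1 - j + d) d \<notin> S"
  proof cases
    case 1
    then have "j = r - 1 - j' + d'" "d = 0" "d' = 0" using assms by (auto simp: ix_eq_iff)
    then show ?thesis using 1 by (auto simp: rbit_0)
  next
    case 2
    then have "j = r - 1 - j' + d'" "d = d'" using assms by (auto simp: ix_eq_iff)
    then show ?thesis using 2 reflect_bound[OF 2(2,3)] by auto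
  qed
qed

lemma cbit_reflect:
  assumes "d \<le> j" "j < r"
  shows "cbit j d \<in> reflect r S \<longleftrightarrow> rbit (r - 1 - j + d) d \<notin> S"
proof
  note b = reflect_bound[OF assms]
  show "rbit (r - 1 - j + d) d \<notin> S \<Longrightarrow> cbit j d \<in> reflect r S"
    unfolding reflect_def using b by (intro UnI1 CollectI exI[of _ "r - 1 - j + d"] exI[of _ d]) auto
  assume "cbit j d \<in> reflect r S"
  then consider j' d' where "cbit j d = cbit (r - 1 - j' + d') d'" "d' \<le> j'" "j' < r" "rbit j' d' \<notin> S"
    | j' d' where "cbit j d = rbit (r - 1 - j' + d') d'" "d' \<le> j'" "j' < r" "cbit j' d' \<notin> S"
    unfolding reflect_def by blast
  then show "rbit (r - 1 - j + d) d \<notin> S"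
  proof cases
    case 1
    then have "j = r - 1 - j' + d'" "d = d'" using assms by (auto simp: ix_eq_iff)
    then show ?thesis using 1 reflect_bound[OF 1(2,3)] by auto
  next
    case 2
    then have "j = r - 1 - j' + d'" "d = 0" "d' = 0" using assms by (auto simp: ix_eq_iff)
    then show ?thesis using 2 by (auto simp: rbit_0)
  qed
qed

lemma square_subsetI:
  assumes "S \<subseteq> {..<r * r}"
    "\<And>j d. d \<le> j \<Longrightarrow> j < r \<Longrightarrow> rbit j d \<in> S \<Longrightarrow> rbit j d \<in> T"
    "\<And>j d. d \<le> j \<Longrightarrow> j < r \<Longrightarrow> cbit j d \<in> S \<Longrightarrow> cbit j d \<in> T"
  shows "S \<subseteq> T"
proof
  fix b assume b: "b \<in> S"
  then have "b < r * r" using assms(1) by auto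
  then show "b \<in> T"
    using b assms(2)[of 0] assms(2)[of "Suc _" "Suc _"] assms(3)[of "Suc _" "Suc _"]
      ix_less_square[of _ _ r]
    by (cases b rule: bit_cases) (metis le0, (metis Suc_le_mono)+)
qed

lemma reflect_subset: "reflect r S \<subseteq> {..<r * r}"
proof -
  have "rbit (r - 1 - j + d) d < r * r" "cbit (r - 1 - j + d) d < r * r" if "d \<le> j" "j < r" for j d
    using reflect_bound[OF that] ix_less_square[of d "r - 1 - j + d" r] by simp_all
  then show ?thesis unfolding reflect_def by auto
qed

lemma reflect_reflect:
  assumes "S \<subseteq> {..<r * r}"
  shows "reflect r (reflect r S) = S"
proof
  have a: "rbit j d \<in> reflect r (reflect r S) \<longleftrightarrow> rbit j d \<in> S" 
    "cbit j d \<in> reflect r (reflect r S) \<longleftrightarrow> cbit j d \<in> S" if "d \<le> j" "j < r" for j d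
    using rbit_reflect[OF that] cbit_reflect[OF that] reflect_bound[OF that]
      rbit_reflect[OF reflect_bound(1,2)[OF that], of S] cbit_reflect[OF reflect_bound(1,2)[OF that], of S]
    by simp_all
  show "reflect r (reflect r S) \<subseteq> S" by (rule square_subsetI[OF reflect_subset]) (simp_all add: a)
  show "S \<subseteq> reflect r (reflect r S)" by (rule square_subsetI[OF assms]) (simp_all add: a)
qed

lemma reflect_antimono: "S \<subseteq> T \<Longrightarrow> reflect r T \<subseteq> reflect r S"
  unfolding reflect_def by blast

text \<open>Reflection replaces \<open>x\<close>, \<open>y\<close>, \<open>a\<close>,
  \<open>c\<close> of a cell by the complements of \<open>y\<close>, \<open>x\<close>,
  \<open>c\<close>, \<open>a\<close>. The conditions \<open>c \<longrightarrow> y\<close> and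
  \<open>x \<longrightarrow> a\<close> change places, and the other two become
  \<open>a \<longrightarrow> x \<or> y\<close> and \<open>a \<and> y \<longrightarrow> c\<close>,
  which follow from the four conditions together.\<close>

lemma reflect_tower:
  assumes S: "S \<in> tower can_set can_clear (r * r)"
  shows "reflect r S \<in> tower can_set can_clear (r * r)"
proof (rule tower_squareI[OF reflect_subset])
  fix j d assume d: "d \<le> j" and j: "Suc j < r"
  define i where "i = r - 1 - Suc j + d"
  have i: "d \<le> i" "r - 1 - j + d = Suc i" "Suc i < r" "r - 1 - Suc j + Suc d = Suc i"
    using d j by (auto simp: i_def)
  have lt: "cbit (Suc i) (Suc d) < r * r" "rbit (Suc i) (Suc d) < r * r"
    using ix_less_square[of "Suc d" "Suc i" r] i by auto
  have m: "rbit j d \<in> reflect r S \<longleftrightarrow> cbit (Suc i) d \<notin> S"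
    "cbit (Suc j) d \<in> reflect r S \<longleftrightarrow> rbit i d \<notin> S"
    "cbit (Suc j) (Suc d) \<in> reflect r S \<longleftrightarrow> rbit (Suc i) (Suc d) \<notin> S"
    "rbit (Suc j) (Suc d) \<in> reflect r S \<longleftrightarrow> cbit (Suc i) (Suc d) \<notin> S"
    using rbit_reflect[of d j r S] cbit_reflect[of d "Suc j" r S] cbit_reflect[of "Suc d" "Suc j" r S]
      rbit_reflect[of "Suc d" "Suc j" r S] d j i i_def by auto
  note t = towerD[OF S i(1)]
  show "cbit (Suc j) (Suc d) \<in> reflect r S \<Longrightarrow> cbit (Suc j) d \<in> reflect r S"
    using t(4) lt m by blast
  show "rbit j d \<in> reflect r S \<Longrightarrow> cbit (Suc j) d \<in> reflect r S \<Longrightarrow> cbit (Suc j) (Suc d) \<in> reflect r S"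
    using t(1,3) m by blast
  show "rbit (Suc j) (Suc d) \<in> reflect r S \<Longrightarrow> rbit j d \<in> reflect r S \<or> cbit (Suc j) (Suc d) \<in> reflect r S"
    using t(2,3) lt m by blast
  show "rbit j d \<in> reflect r S \<Longrightarrow> rbit (Suc j) (Suc d) \<in> reflect r S"
    using t(1) m by blast
qed

locale growth_lattice = doubled_lattice can_set can_clear L h "r * r"
  for L :: "'a gorder" (structure) and h :: "'a \<Rightarrow> nat set" and r :: nat
begin

lemma extremal_half: "Max (chain_length ` {K. chain_in L K}) = r * r"
  and left_modular_L: "left_modular L"
proof -
  have "\<forall>k. \<exists>x. x \<in> C \<and> h x = flag_set r k" using h_surj[OF flag_set_tower] by blast
  then obtain s where "s k \<in> C" "h (s k) = flag_set r k" for k by metis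
  then show "Max (chain_length ` {K. chain_in L K}) = r * r" "left_modular L"
    using flag[of s] flag_set_step by simp_all
qed

lemma growth_lattice_dual: "growth_lattice (inv_gorder L) (reflect r \<circ> h) r"
proof
  have bij: "bij_betw (reflect r) (F (r * r)) (F (r * r))"
    by (rule bij_betw_byWitness[of _ "reflect r"])
      (use reflect_reflect reflect_tower tower_subset in auto)
  then show "bij_betw (reflect r \<circ> h) (carrier (inv_gorder L)) (F (r * r))"
    using bij_betw_trans[OF bij_h bij] by simp
  show "eq (inv_gorder L) = (=)" using eq_L by simp
  fix x y assume "x \<in> carrier (inv_gorder L)" "y \<in> carrier (inv_gorder L)"
  then have xy: "x \<in> C" "y \<in> C" by auto
  have "h y \<subseteq> h x \<longleftrightarrow> reflect r (h x) \<subseteq> reflect r (h y)"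
    using reflect_antimono[of "h y" "h x" r] reflect_antimono[of "reflect r (h x)" "reflect r (h y)" r]
      reflect_reflect[OF h_subset[OF xy(1)]] reflect_reflect[OF h_subset[OF xy(2)]] by auto
  then show "x \<sqsubseteq>\<^bsub>inv_gorder L\<^esub> y \<longleftrightarrow> (reflect r \<circ> h) x \<subseteq> (reflect r \<circ> h) y"
    using le_iff[OF xy(2,1)] by simp
qed

end

section \<open>Polygons\<close>

context doubled_lattice
begin

lemma interval_iff:
  "x \<in> C \<Longrightarrow> t \<in> C \<Longrightarrow> z \<in> \<lbrace>x..t\<rbrace> \<longleftrightarrow> z \<in> C \<and> h x \<subseteq> h z \<and> h z \<subseteq> h t"
  by (auto simp: at_least_at_most_def le_iff)

lemma chain_in_iff:
  "chain_in L A \<longleftrightarrow> A \<noteq> {} \<and> A \<subseteq> C \<and> (\<forall>a\<in>A. \<forall>b\<in>A. h a \<subseteq> h b \<or> h b \<subseteq> h a)"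
proof -
  have "a \<sqsubseteq> b \<longleftrightarrow> h a \<subseteq> h b" if "A \<subseteq> C" "a \<in> A" "b \<in> A" for a b
    using that by (intro le_iff) auto
  then show ?thesis unfolding chain_in_def by (intro conj_cong ball_cong) simp_all
qed

text \<open>By incomparability a chain with an inner element of one side stays on that side, and a
  chain without inner elements extends to \<open>A\<close>. So there are no further maximal
  chains.\<close>

lemma polygon_chainsI:
  assumes x: "x \<in> C" and t: "t \<in> C" and le: "h x \<subseteq> h t"
    and I: "\<lbrace>x..t\<rbrace> = A \<union> B" "A \<inter> B = {x, t}"
    and ch: "chain_in L A" "chain_in L B"
    and ne: "A - {x, t} \<noteq> {}" "B - {x, t} \<noteq> {}"
    and inc: "\<And>a b. a \<in> A - {x, t} \<Longrightarrow> b \<in> B - {x, t} \<Longrightarrow> \<not> h a \<subseteq> h b \<and> \<not> h b \<subseteq> h a"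
  shows "polygon_chains L x t A B"
proof -
  have subA: "E \<subseteq> A" if E: "chain_in L E" "E \<subseteq> A \<union> B" "a \<in> E" "a \<in> A - {x, t}" for E a
  proof
    fix e assume e: "e \<in> E"
    show "e \<in> A"
    proof (rule ccontr)
      assume "e \<notin> A"
      then have "e \<in> B - {x, t}" using e E(2) I(2) by blast
      then show False using inc[OF E(4)] E(1,3) e unfolding chain_in_iff by blast
    qed
  qed
  have subB: "E \<subseteq> B" if E: "chain_in L E" "E \<subseteq> A \<union> B" "b \<in> E" "b \<in> B - {x, t}" for E b
  proof
    fix e assume e: "e \<in> E"
    show "e \<in> B"
    proof (rule ccontr)
      assume "e \<notin> B"
      then have "e \<in> A - {x, t}" using e E(2) I(2) by blast
      then show False using inc[OF _ E(4)] E(1,3) e unfolding chain_in_iff by blast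
    qed
  qed
  have "E \<in> {A, B}" if E: "maximal_chain L \<lbrace>x..t\<rbrace> E" for E
  proof -
    have E1: "chain_in L E" "E \<subseteq> A \<union> B" and max: "\<And>Q. chain_in L Q \<Longrightarrow> Q \<subseteq> A \<union> B \<Longrightarrow> E \<subseteq> Q \<Longrightarrow> Q = E"
      using E I(1) unfolding maximal_chain_def by auto
    consider a where "a \<in> E" "a \<in> A - {x, t}" | b where "b \<in> E" "b \<in> B - {x, t}" | "E \<subseteq> {x, t}"
      using E1(2) by blast
    then show ?thesis
    proof cases
      case 1
      then show ?thesis using max[OF ch(1)] subA[OF E1] by blast
    next
      case 2
      then show ?thesis using max[OF ch(2)] subB[OF E1] by blast
    next
      case 3
      then show ?thesis using max[OF ch(1)] I(2) by blast
    qed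
  qed
  moreover have "maximal_chain L \<lbrace>x..t\<rbrace> A"
    unfolding maximal_chain_def I(1) using ch(1) subA ne(1) by blast
  moreover have "maximal_chain L \<lbrace>x..t\<rbrace> B"
    unfolding maximal_chain_def I(1) using ch(2) subB ne(2) by blast
  moreover have "A \<noteq> B" using ne I(2) by blast
  ultimately show ?thesis
    unfolding polygon_chains_def using x t le I le_iff[OF x t] by blast
qed

lemma quadrilateralI:
  assumes C: "x \<in> C" "t \<in> C" "y\<^sub>1 \<in> C" "y\<^sub>2 \<in> C"
    and I: "\<lbrace>x..t\<rbrace> = {x, y\<^sub>1, y\<^sub>2, t}"
    and lt: "h x \<subset> h y\<^sub>1" "h y\<^sub>1 \<subset> h t" "h x \<subset> h y\<^sub>2" "h y\<^sub>2 \<subset> h t"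
    and inc: "\<not> h y\<^sub>1 \<subseteq> h y\<^sub>2" "\<not> h y\<^sub>2 \<subseteq> h y\<^sub>1"
  shows "quadrilateral L x t"
proof -
  have ne: "x \<noteq> y\<^sub>1" "x \<noteq> y\<^sub>2" "x \<noteq> t" "y\<^sub>1 \<noteq> t" "y\<^sub>2 \<noteq> t" "y\<^sub>1 \<noteq> y\<^sub>2" using lt inc by auto
  have "polygon_chains L x t {x, y\<^sub>1, t} {x, y\<^sub>2, t}"
  proof (rule polygon_chainsI)
    show "chain_in L {x, y\<^sub>1, t}" "chain_in L {x, y\<^sub>2, t}" using C lt unfolding chain_in_iff by auto
  qed (use C I lt inc ne in auto)
  moreover have "chain_length {x, y\<^sub>1, t} = 2" "chain_length {x, y\<^sub>2, t} = 2"
    using ne by (auto simp: chain_length_def)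
  ultimately show ?thesis unfolding quadrilateral_def by blast
qed

lemma hexagonI:
  assumes C: "x \<in> C" "t \<in> C" "y\<^sub>1 \<in> C" "y\<^sub>2 \<in> C" "w \<in> C" "v \<in> C"
    and I: "\<lbrace>x..t\<rbrace> = {x, y\<^sub>1, y\<^sub>2, w, v, t}"
    and lt: "h x \<subset> h y\<^sub>1" "h y\<^sub>1 \<subset> h t" "h x \<subset> h y\<^sub>2" "h y\<^sub>2 \<subset> h w" "h w \<subset> h v" "h v \<subset> h t"
    and inc: "\<not> h y\<^sub>1 \<subseteq> h v" "\<not> h y\<^sub>2 \<subseteq> h y\<^sub>1"
  shows "hexagon L x t"
proof -
  have lt': "h x \<subset> h w" "h x \<subset> h v" "h y\<^sub>2 \<subset> h v" "h y\<^sub>2 \<subset> h t" "h w \<subset> h t" "h x \<subset> h t"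
    using lt by auto
  have inc': "\<not> h y\<^sub>1 \<subseteq> h w" "\<not> h y\<^sub>1 \<subseteq> h y\<^sub>2" "\<not> h w \<subseteq> h y\<^sub>1" "\<not> h v \<subseteq> h y\<^sub>1"
    using lt inc by auto
  have "x \<noteq> y\<^sub>1 \<and> x \<noteq> y\<^sub>2 \<and> x \<noteq> w \<and> x \<noteq> v \<and> x \<noteq> t \<and> y\<^sub>1 \<noteq> t \<and> y\<^sub>2 \<noteq> t \<and> w \<noteq> t \<and> v \<noteq> t \<and>
    y\<^sub>2 \<noteq> w \<and> y\<^sub>2 \<noteq> v \<and> w \<noteq> v \<and> y\<^sub>1 \<noteq> y\<^sub>2 \<and> y\<^sub>1 \<noteq> w \<and> y\<^sub>1 \<noteq> v"
    using lt lt' inc inc' by (intro conjI notI) blast+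
  note ne = this[THEN conjunct1] this
  have "polygon_chains L x t {x, y\<^sub>1, t} {x, y\<^sub>2, w, v, t}"
  proof (rule polygon_chainsI)
    show "chain_in L {x, y\<^sub>1, t}" using C lt lt' unfolding chain_in_iff by auto
    show "chain_in L {x, y\<^sub>2, w, v, t}"
      using C lt[THEN psubset_imp_subset] lt'[THEN psubset_imp_subset] unfolding chain_in_iff by simp
    show "{x, y\<^sub>1, t} \<inter> {x, y\<^sub>2, w, v, t} = {x, t}" using ne by auto
    show "\<lbrace>x..t\<rbrace> = {x, y\<^sub>1, t} \<union> {x, y\<^sub>2, w, v, t}" using I by auto
    fix a b assume "a \<in> {x, y\<^sub>1, t} - {x, t}" "b \<in> {x, y\<^sub>2, w, v, t} - {x, t}"
    then have "a = y\<^sub>1" "b = y\<^sub>2 \<or> b = w \<or> b = v" by auto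
    then show "\<not> h a \<subseteq> h b \<and> \<not> h b \<subseteq> h a" using inc inc' by auto
  qed (use C lt' ne in auto)
  moreover have "chain_length {x, y\<^sub>1, t} = 2" "chain_length {x, y\<^sub>2, w, v, t} = 4"
    using ne by (simp_all add: chain_length_def)
  ultimately show ?thesis unfolding hexagon_def by blast
qed

lemma chain_extends_to_maximal:
  assumes "chain_in L E" "E \<subseteq> S" "S \<subseteq> C"
  obtains M where "maximal_chain L S M" "E \<subseteq> M"
proof -
  let ?A = "{Q. chain_in L Q \<and> Q \<subseteq> S}"
  have "finite ?A" by (rule finite_subset[of _ "Pow C"]) (use finite_L assms in auto)
  from finite_has_maximal2[OF this, of E] assms obtain M
    where M: "M \<in> ?A" "E \<subseteq> M" "\<forall>Q\<in>?A. M \<subseteq> Q \<longrightarrow> M = Q" by auto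
  then have "maximal_chain L S M" unfolding maximal_chain_def by auto
  with M(2) that show thesis by blast
qed

lemma upper_cover_below:
  assumes "x \<in> C" "z \<in> C" "h x \<subset> h z"
  obtains w where "covers L w x" "h w \<subseteq> h z"
proof -
  let ?A = "{w \<in> C. h x \<subset> h w \<and> h w \<subseteq> h z}"
  have "finite ?A" "?A \<noteq> {}" using finite_L assms by auto
  then obtain w where w: "is_arg_min (\<lambda>x. card (h x)) (\<lambda>x. x \<in> ?A) w"
    using ex_is_arg_min_if_finite by blast
  have wA: "w \<in> ?A" using w by (simp add: is_arg_min_def)
  have "\<not> (h x \<subset> h y \<and> h y \<subset> h w)" if "y \<in> C" for y
  proof
    assume y: "h x \<subset> h y \<and> h y \<subset> h w"
    then have "y \<in> ?A" using that wA by auto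
    then have "card (h w) \<le> card (h y)" using w by (simp add: is_arg_min_linorder)
    moreover have "finite (h w)" using wA finite_h by simp
    ultimately show False using y psubset_card_mono[of "h w" "h y"] by simp
  qed
  then have "covers L w x" using wA assms(1) unfolding covers_iff by simp
  then show thesis using that wA by simp
qed

text \<open>Take a cover \<open>z\<close> of \<open>x\<close> below \<open>a\<close>. A maximal
  chain through \<open>z\<close> and \<open>a\<close> can only be \<open>A\<close>; as
  \<open>z\<close> is not an end, it is not on \<open>B\<close>, and \<open>A\<close> is the only
  maximal chain through it. This rests on \<open>A\<close> and \<open>B\<close> being all maximal
  chains of the interval.\<close>

lemma polygon_chains_cover:
  assumes P: "polygon_chains L x y A B" and a: "a \<in> A" "a \<notin> B"
  obtains z where "covers L z x" "z \<in> A" "z \<notin> B"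
    "\<And>Q. chain_in L Q \<Longrightarrow> Q \<subseteq> \<lbrace>x..y\<rbrace> \<Longrightarrow> z \<in> Q \<Longrightarrow> Q \<subseteq> A"
proof -
  have x: "x \<in> C" and y: "y \<in> C" and xy: "h x \<subseteq> h y"
    and M: "\<And>E. maximal_chain L \<lbrace>x..y\<rbrace> E \<Longrightarrow> E = A \<or> E = B"
    and I: "\<lbrace>x..y\<rbrace> = A \<union> B" "A \<inter> B = {x, y}"
    using P le_iff unfolding polygon_chains_def by auto
  have aI: "a \<in> C" "h x \<subseteq> h a" "h a \<subseteq> h y"
    using a I(1) interval_iff[OF x y, of a] by auto
  have "a \<noteq> x" "a \<noteq> y" using a I(2) by auto
  then have lt: "h x \<subset> h a" "h a \<subset> h y" using aI h_inj x y by blast+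
  obtain z where z: "covers L z x" "h z \<subseteq> h a" using upper_cover_below[OF x aI(1) lt(1)] .
  have zC: "z \<in> C" "h x \<subset> h z" using z(1) unfolding covers_iff by auto
  have sub: "\<lbrace>x..y\<rbrace> \<subseteq> C" using interval_iff[OF x y] by auto
  have "chain_in L {z, a}" using zC aI z(2) unfolding chain_in_iff by auto
  moreover have "{z, a} \<subseteq> \<lbrace>x..y\<rbrace>" using interval_iff[OF x y] zC aI z(2) by auto
  ultimately obtain E where "maximal_chain L \<lbrace>x..y\<rbrace> E" "{z, a} \<subseteq> E"
    using chain_extends_to_maximal sub by blast
  then have zA: "z \<in> A" using M a by blast
  have "z \<noteq> x" "z \<noteq> y" using zC lt z(2) by auto
  then have zB: "z \<notin> B" using zA I(2) by blast
  have "Q \<subseteq> A" if Q: "chain_in L Q" "Q \<subseteq> \<lbrace>x..y\<rbrace>" "z \<in> Q" for Q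
  proof -
    obtain E where "maximal_chain L \<lbrace>x..y\<rbrace> E" "Q \<subseteq> E"
      using chain_extends_to_maximal[OF Q(1,2) sub] .
    then show ?thesis using M zB Q(3) by blast
  qed
  then show thesis using that z(1) zA zB by blast
qed

text \<open>Choose a cover of \<open>x\<close> on each side. Their join lies above both, hence on
  both sides, and can only be \<open>y\<close>. Thus the claim about arbitrary polygons reduces to
  intervals generated by two covers.\<close>

lemma polygon_atoms:
  assumes "polygon L x y"
  obtains y\<^sub>1 y\<^sub>2 where "covers L y\<^sub>1 x" "covers L y\<^sub>2 x" "y\<^sub>1 \<noteq> y\<^sub>2" "y = y\<^sub>1 \<squnion> y\<^sub>2"
proof -
  obtain A B where P: "polygon_chains L x y A B" using assms unfolding polygon_def by blast
  then have P': "polygon_chains L x y B A" unfolding polygon_chains_def by blast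
  have max: "maximal_chain L \<lbrace>x..y\<rbrace> A" "maximal_chain L \<lbrace>x..y\<rbrace> B" "A \<noteq> B" "A \<inter> B = {x, y}"
    "x \<in> C" "y \<in> C" using P unfolding polygon_chains_def by auto
  then obtain a b where ab: "a \<in> A" "a \<notin> B" "b \<in> B" "b \<notin> A" unfolding maximal_chain_def by blast
  obtain z where z: "covers L z x" "z \<in> A" "z \<notin> B"
    "\<And>Q. chain_in L Q \<Longrightarrow> Q \<subseteq> \<lbrace>x..y\<rbrace> \<Longrightarrow> z \<in> Q \<Longrightarrow> Q \<subseteq> A"
    using polygon_chains_cover[OF P ab(1,2)] by metis
  obtain w where w: "covers L w x" "w \<in> B" "w \<notin> A"
    "\<And>Q. chain_in L Q \<Longrightarrow> Q \<subseteq> \<lbrace>x..y\<rbrace> \<Longrightarrow> w \<in> Q \<Longrightarrow> Q \<subseteq> B"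
    using polygon_chains_cover[OF P' ab(3,4)] by metis
  have zC: "z \<in> C" "h x \<subset> h z" and wC: "w \<in> C" "h x \<subset> h w" using z w unfolding covers_iff by auto
  have "z \<in> \<lbrace>x..y\<rbrace>" "w \<in> \<lbrace>x..y\<rbrace>" using z(2) w(2) max unfolding maximal_chain_def by auto
  then have "h z \<subseteq> h y" "h w \<subseteq> h y" using interval_iff[OF max(5,6)] by auto
  then have ty: "h (z \<squnion> w) \<subseteq> h y" using h_join_least zC wC max by simp
  have tC: "z \<squnion> w \<in> C" using zC wC by simp
  note ge = h_join_ge[OF zC(1) wC(1)]
  then have "h x \<subseteq> h (z \<squnion> w)" using zC(2) by blast
  then have I: "z \<squnion> w \<in> \<lbrace>x..y\<rbrace>" using interval_iff[OF max(5,6)] tC ty by simp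
  have "chain_in L {z, z \<squnion> w}" "chain_in L {w, z \<squnion> w}"
    using zC wC tC ge unfolding chain_in_iff by simp_all
  then have "z \<squnion> w \<in> A" "z \<squnion> w \<in> B"
    using z(4)[of "{z, z \<squnion> w}"] w(4)[of "{w, z \<squnion> w}"] I \<open>z \<in> \<lbrace>x..y\<rbrace>\<close> \<open>w \<in> \<lbrace>x..y\<rbrace>\<close> by simp_all
  then have "z \<squnion> w \<in> {x, y}" using max(4) by blast
  then have "y = z \<squnion> w" using ge zC by auto
  moreover have "z \<noteq> w" using z w by auto
  ultimately show thesis using that z(1) w(1) by blast
qed

section \<open>How a cover changes the bits\<close>

lemma cover_or_equal:
  assumes c: "covers L y x" and m: "m \<le> N" and S: "S \<in> F m" "pre m x \<subseteq> S" "S \<subseteq> pre m y"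
  shows "S = pre m x \<or> S = pre m y"
proof -
  have C: "x \<in> C" "y \<in> C" "h x \<subset> h y" and no: "\<And>z. z \<in> C \<Longrightarrow> h x \<subset> h z \<Longrightarrow> \<not> h z \<subset> h y"
    using c unfolding covers_iff by auto
  obtain Z where Z: "Z \<in> F N" "h x \<subseteq> Z" "Z \<subseteq> h y" "cut m Z = S"
    using extend_between[OF h_tower[OF C(1)] h_tower[OF C(2)] psubset_imp_subset[OF C(3)] m S] by blast
  obtain z where "z \<in> C" "h z = Z" using h_surj[OF Z(1)] by blast
  then have "Z = h x \<or> Z = h y" using no[of z] Z by blast
  then show ?thesis using Z by blast
qed

text \<open>Once the prefixes have separated, a changed bit that is still free at \<open>x\<close>
  could be set on the prefix of \<open>x\<close> alone, and one free at \<open>y\<close> could be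
  left clear on the prefix of \<open>y\<close>. Either would lie strictly between the two prefixes
  of length \<open>Suc b\<close>.\<close>

lemma cover_bit:
  assumes c: "covers L y x" and b: "b < N" "pre b x \<noteq> pre b y" "b \<in> h y" "b \<notin> h x"
  shows "\<not> split_at b x" "\<not> split_at b y"
proof -
  have C: "x \<in> C" "y \<in> C" "h x \<subset> h y" using c unfolding covers_iff by auto
  have F: "pre b x \<in> F b" "pre b y \<in> F b" using tower_cut[OF h_tower[OF C(1)]] tower_cut[OF h_tower[OF C(2)]] b(1) by simp_all
  have UD: "gg b (cut b S) = gg b S" if "gg = U \<or> gg = D" for gg S
    using that U_cong[of S b "cut b S"] D_cong[of S b "cut b S"] by auto
  show "\<not> split_at b x"
  proof
    assume "split_at b x"
    then have "insert b (pre b x) \<in> F (Suc b)"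
      using tower_insert[OF F(1)] UD[of U] by (simp add: split_at_def)
    then have "insert b (pre b x) = pre (Suc b) x \<or> insert b (pre b x) = pre (Suc b) y"
      using C b by (intro cover_or_equal[OF c]) (auto simp: cut_Suc)
    then show False using b by (auto simp: cut_Suc)
  qed
  show "\<not> split_at b y"
  proof
    assume "split_at b y"
    then have "pre b y \<in> F (Suc b)"
      using tower_same[OF F(2)] UD[of D] by (simp add: split_at_def)
    then have "pre b y = pre (Suc b) x \<or> pre b y = pre (Suc b) y"
      using C b by (intro cover_or_equal[OF c]) (auto simp: cut_Suc)
    then show False using b by (auto simp: cut_Suc)
  qed
qed

end

text \<open>The bit \<open>b\<close> is an \<open>a\<close>-bit of row index \<open>k + 1\<close> or a \<open>c\<close>-bit of column index \<open>k + 1\<close>.\<close>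

definition online :: "nat \<Rightarrow> nat \<Rightarrow> bool" where
  "online k b \<longleftrightarrow> (\<exists>j d. d \<le> j \<and> b = rbit j d \<and> k = j - d) \<or> (\<exists>d\<le>k. b = cbit k d)"

lemma online_rbit: "d \<le> j \<Longrightarrow> online k (rbit j d) \<longleftrightarrow> k = j - d"
  by (auto simp: online_def ix_eq_iff)

lemma online_cbit: "d \<le> j \<Longrightarrow> online k (cbit j d) \<longleftrightarrow> k = j"
  by (auto simp: online_def ix_eq_iff)

context growth_lattice
begin

lemma bit_lt: "x \<in> C \<Longrightarrow> b \<in> h x \<Longrightarrow> b < r * r"
  using h_subset by blast

text \<open>An \<open>a\<close>-bit of a join can be forced only by the preceding
  \<open>a\<close>-bit of its row; by induction some argument has that one and therefore has the
  forced bit as well. So on \<open>a\<close>-bits joins are unions, as meets are intersections on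
  \<open>c\<close>-bits.\<close>

lemma rbit_join:
  assumes C: "x \<in> C" "y \<in> C"
  shows "d \<le> j \<Longrightarrow> j < r \<Longrightarrow> rbit j d \<in> h (x \<squnion> y) \<longleftrightarrow> rbit j d \<in> h x \<or> rbit j d \<in> h y"
proof (induction d arbitrary: j)
  case 0
  then show ?case using bit_join[OF C, of "rbit j 0"] ix_less_square(1)[of 0 j r] can_simps_diag by simp
next
  case (Suc d)
  then obtain i where j: "j = Suc i" and d: "d \<le> i" by (cases j) auto
  have b: "rbit j (Suc d) < r * r" using Suc ix_less_square(1) by simp
  have "rbit i d \<in> h x \<Longrightarrow> rbit j (Suc d) \<in> h x" "rbit i d \<in> h y \<Longrightarrow> rbit j (Suc d) \<in> h y"
    using towerD(4)[OF h_tower[OF C(1)] d] towerD(4)[OF h_tower[OF C(2)] d] b j by simp_all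
  then show ?case using bit_join[OF C b] Suc.IH[of i] Suc.prems j d can_simps_row(2)[OF d, of "h (x \<squnion> y)"] by auto
qed

lemma cbit_meet:
  assumes C: "x \<in> C" "y \<in> C"
  shows "d \<le> j \<Longrightarrow> j < r \<Longrightarrow> cbit j d \<in> h (x \<sqinter> y) \<longleftrightarrow> cbit j d \<in> h x \<and> cbit j d \<in> h y"
proof (induction d)
  case 0
  then show ?case
    using bit_meet[OF C, of "cbit j 0"] ix_less_square(2)[of 0 j r] can_simps_diag(1)[of j] by (simp add: rbit_0)
next
  case (Suc d)
  then obtain i where j: "j = Suc i" and d: "d \<le> i" by (cases j) auto
  have b: "cbit j (Suc d) < r * r" using Suc ix_less_square(2) by simp
  have "cbit j (Suc d) \<in> h x \<Longrightarrow> cbit j d \<in> h x" "cbit j (Suc d) \<in> h y \<Longrightarrow> cbit j d \<in> h y"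
    using towerD(1)[OF h_tower[OF C(1)] d] towerD(1)[OF h_tower[OF C(2)] d] j by simp_all
  then show ?case using bit_meet[OF C b] Suc.IH Suc.prems j d can_simps_col(1)[OF d, of "h (x \<sqinter> y)"] by auto
qed

text \<open>After the first one, a changed bit is free neither at \<open>x\<close> nor at
  \<open>y\<close>. Comparing the two shows that a changed \<open>c\<close>-bit comes after a
  changed \<open>c\<close>-bit of its column, and a changed \<open>a\<close>-bit after a changed
  \<open>a\<close>-bit of its row. Tracing back to the first changed bit never leaves one
  line.\<close>

lemma cover_online:
  assumes c: "covers L y x"
  shows "\<exists>k. \<forall>b\<in>h y - h x. online k b"
proof -
  have C: "x \<in> C" "y \<in> C" "h x \<subset> h y" using c unfolding covers_iff by auto
  obtain m where m: "m < r * r" "m \<in> h y" "m \<notin> h x" "pre m x = pre m y"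
    using first_difference[OF C(1,2)] C(3) le_iff[OF C(1,2)] by (metis psubset_imp_subset psubsetE)
  have "\<exists>k. online k m"
    by (cases m rule: bit_cases) (auto simp: online_rbit online_cbit)
  then obtain k where k: "online k m" by blast
  have "online k b" if "b \<in> h y - h x" for b
    using that
  proof (induction b rule: less_induct)
    case (less b)
    have b: "b < r * r" "b \<in> h y" "b \<notin> h x" using less.prems bit_lt C by auto
    show ?case
    proof (cases "b = m")
      case False
      then have "m < b" using m(4) b by (metis IntD1 IntI lessThan_iff linorder_neqE_nat)
      then have "pre b x \<noteq> pre b y" using m by blast
      note ns = cover_bit[OF c b(1) this b(2,3)]
      note Tx = towerD[OF h_tower[OF C(1)]] and Ty = towerD[OF h_tower[OF C(2)]]
      show ?thesis
      proof (cases b rule: bit_cases)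
        case (diag j)
        then show ?thesis using ns(1) can_simps_diag by (simp add: split_at_def)
      next
        case (col j d)
        have lt: "cbit (Suc j) d < b" using ix_less[OF col(1)] col(2) by simp
        have y: "cbit (Suc j) d \<in> h y" using Ty(1)[OF col(1)] b col(2) by simp
        have "cbit (Suc j) d \<notin> h x"
        proof
          assume a: "cbit (Suc j) d \<in> h x"
          then have "rbit j d \<notin> h x" using Tx(2)[OF col(1)] b col(2) by blast
          then show False using ns(1) a can_simps_col[OF col(1)] col(2) by (simp add: split_at_def)
        qed
        then have "online k (cbit (Suc j) d)" using less.IH[OF lt] y by simp
        then show ?thesis using col by (simp add: online_cbit)
      next
        case (row j d)
        have lt: "rbit j d < b" "cbit (Suc j) (Suc d) < b" using ix_less[OF row(1)] row(2) by simp_all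
        have ax: "rbit j d \<notin> h x" using Tx(4)[OF row(1)] b row(2) by blast
        then have cx: "cbit (Suc j) (Suc d) \<notin> h x"
          using ns(1) can_simps_row[OF row(1), of "h x"] row(2) by (auto simp: split_at_def)
        have "rbit j d \<in> h y"
        proof (rule ccontr)
          assume a: "rbit j d \<notin> h y"
          then have "cbit (Suc j) (Suc d) \<in> h y" using Ty(3)[OF row(1)] b row(2) by blast
          then show False using ns(2) a can_simps_row[OF row(1), of "h y"] row(2) by (simp add: split_at_def)
        qed
        then have "online k (rbit j d)" using less.IH[OF lt(1)] ax by simp
        then show ?thesis using row by (simp add: online_rbit)
      qed
    qed (use k in simp)
  qed
  then show ?thesis by blast
qed

text \<open>A bit that is new in the join is a forced \<open>c\<close>-bit, since
  \<open>a\<close>-bits are unions. The preceding \<open>c\<close>-bit of its column is set in the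
  join; it is clear in \<open>x\<close>, for otherwise both atoms would have it, would have to lack
  \<open>rbit j d\<close>, and the join would lack it too. So that bit changes as well, and it is on
  the same line.\<close>

lemma join_online:
  assumes C: "x \<in> C" "y\<^sub>1 \<in> C" "y\<^sub>2 \<in> C" "h x \<subseteq> h y\<^sub>1" "h x \<subseteq> h y\<^sub>2"
    and o: "\<And>b. b \<in> h y\<^sub>1 - h x \<Longrightarrow> \<exists>k\<in>K. online k b" "\<And>b. b \<in> h y\<^sub>2 - h x \<Longrightarrow> \<exists>k\<in>K. online k b"
  shows "b \<in> h (y\<^sub>1 \<squnion> y\<^sub>2) - h x \<Longrightarrow> \<exists>k\<in>K. online k b"
proof (induction b rule: less_induct)
  case (less b)
  let ?t = "y\<^sub>1 \<squnion> y\<^sub>2"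
  have tC: "?t \<in> C" using C by simp
  have b: "b < r * r" "b \<in> h ?t" "b \<notin> h x" using less.prems bit_lt tC by auto
  show ?case
  proof (cases "b \<in> h y\<^sub>1 \<or> b \<in> h y\<^sub>2")
    case True
    then show ?thesis using o b by blast
  next
    case False
    then have nD: "\<not> can_clear b (h ?t)" using bit_join[OF C(2,3) b(1)] b by simp
    show ?thesis
    proof (cases b rule: bit_cases)
      case (diag j)
      then show ?thesis using nD can_simps_diag by simp
    next
      case (row j d)
      have "Suc j < r" using ix_less_square(1)[of "Suc d" "Suc j" r] b(1) row by simp
      then show ?thesis using False rbit_join[OF C(2,3), of "Suc d" "Suc j"] row b(2) by simp
    next
      case (col j d)
      have j: "Suc j < r" using ix_less_square(2)[of "Suc d" "Suc j" r] b(1) col by simp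
      have at: "rbit j d \<in> h ?t" "cbit (Suc j) d \<in> h ?t" using nD can_simps_col[OF col(1)] col(2) by auto
      have "cbit (Suc j) d \<notin> h x"
      proof
        assume "cbit (Suc j) d \<in> h x"
        then have "cbit (Suc j) d \<in> h y\<^sub>1" "cbit (Suc j) d \<in> h y\<^sub>2" using C by auto
        then have "rbit j d \<notin> h y\<^sub>1" "rbit j d \<notin> h y\<^sub>2"
          using towerD(2)[OF h_tower[OF C(2)] col(1)] towerD(2)[OF h_tower[OF C(3)] col(1)]
            b(1) False col(2) by blast+
        then show False using rbit_join[OF C(2,3) col(1)] at(1) j by simp
      qed
      then have "\<exists>k\<in>K. online k (cbit (Suc j) d)"
        using less.IH[of "cbit (Suc j) d"] at(2) ix_less(1)[OF col(1)] col(2) by simp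
      then show ?thesis using col by (simp add: online_cbit)
    qed
  qed
qed

section \<open>Intervals generated by two covers of one element\<close>

definition atoms :: "'a \<Rightarrow> 'a \<Rightarrow> 'a \<Rightarrow> 'a \<Rightarrow> bool" where
  "atoms x y z t \<longleftrightarrow> covers L y x \<and> covers L z x \<and> y \<noteq> z \<and> t = y \<squnion> z"

lemma atoms_sym: "atoms x y z t \<Longrightarrow> atoms x z y t"
  unfolding atoms_def using join_comm[of L y z] by auto

lemma atomsD:
  assumes "atoms x y z t"
  shows "x \<in> C" "y \<in> C" "z \<in> C" "t \<in> C" "h x \<subset> h y" "h x \<subset> h z" "h y \<subset> h t" "h z \<subset> h t"
    "\<not> h y \<subseteq> h z" "\<not> h z \<subseteq> h y" "y \<sqinter> z = x" "covers L y x" "covers L z x" "t = y \<squnion> z"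
proof -
  show c: "covers L y x" "covers L z x" and t: "t = y \<squnion> z" using assms by (auto simp: atoms_def)
  show C: "x \<in> C" "y \<in> C" "z \<in> C" and lt: "h x \<subset> h y" "h x \<subset> h z"
    using c unfolding covers_iff by auto
  have no: "\<And>w. w \<in> C \<Longrightarrow> h x \<subset> h w \<Longrightarrow> \<not> h w \<subset> h y" "\<And>w. w \<in> C \<Longrightarrow> h x \<subset> h w \<Longrightarrow> \<not> h w \<subset> h z"
    using c unfolding covers_iff by auto
  show tC: "t \<in> C" using C t by simp
  have ne: "h y \<noteq> h z" using assms h_inj C by (simp add: atoms_def)
  show inc: "\<not> h y \<subseteq> h z" "\<not> h z \<subseteq> h y"
    using no(2)[OF C(2) lt(1)] no(1)[OF C(3) lt(2)] ne by auto
  show "h y \<subset> h t" "h z \<subset> h t" using h_join_ge[OF C(2,3)] t inc by auto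
  have le: "h (y \<sqinter> z) \<subseteq> h y" "h (y \<sqinter> z) \<subseteq> h z" "h x \<subseteq> h (y \<sqinter> z)"
    using h_meet_le[OF C(2,3)] h_meet_greatest[OF C(2,3,1)] lt by auto
  moreover have "h (y \<sqinter> z) \<noteq> h y" using le(2) inc by auto
  ultimately have "h (y \<sqinter> z) = h x" using no(1)[OF meet_closed[OF C(2,3)]] by blast
  then show "y \<sqinter> z = x" using h_inj C by simp
qed

lemma atoms_online:
  assumes p: "atoms x y z t"
  shows "\<exists>k\<^sub>1 k\<^sub>2. \<forall>b\<in>h t - h x. online k\<^sub>1 b \<or> online k\<^sub>2 b"
proof -
  note q = atomsD[OF p]
  obtain k\<^sub>1 where k1: "\<forall>b\<in>h y - h x. online k\<^sub>1 b" using cover_online[OF q(12)] by blast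
  obtain k\<^sub>2 where k2: "\<forall>b\<in>h z - h x. online k\<^sub>2 b" using cover_online[OF q(13)] by blast
  have "\<exists>k\<in>{k\<^sub>1, k\<^sub>2}. online k b" if b: "b \<in> h t - h x" for b
    using join_online[OF q(1-3), of "{k\<^sub>1, k\<^sub>2}" b] q(5,6,14) k1 k2 b by auto
  then show ?thesis by blast
qed

text \<open>Only at an active cell can a doubling add elements to \<open>[x, t]\<close> once both atoms are visible.\<close>

definition active :: "'a \<Rightarrow> 'a \<Rightarrow> nat \<Rightarrow> nat \<Rightarrow> bool" where
  "active x t j d \<longleftrightarrow> d \<le> j \<and> rbit j d \<in> h t - h x \<and> (\<exists>e\<le>Suc j. cbit (Suc j) e \<in> h t - h x)"

text \<open>The two lines must be \<open>j - d\<close> for the row and \<open>Suc j\<close> for the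
  column. The first is the smaller, so the unordered pair of lines already determines
  \<open>j\<close> and \<open>d\<close>.\<close>

lemma active_unique:
  assumes "atoms x y z t" "active x t j d" "active x t j' d'"
  shows "j = j' \<and> d = d'"
proof -
  obtain k\<^sub>1 k\<^sub>2 where k: "\<forall>b\<in>h t - h x. online k\<^sub>1 b \<or> online k\<^sub>2 b" using atoms_online[OF assms(1)] by blast
  have "(k\<^sub>1 = i - e \<and> k\<^sub>2 = Suc i) \<or> (k\<^sub>2 = i - e \<and> k\<^sub>1 = Suc i)" if "active x t i e" for i e
  proof -
    have "k\<^sub>1 = i - e \<or> k\<^sub>2 = i - e" using that k online_rbit unfolding active_def by blast
    moreover have "k\<^sub>1 = Suc i \<or> k\<^sub>2 = Suc i" using that k online_cbit unfolding active_def by blast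
    moreover have "i - e \<noteq> Suc i" by simp
    ultimately show ?thesis by auto
  qed
  from this[OF assms(2)] this[OF assms(3)] assms(2,3) show ?thesis by (auto simp: active_def)
qed

definition interval_at :: "'a \<Rightarrow> 'a \<Rightarrow> nat \<Rightarrow> nat set set" where
  "interval_at x t m = {S \<in> F m. pre m x \<subseteq> S \<and> S \<subseteq> pre m t}"

lemma interval_at_cut: "w \<in> C \<Longrightarrow> h x \<subseteq> h w \<Longrightarrow> h w \<subseteq> h t \<Longrightarrow> m \<le> r * r \<Longrightarrow> pre m w \<in> interval_at x t m"
  unfolding interval_at_def using tower_cut[OF h_tower] by blast

lemma interval_at_Suc:
  assumes "S \<in> interval_at x t (Suc m)"
  shows "cut m S \<in> interval_at x t m" "m \<in> S \<Longrightarrow> can_set m (cut m S)" "m \<notin> S \<Longrightarrow> can_clear m (cut m S)"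
    "m \<in> h x \<Longrightarrow> m \<in> S" "m \<in> S \<Longrightarrow> m \<in> h t"
    "m \<in> S \<Longrightarrow> S = insert m (cut m S)" "m \<notin> S \<Longrightarrow> S = cut m S"
proof -
  have S: "S \<in> F (Suc m)" "pre (Suc m) x \<subseteq> S" "S \<subseteq> pre (Suc m) t"
    using assms by (auto simp: interval_at_def)
  have "cut m S \<in> F m" using tower_cut[OF S(1)] by simp
  then show "cut m S \<in> interval_at x t m" using S by (auto simp: interval_at_def)
  show "m \<in> S \<Longrightarrow> can_set m (cut m S)" "m \<notin> S \<Longrightarrow> can_clear m (cut m S)"
    using tower_UD[OF S(1), of m] U_cong[of S m "cut m S"] D_cong[of S m "cut m S"] by auto
  show "m \<in> h x \<Longrightarrow> m \<in> S" "m \<in> S \<Longrightarrow> m \<in> h t" using S by auto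
  have sub: "b < m \<or> b = m" if "b \<in> S" for b using tower_subset[OF S(1)] that by auto
  show "m \<in> S \<Longrightarrow> S = insert m (cut m S)" "m \<notin> S \<Longrightarrow> S = cut m S"
    using sub by (intro equalityI subsetI; fastforce)+
qed

lemma interval_at_lift:
  assumes "x \<in> C" "t \<in> C" "h x \<subseteq> h t" "Suc m \<le> r * r" "S \<in> interval_at x t m"
  shows "\<exists>S'\<in>interval_at x t (Suc m). cut m S' = S"
proof -
  have "pre (Suc m) x \<in> F (Suc m)" "pre (Suc m) t \<in> F (Suc m)"
    using tower_cut[OF h_tower[OF assms(1)] assms(4)] tower_cut[OF h_tower[OF assms(2)] assms(4)] by simp_all
  moreover have "cut m (cut (Suc m) S) = cut m S" for S by auto
  ultimately show ?thesis
    using extend_between[of "pre (Suc m) x" "Suc m" "pre (Suc m) t" m S] assms(3,5)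
    unfolding interval_at_def by auto
qed

text \<open>The negation says that bit \<open>m\<close> is constant on the interval or determined by
  the prefix everywhere; then the next level of the interval is an isomorphic copy.\<close>

definition grow :: "'a \<Rightarrow> 'a \<Rightarrow> nat \<Rightarrow> bool" where
  "grow x t m \<longleftrightarrow> m \<notin> h x \<and> m \<in> h t \<and> (\<exists>S\<in>interval_at x t m. can_set m S \<and> can_clear m S)"

lemma no_grow_mono:
  assumes "\<not> grow x t m" "S \<in> interval_at x t (Suc m)" "T \<in> interval_at x t (Suc m)" "cut m S \<subseteq> cut m T"
  shows "S \<subseteq> T"
proof -
  note s = interval_at_Suc[OF assms(2)] and t = interval_at_Suc[OF assms(3)]
  have "m \<in> T" if m: "m \<in> S"
  proof (rule ccontr)
    assume n: "m \<notin> T"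
    have "can_set m (cut m T)" using U_sub[OF assms(4) s(2)[OF m]] .
    then have "grow x t m" using t(1,3,4) s(5) m n unfolding grow_def by blast
    then show False using assms(1) by simp
  qed
  show ?thesis
  proof
    fix b assume b: "b \<in> S"
    then have "b \<le> m" using assms(2) by (auto simp: interval_at_def)
    then show "b \<in> T" using b \<open>m \<in> S \<Longrightarrow> m \<in> T\<close> assms(4) by (cases "b = m") auto
  qed
qed

lemma split_cut: "can_set m (pre m w) \<and> can_clear m (pre m w) \<longleftrightarrow> split_at m w"
  using U_cong[of "h w" m "pre m w"] D_cong[of "h w" m "pre m w"] by (simp add: split_at_def)

text \<open>Visible atoms cannot switch on a bit that is free at \<open>x\<close>. They would leave
  it clear, be free there themselves, and so make their join free and clear, although growth needs
  the bit in \<open>t\<close>. If \<open>t\<close> were free, an atom with the bit would be free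
  too, which \<open>cover_bit\<close> excludes; so both atoms lack it, and again it is clear in
  \<open>t\<close>.\<close>

lemma grow_ends:
  assumes p: "atoms x y z t" and m: "m < r * r" and g: "grow x t m"
    and ne: "pre m x \<noteq> pre m y" "pre m x \<noteq> pre m z"
  shows "\<not> split_at m x" "\<not> split_at m t"
proof -
  note q = atomsD[OF p]
  have mx: "m \<notin> h x" and mT: "m \<in> h t" using g by (auto simp: grow_def)
  note cy = cover_bit[OF q(12) m ne(1) _ mx] and cz = cover_bit[OF q(13) m ne(2) _ mx]
  show "\<not> split_at m x"
  proof
    assume s: "split_at m x"
    then have n: "m \<notin> h y" "m \<notin> h z" using cy cz by auto
    have "can_set m (h y)" "can_set m (h z)" using s U_sub[of "h x" "h y" m] U_sub[of "h x" "h z" m] q(5,6)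
      unfolding split_at_def by auto
    then have "split_at m y" "split_at m z" using h_UD(2)[OF q(2) m] h_UD(2)[OF q(3) m] n
      by (auto simp: split_at_def)
    then have "can_clear m (h t)" using split_at_join[OF q(2,3) m] q(14) by (simp add: split_at_def)
    then show False using bit_join[OF q(2,3) m] n mT q(14) by simp
  qed
  show "\<not> split_at m t"
  proof
    assume s: "split_at m t"
    then have D: "can_clear m (h y)" "can_clear m (h z)" "can_clear m (h t)" using D_sub[of "h y" "h t" m] D_sub[of "h z" "h t" m] q(7,8)
      unfolding split_at_def by auto
    have "m \<notin> h y" using cy(2) D(1) h_UD(1)[OF q(2)] by (auto simp: split_at_def)
    moreover have "m \<notin> h z" using cz(2) D(2) h_UD(1)[OF q(3)] by (auto simp: split_at_def)
    ultimately show False using bit_join[OF q(2,3) m] mT q(14) D(3) by simp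
  qed
qed

text \<open>Freedom at \<open>m\<close> needs a \<open>c\<close>-bit set and an \<open>a\<close>-bit
  clear. Some prefix \<open>S\<close> meets both demands, \<open>x\<close> fails only the first and
  \<open>t\<close> only the second, so both of these bits change between \<open>x\<close> and
  \<open>t\<close>.\<close>

lemma grow_active:
  assumes p: "atoms x y z t" and m: "m < r * r" and g: "grow x t m"
    and ne: "pre m x \<noteq> pre m y" "pre m x \<noteq> pre m z"
  obtains (col) j d where "active x t j d" "m = cbit (Suc j) (Suc d)" "cbit (Suc j) d \<notin> h x"
  | (row) j d where "active x t j d" "m = rbit (Suc j) (Suc d)" "cbit (Suc j) (Suc d) \<notin> h x"
proof -
  note q = atomsD[OF p]
  note e = grow_ends[OF assms]
  have mx: "m \<notin> h x" and mT: "m \<in> h t" using g by (auto simp: grow_def)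
  obtain S where S: "S \<in> interval_at x t m" "can_set m S" "can_clear m S" using g by (auto simp: grow_def)
  have St: "S \<subseteq> h t" "pre m x \<subseteq> S" using S(1) by (auto simp: interval_at_def)
  have Ut: "can_set m (h t)" and Dx: "can_clear m (h x)" using h_UD(1)[OF q(4) mT] h_UD(2)[OF q(1) m mx] by auto
  show thesis
  proof (cases m rule: bit_cases)
    case (diag j)
    then show thesis using e(1) can_simps_diag by (simp add: split_at_def)
  next
    case col: (col j d)
    have y: "cbit (Suc j) d \<in> S" and x: "rbit j d \<notin> S" using S can_simps_col[OF col(1)] col(2) by auto
    have "rbit j d \<notin> h x" using x St ix_less[OF col(1)] col(2) by auto
    moreover have "cbit (Suc j) d \<notin> h x" using e(1) Dx can_simps_col[OF col(1)] col(2) by (auto simp: split_at_def)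
    moreover have "rbit j d \<in> h t" using e(2) Ut can_simps_col[OF col(1)] col(2) by (auto simp: split_at_def)
    moreover have "cbit (Suc j) d \<in> h t" using y St by auto
    ultimately show thesis using that(1)[of j d] col unfolding active_def by (meson DiffI le_SucI)
  next
    case row: (row j d)
    have x: "rbit j d \<notin> S" and y: "cbit (Suc j) (Suc d) \<in> S" using S can_simps_row[OF row(1)] row(2) by auto
    have "rbit j d \<notin> h x" using x St ix_less[OF row(1)] row(2) by auto
    moreover have "cbit (Suc j) (Suc d) \<notin> h x"
      using e(1) Dx can_simps_row[OF row(1)] row(2) by (auto simp: split_at_def)
    moreover have "rbit j d \<in> h t" using e(2) Ut can_simps_row[OF row(1)] row(2) by (auto simp: split_at_def)
    moreover have "cbit (Suc j) (Suc d) \<in> h t" using y St by auto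
    ultimately show thesis using that(2)[of j d] row unfolding active_def by (meson DiffI Suc_le_mono)
  qed
qed


definition quad_at :: "'a \<Rightarrow> 'a \<Rightarrow> 'a \<Rightarrow> 'a \<Rightarrow> nat \<Rightarrow> bool" where
  "quad_at x y z t m \<longleftrightarrow> pre m x \<noteq> pre m y \<and> pre m x \<noteq> pre m z \<and>
     interval_at x t m = {pre m x, pre m y, pre m z, pre m t}"

text \<open>The long side passes through \<open>z\<close>. The last clause records that the bits of
  the active cell are already revealed; as there is only one active cell, no later bit can enlarge
  the interval.\<close>

definition hexagon_at :: "'a \<Rightarrow> 'a \<Rightarrow> 'a \<Rightarrow> 'a \<Rightarrow> nat \<Rightarrow> bool" where
  "hexagon_at x y z t m \<longleftrightarrow> pre m x \<noteq> pre m y \<and> pre m x \<noteq> pre m z \<and>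
     (\<exists>w v. interval_at x t m = {pre m x, pre m y, pre m z, w, v, pre m t} \<and>
       pre m z \<subset> w \<and> w \<subset> v \<and> \<not> pre m y \<subseteq> v) \<and>
     (\<exists>j d. active x t j d \<and> rbit (Suc j) (Suc d) < m)"

lemma cut_ne_Suc: "cut m S \<noteq> cut m T \<Longrightarrow> cut (Suc m) S \<noteq> cut (Suc m) T"
  using cut_Suc_eq by blast

lemma cut_cut_Suc: "cut m (cut (Suc m) S) = cut m S"
  by auto

lemma no_grow_eq:
  assumes "\<not> grow x t m" "S \<in> interval_at x t (Suc m)" "T \<in> interval_at x t (Suc m)" "cut m S = cut m T"
  shows "S = T"
  using no_grow_mono[OF assms(1-3)] no_grow_mono[OF assms(1,3,2)] assms(4) by auto

lemma atoms_interval_at: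
  assumes "atoms x y z t" "m \<le> r * r"
  shows "pre m x \<in> interval_at x t m" "pre m y \<in> interval_at x t m" "pre m z \<in> interval_at x t m"
    "pre m t \<in> interval_at x t m"
  using atomsD[OF assms(1)] by (auto intro!: interval_at_cut assms(2))

text \<open>While \<open>z\<close> is invisible, the prefix of \<open>t\<close> is that of
  \<open>y\<close>, and the interval has no elements besides the prefixes of \<open>x\<close> and
  \<open>y\<close>. A bit that then makes \<open>z\<close> visible is free at \<open>x\<close> and
  crosses this edge with a two-element chain.\<close>

lemma step_degenerate:
  assumes p: "atoms x y z t" and m: "m < r * r" and e: "pre m x = pre m z"
  shows "pre (Suc m) x = pre (Suc m) y \<or> pre (Suc m) x = pre (Suc m) z \<or>
    quad_at x y z t (Suc m)"
proof (rule ccontr)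
  note q = atomsD[OF p]
  assume n: "\<not> ?thesis"
  then have ne: "pre (Suc m) x \<noteq> pre (Suc m) y" "pre (Suc m) x \<noteq> pre (Suc m) z"
    and nq: "\<not> quad_at x y z t (Suc m)" by auto
  have "(m \<in> h x) \<noteq> (m \<in> h z)" using ne(2) e cut_Suc_eq[of "h x" m "h z"] by simp
  then have mz: "m \<in> h z" and mx: "m \<notin> h x" using q(6) by auto
  have mT: "m \<in> h t" using mz q(8) by auto
  have "can_set m (h x)" using h_UD(1)[OF q(3) mz] U_cong[OF e] by simp
  then have sx: "split_at m x" using h_UD(2)[OF q(1) m mx] by (simp add: split_at_def)
  \<comment> \<open>The two atoms cannot share the bit: with equal prefixes it would survive in
    their meet, which is \<open>x\<close>, and with separated prefixes \<open>cover_bit\<close>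
    forbids it because \<open>x\<close> is free at \<open>m\<close>.\<close>
  have my: "m \<notin> h y"
  proof
    assume my: "m \<in> h y"
    show False
    proof (cases "pre m x = pre m y")
      case True
      have "pre (Suc m) z \<in> F (Suc m)" using tower_cut[OF h_tower[OF q(3)], of "Suc m"] m by simp
      moreover have "pre (Suc m) z = pre (Suc m) y" using True e my mz cut_Suc_eq by metis
      ultimately have "pre (Suc m) z \<subseteq> h (y \<sqinter> z)"
        using cut_meet_greatest[OF q(2,3), of "Suc m" "pre (Suc m) z"] m by auto
      then show False using q(11) mz mx by auto
    next
      case False
      then show False using cover_bit(1)[OF q(12) m False my mx] sx by simp
    qed
  qed
  have "pre m t \<subseteq> pre m y"
    using cut_join_least[OF q(2,3), of m "pre m y"] tower_cut[OF h_tower[OF q(2)], of m] m e q(5,14)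
    by auto
  then have ty: "pre m t = pre m y" using q(7) by auto
  have XYZT: "pre (Suc m) x = pre m x" "pre (Suc m) y = pre m y"
    "pre (Suc m) z = insert m (pre m x)" "pre (Suc m) t = insert m (pre m y)"
    using mx my mz mT by (simp_all add: cut_Suc e ty)
  have "S \<in> {pre (Suc m) x, pre (Suc m) y, pre (Suc m) z, pre (Suc m) t}"
    if S: "S \<in> interval_at x t (Suc m)" for S
  proof -
    note s = interval_at_Suc[OF S]
    have "cut m S = pre m x \<or> cut m S = pre m y"
      using s(1) ty m by (intro cover_or_equal[OF q(12)]) (auto simp: interval_at_def)
    then have "S = pre m x \<or> S = pre m y \<or> S = insert m (pre m x) \<or>
      S = insert m (pre m y)" using s(6,7) by metis
    then show ?thesis unfolding XYZT by blast
  qed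
  moreover have "{pre (Suc m) x, pre (Suc m) y, pre (Suc m) z, pre (Suc m) t} \<subseteq> interval_at x t (Suc m)"
    using atoms_interval_at[OF p Suc_leI[OF m]] by (simp only: insert_subset empty_subsetI)
  ultimately have "interval_at x t (Suc m) = {pre (Suc m) x, pre (Suc m) y, pre (Suc m) z, pre (Suc m) t}"
    by (intro equalityI subsetI) (simp_all only: subsetD)
  then have "quad_at x y z t (Suc m)" unfolding quad_at_def by (intro conjI ne)
  then show False using nq by simp
qed

lemma step_quad_at:
  assumes p: "atoms x y z t" and m: "m < r * r" and Q: "quad_at x y z t m" and g: "\<not> grow x t m"
  shows "quad_at x y z t (Suc m)"
proof -
  note i = atoms_interval_at[OF p Suc_leI[OF m]]
  note Q' = Q[unfolded quad_at_def]
  have I: "interval_at x t m = {pre m x, pre m y, pre m z, pre m t}"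
    using Q' by (elim conjE)
  have "S \<in> {pre (Suc m) x, pre (Suc m) y, pre (Suc m) z, pre (Suc m) t}"
    if S: "S \<in> interval_at x t (Suc m)" for S
  proof -
    have "cut m S \<in> {pre m x, pre m y, pre m z, pre m t}"
      using interval_at_Suc(1)[OF S] unfolding I .
    then show ?thesis
      unfolding insert_iff empty_iff
      using no_grow_eq[OF g S i(1)] no_grow_eq[OF g S i(2)] no_grow_eq[OF g S i(3)]
        no_grow_eq[OF g S i(4)] cut_cut_Suc by metis
  qed
  moreover have "{pre (Suc m) x, pre (Suc m) y, pre (Suc m) z, pre (Suc m) t} \<subseteq> interval_at x t (Suc m)"
    using i by (simp only: insert_subset empty_subsetI)
  ultimately have "interval_at x t (Suc m) = {pre (Suc m) x, pre (Suc m) y, pre (Suc m) z, pre (Suc m) t}"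
    by (intro equalityI subsetI) (simp_all only: subsetD)
  then show ?thesis
    unfolding quad_at_def by (intro conjI cut_ne_Suc[OF Q'[THEN conjunct1]]
        cut_ne_Suc[OF Q'[THEN conjunct2, THEN conjunct1]])
qed

lemma hexagon_atD:
  assumes "hexagon_at x y z t m"
  shows "pre m x \<noteq> pre m y" "pre m x \<noteq> pre m z"
    "\<exists>w v. interval_at x t m = {pre m x, pre m y, pre m z, w, v, pre m t} \<and>
       pre m z \<subset> w \<and> w \<subset> v \<and> \<not> pre m y \<subseteq> v"
    "\<exists>j d. active x t j d \<and> rbit (Suc j) (Suc d) < m"
proof -
  note H = assms[unfolded hexagon_at_def]
  show "pre m x \<noteq> pre m y" using H by (rule conjunct1)
  note H = H[THEN conjunct2]
  show "pre m x \<noteq> pre m z" using H by (rule conjunct1)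
  note H = H[THEN conjunct2]
  show "\<exists>w v. interval_at x t m = {pre m x, pre m y, pre m z, w, v, pre m t} \<and>
       pre m z \<subset> w \<and> w \<subset> v \<and> \<not> pre m y \<subseteq> v" using H by (rule conjunct1)
  show "\<exists>j d. active x t j d \<and> rbit (Suc j) (Suc d) < m" using H by (rule conjunct2)
qed

lemma hexagon_at_no_grow:
  assumes p: "atoms x y z t" and m: "m < r * r" and H: "hexagon_at x y z t m"
  shows "\<not> grow x t m"
proof
  assume g: "grow x t m"
  note ne = hexagon_atD(1,2)[OF H]
  obtain j d where jd: "active x t j d" "rbit (Suc j) (Suc d) < m" using hexagon_atD(4)[OF H] by (elim exE conjE)
  have d: "cbit (Suc j) (Suc d) < rbit (Suc j) (Suc d)"
    using ix_less(3)[of d j] jd(1) by (simp add: active_def)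
  show False
    using p m g ne
  proof (cases rule: grow_active)
    case (col j' d')
    then show False using active_unique[OF p jd(1) col(1)] jd(2) d by simp
  next
    case (row j' d')
    then show False using active_unique[OF p jd(1) row(1)] jd(2) d by simp
  qed
qed

lemma step_hexagon_at:
  assumes p: "atoms x y z t" and m: "m < r * r" and H: "hexagon_at x y z t m"
  shows "hexagon_at x y z t (Suc m)"
proof -
  note q = atomsD[OF p]
  note i = atoms_interval_at[OF p Suc_leI[OF m]]
  have g: "\<not> grow x t m" using hexagon_at_no_grow[OF assms] .
  note ne = hexagon_atD(1,2)[OF H] and ac = hexagon_atD(4)[OF H]
  from hexagon_atD(3)[OF H] obtain w v where wv: "interval_at x t m = {pre m x, pre m y, pre m z, w, v, pre m t}"
    "pre m z \<subset> w" "w \<subset> v" "\<not> pre m y \<subseteq> v" by (elim exE conjE)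
  have xt: "h x \<subseteq> h t" using q(5,7) by blast
  have wi: "w \<in> interval_at x t m" "v \<in> interval_at x t m" unfolding wv(1) by simp_all
  obtain w' where w': "w' \<in> interval_at x t (Suc m)" "cut m w' = w"
    using interval_at_lift[OF q(1,4) xt Suc_leI[OF m] wi(1)] by blast
  obtain v' where v': "v' \<in> interval_at x t (Suc m)" "cut m v' = v"
    using interval_at_lift[OF q(1,4) xt Suc_leI[OF m] wi(2)] by blast
  have "S \<in> {pre (Suc m) x, pre (Suc m) y, pre (Suc m) z, w', v', pre (Suc m) t}"
    if S: "S \<in> interval_at x t (Suc m)" for S
  proof -
    have "cut m S \<in> {pre m x, pre m y, pre m z, w, v, pre m t}"
      using interval_at_Suc(1)[OF S] unfolding wv(1) .
    then show ?thesis
      unfolding insert_iff empty_iff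
      using no_grow_eq[OF g S i(1)] no_grow_eq[OF g S i(2)] no_grow_eq[OF g S i(3)]
        no_grow_eq[OF g S i(4)] no_grow_eq[OF g S w'(1)] no_grow_eq[OF g S v'(1)] w'(2) v'(2)
        cut_cut_Suc by metis
  qed
  moreover have "{pre (Suc m) x, pre (Suc m) y, pre (Suc m) z, w', v', pre (Suc m) t}
    \<subseteq> interval_at x t (Suc m)" using i w'(1) v'(1) by (simp only: insert_subset empty_subsetI)
  ultimately have I: "interval_at x t (Suc m) =
    {pre (Suc m) x, pre (Suc m) y, pre (Suc m) z, w', v', pre (Suc m) t}"
    by (intro equalityI subsetI) (simp_all only: subsetD)
  have "pre (Suc m) z \<subset> w'"
  proof
    show "pre (Suc m) z \<subseteq> w'"
      by (rule no_grow_mono[OF g i(3) w'(1)]) (simp only: cut_cut_Suc w'(2) psubset_imp_subset[OF wv(2)])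
    show "pre (Suc m) z \<noteq> w'" using wv(2) w'(2) cut_cut_Suc[of "h z" m] by (metis psubsetE subset_refl)
  qed
  moreover have "w' \<subset> v'"
  proof
    show "w' \<subseteq> v'"
      by (rule no_grow_mono[OF g w'(1) v'(1)]) (simp only: w'(2) v'(2) psubset_imp_subset[OF wv(3)])
    show "w' \<noteq> v'" using wv(3) w'(2) v'(2) by (metis psubsetE subset_refl)
  qed
  moreover have "\<not> pre (Suc m) y \<subseteq> v'"
  proof
    assume "pre (Suc m) y \<subseteq> v'"
    then have "pre m y \<subseteq> cut m v'" by auto
    then show False using wv(4) v'(2) by simp
  qed
  moreover have "\<exists>j d. active x t j d \<and> rbit (Suc j) (Suc d) < Suc m" using ac less_SucI by blast
  ultimately show ?thesis
    unfolding hexagon_at_def by (intro conjI cut_ne_Suc[OF ne(1)] cut_ne_Suc[OF ne(2)] exI[of _ w'] exI[of _ v'] I)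
qed

text \<open>At the active cell the vertices \<open>x\<close>, \<open>y\<close>, \<open>z\<close>,
  \<open>t\<close> show all four values \<open>(0, 0)\<close>, \<open>(1, 0)\<close>,
  \<open>(0, 1)\<close>, \<open>(1, 1)\<close> of \<open>(rbit j d, cbit (Suc j) d)\<close>. Only
  \<open>z\<close> leaves the cell open, and its prefix is replaced by \<open>Z\<close>,
  \<open>W\<close>, \<open>V\<close>, with \<open>(0, 0)\<close>, \<open>(0, 1)\<close>,
  \<open>(1, 1)\<close> as the values of \<open>(a, c)\<close> there.\<close>

lemma quad_at_grow_right:
  assumes p: "atoms x y z t" and m: "m < r * r" and Q: "quad_at x y z t m" and g: "grow x t m"
    and sz: "split_at m z"
  shows "\<exists>j d. d \<le> j \<and> Suc m = rbit (Suc j) (Suc d) \<and> hexagon_at x y z t (Suc (Suc m))"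
proof -
  note q = atomsD[OF p]
  have ne: "pre m x \<noteq> pre m y" "pre m x \<noteq> pre m z"
    and I: "interval_at x t m = {pre m x, pre m y, pre m z, pre m t}"
    using Q by (auto simp: quad_at_def)
  have mx: "m \<notin> h x" and mT: "m \<in> h t" using g by (auto simp: grow_def)
  note Tx = towerD[OF h_tower[OF q(1)]] and Ty = towerD[OF h_tower[OF q(2)]]
    and Tz = towerD[OF h_tower[OF q(3)]]
  show ?thesis
    using p m g ne
  proof (cases rule: grow_active)
    \<comment> \<open>Growth cannot start at the \<open>a\<close>-bit: \<open>z\<close> would have
      switched on the \<open>c\<close>-bit just before it, after separating from \<open>x\<close>
      and while that bit was free at \<open>z\<close>.\<close>
    case (row j d)
    have d: "d \<le> j" and at: "rbit j d \<in> h t" using row(1) by (auto simp: active_def)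
    let ?c = "cbit (Suc j) (Suc d)"
    have j: "Suc j < r" using m row(2) ix_less_square(1)[of "Suc d" "Suc j" r] d by simp
    have c: "?c < r * r" using ix_less_square(2)[of "Suc d" "Suc j" r] d j by simp
    have az: "rbit j d \<notin> h z" and cz: "?c \<in> h z"
      using sz can_simps_row[OF d] row(2) by (auto simp: split_at_def)
    have ay: "rbit j d \<in> h y" using rbit_join[OF q(2,3) d] at az j q(14) by simp
    have "?c \<notin> h y" using cbit_meet[OF q(2,3), of "Suc d" "Suc j"] d j cz row(3) q(11) by simp
    then have "cbit (Suc j) d \<notin> h y" using Ty(2)[OF d c ay] by blast
    then have yx: "cbit (Suc j) d \<notin> h x" using q(5) by blast
    have yz: "cbit (Suc j) d \<in> h z" using Tz(1)[OF d cz] .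
    have "pre ?c x \<noteq> pre ?c z" using yx yz ix_less(1)[OF d] by blast
    then have "\<not> split_at ?c z" using cover_bit(2)[OF q(13) c _ cz row(3)] by blast
    then show ?thesis using can_simps_col[OF d] az yz by (simp add: split_at_def)
  next
    case (col j d)
    have d: "d \<le> j" and at: "rbit j d \<in> h t" and ax: "rbit j d \<notin> h x"
      using col(1) by (auto simp: active_def)
    let ?y = "cbit (Suc j) d" and ?a = "rbit (Suc j) (Suc d)"
    have j: "Suc j < r" using m col(2) ix_less_square(2)[of "Suc d" "Suc j" r] d by simp
    have a: "?a < r * r" using ix_less_square(1)[of "Suc d" "Suc j" r] d j by simp
    have am: "?a = Suc m" using ix_less(6)[OF d] col(2) by simp
    have lt: "rbit j d < m" "?y < m" using ix_less[OF d] col(2) by simp_all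
    have yz: "?y \<in> h z" and az: "rbit j d \<notin> h z" using sz can_simps_col[OF d] col(2) by (auto simp: split_at_def)
    have ay: "rbit j d \<in> h y" using rbit_join[OF q(2,3) d] at az j q(14) by simp
    have yy: "?y \<notin> h y" using cbit_meet[OF q(2,3), of d "Suc j"] d j yz col(3) q(11) by simp
    have yt: "?y \<in> h t" using yz q(8) by blast
    have mz: "m \<notin> h z" using cover_bit(2)[OF q(13) m ne(2) _ mx] sz by blast
    have my: "m \<notin> h y" using Ty(1)[OF d] yy col(2) by blast
    have my': "Suc m \<in> h y" using Ty(4)[OF d a ay] am by simp
    have mT': "Suc m \<in> h t" using my' q(7) by blast
    have mz': "Suc m \<notin> h z" using Tz(3)[OF d] az mz col(2) am by auto
    have mx': "Suc m \<notin> h x" using mz' q(6) by blast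
    define Z where "Z = pre m z"
    define W where "W = insert m Z"
    define V where "V = insert (Suc m) W"
    have two: "cut (Suc (Suc m)) A = cut m A \<union> (if m \<in> A then {m} else {}) \<union> (if Suc m \<in> A then {Suc m} else {})"
      for A by (simp add: cut_Suc)
    have X2: "pre (Suc (Suc m)) x = pre m x" and Z2: "pre (Suc (Suc m)) z = Z"
      and Y2: "pre (Suc (Suc m)) y = pre m y \<union> {Suc m}"
      and T2: "pre (Suc (Suc m)) t = pre m t \<union> {m} \<union> {Suc m}"
      unfolding two Z_def using mx mx' mz mz' my my' mT mT' by simp_all
    have ZF: "Z \<in> F m" using tower_cut[OF h_tower[OF q(3)], of m] m by (simp add: Z_def)
    have "can_set m Z" using sz split_cut[of m z] by (simp add: Z_def)
    then have WF: "W \<in> F (Suc m)" using tower_insert[OF ZF] by (simp add: W_def)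
    have aW: "rbit j d \<notin> W" "cbit (Suc j) (Suc d) \<in> W" using az lt col(2) by (auto simp: W_def Z_def)
    have "can_clear (Suc m) W" "can_set (Suc m) W" using can_simps_row[OF d, of W] aW am by simp_all
    then have WF2: "W \<in> F (Suc (Suc m))" and VF: "V \<in> F (Suc (Suc m))"
      using tower_same[OF WF] tower_insert[OF WF] by (simp_all add: V_def)
    have XZ: "pre m x \<subseteq> Z" and ZT: "Z \<subseteq> pre m t" using q(6,8) by (auto simp: Z_def)
    have WV: "W \<in> interval_at x t (Suc (Suc m))" "V \<in> interval_at x t (Suc (Suc m))"
      unfolding interval_at_def X2 T2 using WF2 VF XZ ZT by (auto simp: W_def V_def)
    have mem: "S \<in> {pre (Suc (Suc m)) x, pre (Suc (Suc m)) y, pre (Suc (Suc m)) z, W, V,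
        pre (Suc (Suc m)) t}" if S: "S \<in> interval_at x t (Suc (Suc m))" for S
    proof -
      have SF: "S \<in> F (Suc (Suc m))" using S by (simp add: interval_at_def)
      have S2: "S = cut m S \<union> (if m \<in> S then {m} else {}) \<union> (if Suc m \<in> S then {Suc m} else {})"
        using two[of S] tower_subset[OF SF] by (simp add: Int_absorb2)
      have TS: "m \<in> S \<Longrightarrow> ?y \<in> S" "rbit j d \<in> S \<Longrightarrow> ?y \<in> S \<Longrightarrow> m \<in> S"
        "Suc m \<in> S \<Longrightarrow> rbit j d \<in> S \<or> m \<in> S" "rbit j d \<in> S \<Longrightarrow> Suc m \<in> S"
        using towerD[OF SF d] col(2) am by simp_all
      have cutS: "cut m S \<in> {pre m x, pre m y, Z, pre m t}"
        using interval_at_Suc(1)[OF interval_at_Suc(1)[OF S]] unfolding cut_cut_Suc I Z_def .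
      have bit: "b \<in> S \<longleftrightarrow> b \<in> h w" if "cut m S = pre m w" "b < m" for b w using that by blast
      from cutS consider "cut m S = pre m x" | "cut m S = pre m y" | "cut m S = Z"
        | "cut m S = pre m t" by blast
      then show ?thesis
      proof cases
        case 1
        then have "m \<notin> S" "Suc m \<notin> S" using TS(1,3) bit[OF 1] lt col(3) ax by blast+
        then show ?thesis using S2 X2 1 by simp
      next
        case 2
        then have "m \<notin> S" "Suc m \<in> S" using TS(1,4) bit[OF 2] lt yy ay by blast+
        then show ?thesis using S2 Y2 2 by simp
      next
        case 3
        then have "rbit j d \<notin> S" using bit[of z] lt az by (simp add: Z_def)
        then have "cut m S \<union> (if m \<in> S then {m} else {}) \<union> (if Suc m \<in> S then {Suc m} else {}) \<in> {Z, W, V}"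
          using 3 TS(3) by (cases "m \<in> S"; cases "Suc m \<in> S") (simp_all add: W_def V_def)
        then have "S \<in> {Z, W, V}" using S2 by metis
        then show ?thesis unfolding insert_iff Z2 by argo
      next
        case 4
        then have "m \<in> S" "Suc m \<in> S" using TS(2,4) bit[OF 4] lt yt at by blast+
        then show ?thesis using S2 T2 4 by simp
      qed
    qed
    have "Suc (Suc m) \<le> r * r" using a am by simp
    note i = atoms_interval_at[OF p this]
    have "{pre (Suc (Suc m)) x, pre (Suc (Suc m)) y,
        pre (Suc (Suc m)) z, W, V, pre (Suc (Suc m)) t} \<subseteq> interval_at x t (Suc (Suc m))"
      using i WV by (simp only: insert_subset empty_subsetI)
    with mem have I2: "interval_at x t (Suc (Suc m)) = {pre (Suc (Suc m)) x, pre (Suc (Suc m)) y,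
        pre (Suc (Suc m)) z, W, V, pre (Suc (Suc m)) t}"
      by (intro equalityI subsetI) (simp_all only: subsetD)
    have "m \<notin> Z" "Suc m \<notin> W" by (simp_all add: W_def Z_def)
    then have "pre (Suc (Suc m)) z \<subset> W" "W \<subset> V" unfolding Z2 W_def V_def by blast+
    moreover have "\<not> pre (Suc (Suc m)) y \<subseteq> V"
    proof -
      have "rbit j d \<notin> V" using az lt by (simp add: W_def V_def Z_def)
      then show ?thesis unfolding Y2 using ay lt by auto
    qed
    moreover have "active x t j d \<and> rbit (Suc j) (Suc d) < Suc (Suc m)" using am col(1) by simp
    ultimately have "hexagon_at x y z t (Suc (Suc m))"
      unfolding hexagon_at_def by (intro conjI cut_ne_Suc[OF cut_ne_Suc[OF ne(1)]]
        cut_ne_Suc[OF cut_ne_Suc[OF ne(2)]] exI[of _ W] exI[of _ V] exI[of _ j] exI[of _ d] I2; simp)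
    then show ?thesis using d am by metis
  qed
qed

lemma quad_at_sym: "quad_at x y z t m \<Longrightarrow> quad_at x z y t m"
  unfolding quad_at_def by auto

text \<open>Between the two bits of the active cell the interval is a pentagon. That level is skipped: the
  induction jumps from the square over both bits to the hexagon.\<close>

definition shape :: "'a \<Rightarrow> 'a \<Rightarrow> 'a \<Rightarrow> 'a \<Rightarrow> nat \<Rightarrow> bool" where
  "shape x y z t m \<longleftrightarrow> pre m x = pre m y \<or> pre m x = pre m z \<or>
     quad_at x y z t m \<or> hexagon_at x y z t m \<or> hexagon_at x z y t m"

lemma shape_step:
  assumes p: "atoms x y z t" and m: "m < r * r" and s: "shape x y z t m"
  shows "shape x y z t (Suc m) \<or>
    (\<exists>j d. d \<le> j \<and> Suc m = rbit (Suc j) (Suc d)) \<and> shape x y z t (Suc (Suc m))"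
proof -
  note p' = atoms_sym[OF p]
  from s consider "pre m x = pre m y" | "pre m x = pre m z" | "quad_at x y z t m"
    | "hexagon_at x y z t m" | "hexagon_at x z y t m" unfolding shape_def by blast
  then show ?thesis
  proof cases
    case 1
    then show ?thesis using step_degenerate[OF p' m] quad_at_sym unfolding shape_def by blast
  next
    case 2
    then show ?thesis using step_degenerate[OF p m] unfolding shape_def by blast
  next
    case Q: 3
    show ?thesis
    proof (cases "grow x t m")
      case g: True
      then obtain S where S: "S \<in> interval_at x t m" "can_set m S" "can_clear m S" by (auto simp: grow_def)
      have ne: "pre m x \<noteq> pre m y" "pre m x \<noteq> pre m z" using Q by (auto simp: quad_at_def)
      have "S \<noteq> pre m x" "S \<noteq> pre m t"
        using grow_ends[OF p m g ne] split_cut[of m x] split_cut[of m t] S(2,3) by auto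
      then have "S = pre m y \<or> S = pre m z" using S(1) Q by (auto simp: quad_at_def)
      then have "split_at m y \<or> split_at m z"
        using split_cut[of m y] split_cut[of m z] S(2,3) by auto
      then show ?thesis
        using quad_at_grow_right[OF p m Q g] quad_at_grow_right[OF p' m quad_at_sym[OF Q] g]
        unfolding shape_def by blast
    next
      case False
      then show ?thesis using step_quad_at[OF p m Q] unfolding shape_def by blast
    qed
  next
    case 4
    then show ?thesis using step_hexagon_at[OF p m] unfolding shape_def by blast
  next
    case 5
    then show ?thesis using step_hexagon_at[OF p' m] unfolding shape_def by blast
  qed
qed

lemma shape_square:
  assumes p: "atoms x y z t"
  shows "shape x y z t (r * r)"
proof -
  let ?row = "\<lambda>m. \<exists>j d. d \<le> j \<and> m = rbit (Suc j) (Suc d)"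
  have "shape x y z t m \<or> ?row m \<and> shape x y z t (Suc m)" if "m \<le> r * r" for m
    using that
  proof (induction m)
    case 0
    then show ?case by (simp add: shape_def)
  next
    case (Suc m)
    then show ?case using shape_step[OF p, of m] by auto
  qed
  \<comment> \<open>The full level \<open>r * r\<close> equals \<open>rbit r 0\<close>, the number
    of a diagonal bit, so it is never the skipped one.\<close>
  moreover have "\<not> ?row (r * r)"
  proof
    assume "?row (r * r)"
    then obtain j d where "d \<le> j" "rbit r 0 = rbit (Suc j) (Suc d)" by (auto simp: rbit_def)
    then show False by (simp add: rbit_eq_iff)
  qed
  ultimately show ?thesis by blast
qed

lemma atoms_polygon:
  assumes p: "atoms x y z t"
  shows "quadrilateral L x t \<or> hexagon L x t"
proof -
  note q = atomsD[OF p]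
  have full: "pre (r * r) w = h w" if "w \<in> C" for w using h_subset[OF that] by auto
  have iv: "h w \<in> interval_at x t (r * r) \<longleftrightarrow> w \<in> \<lbrace>x..t\<rbrace>" if "w \<in> C" for w
    unfolding interval_at_def interval_iff[OF q(1,4)] using full q that h_tower[OF that] by simp
  have hex: "hexagon L x t" if p: "atoms x y z t" and H: "hexagon_at x y z t (r * r)" for y z
  proof -
    note q = atomsD[OF p]
    from H obtain W V where I: "interval_at x t (r * r) = {h x, h y, h z, W, V, h t}"
      and lt: "h z \<subset> W" "W \<subset> V" "\<not> h y \<subseteq> V"
      unfolding hexagon_at_def full[OF q(1)] full[OF q(2)] full[OF q(3)] full[OF q(4)] by (elim exE conjE)
    have WV: "W \<in> F (r * r)" "V \<in> F (r * r)" "V \<subseteq> h t" using I full[OF q(4)] unfolding interval_at_def by blast+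
    obtain w v where w: "w \<in> C" "h w = W" and v: "v \<in> C" "h v = V"
      using h_surj[OF WV(1)] h_surj[OF WV(2)] by blast
    have "u \<in> \<lbrace>x..t\<rbrace> \<longleftrightarrow> u \<in> {x, y, z, w, v, t}" for u
    proof (cases "u \<in> C")
      case True
      then show ?thesis using iv[OF True] I w v h_inj[OF True] q(1-4) by auto
    next
      case False
      then show ?thesis using interval_iff[OF q(1,4)] q(1-4) w v by auto
    qed
    then have "\<lbrace>x..t\<rbrace> = {x, y, z, w, v, t}" by blast
    moreover have "h v \<subset> h t" using WV(3) lt(3) q(7) v(2) by auto
    ultimately show ?thesis
      using hexagonI[OF q(1,4,2,3) w(1) v(1)] q(5-10) lt w(2) v(2) by simp
  qed
  have "h x \<noteq> h y" "h x \<noteq> h z" using q(5,6) by auto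
  then consider "quad_at x y z t (r * r)" | "hexagon_at x y z t (r * r)" | "hexagon_at x z y t (r * r)"
    using shape_square[OF p] full q(1-3) unfolding shape_def by auto
  then show ?thesis
  proof cases
    case 1
    then have I: "interval_at x t (r * r) = {h x, h y, h z, h t}"
      unfolding quad_at_def full[OF q(1)] full[OF q(2)] full[OF q(3)] full[OF q(4)] by blast
    have "u \<in> \<lbrace>x..t\<rbrace> \<longleftrightarrow> u \<in> {x, y, z, t}" for u
    proof (cases "u \<in> C")
      case True
      then show ?thesis using iv[OF True] I h_inj[OF True] q(1-4) by auto
    next
      case False
      then show ?thesis using interval_iff[OF q(1,4)] q(1-4) by auto
    qed
    then have "\<lbrace>x..t\<rbrace> = {x, y, z, t}" by blast
    then show ?thesis using quadrilateralI[OF q(1,4,2,3)] q(5-10) by simp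
  next
    case 2
    then show ?thesis using hex[OF p] by blast
  next
    case 3
    then show ?thesis using hex[OF atoms_sym[OF p]] by blast
  qed
qed

lemma polygon_quadrilateral_or_hexagon:
  "polygon L x y \<Longrightarrow> quadrilateral L x y \<or> hexagon L x y"
  using polygon_atoms[of x y] atoms_polygon unfolding atoms_def by metis

lemma covers_polygon:
  assumes "covers L y x" "covers L z x" "y \<noteq> z"
  shows "polygon L x (y \<squnion> z)"
  using atoms_polygon[of x y z "y \<squnion> z"] assms
  unfolding atoms_def quadrilateral_def hexagon_def polygon_def by blast

end

section \<open>Small tableaux\<close>

text \<open>A dot other than the root is a cell with nonempty cells both to its left and above it.
  Excluding dots turns the disjunction in \<open>fb_tableau\<close> into an exclusive one.\<close>

lemma small_iff:
  "small n T \<longleftrightarrow> T \<subseteq> board n \<and> root n \<in> T \<and> border n \<subseteq> T \<and>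
    (\<forall>c\<in>T. c \<noteq> root n \<longrightarrow> (\<exists>d\<in>T. strictly_left d c) \<noteq> (\<exists>d\<in>T. strictly_above d c))"
proof -
  have d: "dot n T c \<longleftrightarrow> c \<in> T \<and> (c = root n \<or> (\<exists>d\<in>T. strictly_left d c) \<and> (\<exists>d\<in>T. strictly_above d c))" for c
    unfolding dot_def left_arrow_def up_arrow_def by argo
  show ?thesis unfolding small_def fb_tableau_def d bex_disj_distrib by blast
qed

text \<open>On small tableaux this is the bit \<open>a(k, j)\<close>, and \<open>occupied\<close> is
  the bit \<open>c(k, j)\<close>.\<close>

definition no_left :: "cell set \<Rightarrow> nat \<Rightarrow> nat \<Rightarrow> bool" where
  "no_left T k j \<longleftrightarrow> (\<forall>l>j. (Suc k, l) \<notin> T)"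

definition occupied :: "cell set \<Rightarrow> nat \<Rightarrow> nat \<Rightarrow> bool" where
  "occupied T k j \<longleftrightarrow> (\<exists>i\<le>k. (i, j) \<in> T)"

definition bits :: "nat \<Rightarrow> cell set \<Rightarrow> nat set" where
  "bits n T = {rbit j d | j d. d \<le> j \<and> j < n - 1 \<and> no_left T (Suc (j - d)) (Suc j)} \<union>
     {cbit j d | j d. d \<le> j \<and> j < n - 1 \<and> occupied T (Suc (j - d)) (Suc j)}"

lemma strictly_left_iff: "(\<exists>d\<in>T. strictly_left d (i, j)) \<longleftrightarrow> (\<exists>l>j. (i, l) \<in> T)"
  by (force simp: strictly_left_def)

lemma strictly_above_iff: "(\<exists>d\<in>T. strictly_above d (i, j)) \<longleftrightarrow> (\<exists>k<i. (k, j) \<in> T)"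
  by (force simp: strictly_above_def)

lemma smallD:
  assumes "small n T"
  shows "T \<subseteq> board n" "(1, n) \<in> T" "1 \<le> k \<Longrightarrow> k < n \<Longrightarrow> (Suc k, k) \<in> T"
    "(i, j) \<in> T \<Longrightarrow> (i, j) \<noteq> (1, n) \<Longrightarrow> (\<exists>l>j. (i, l) \<in> T) \<noteq> (\<exists>k<i. (k, j) \<in> T)"
proof -
  note s = assms[unfolded small_iff]
  show "T \<subseteq> board n" "(1, n) \<in> T" using s by (auto simp: root_def)
  have "(Suc k, k) \<in> border n" if "1 \<le> k" "k < n" using that by (auto simp: border_def)
  then show "1 \<le> k \<Longrightarrow> k < n \<Longrightarrow> (Suc k, k) \<in> T" using s by blast
  show "(i, j) \<in> T \<Longrightarrow> (i, j) \<noteq> (1, n) \<Longrightarrow> (\<exists>l>j. (i, l) \<in> T) \<noteq> (\<exists>k<i. (k, j) \<in> T)"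
    using s strictly_left_iff[of T i j] strictly_above_iff[of T i j] by (auto simp: root_def)
qed

lemma board_iff: "(i, j) \<in> board n \<longleftrightarrow> 1 \<le> i \<and> i \<le> max 1 n \<and> 1 \<le> j \<and> j \<le> n \<and> i \<le> Suc j"
  by (auto simp: board_def)

lemma smallI:
  assumes "T \<subseteq> board n" "(1, n) \<in> T" "\<And>k. 1 \<le> k \<Longrightarrow> k < n \<Longrightarrow> (Suc k, k) \<in> T"
    "\<And>i j. (i, j) \<in> T \<Longrightarrow> (i, j) \<noteq> (1, n) \<Longrightarrow> (\<exists>l>j. (i, l) \<in> T) \<noteq> (\<exists>k<i. (k, j) \<in> T)"
  shows "small n T"
proof -
  have "c \<in> T" if c: "c \<in> border n" for c
  proof -
    obtain i where "c = (i, i - 1)" "2 \<le> i" "i \<le> n" using c by (auto simp: border_def)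
    then show ?thesis using assms(3)[of "i - 1"] by auto
  qed
  moreover have "(\<exists>d\<in>T. strictly_left d c) \<noteq> (\<exists>d\<in>T. strictly_above d c)"
    if "c \<in> T" "c \<noteq> (1, n)" for c
    using assms(4)[of "fst c" "snd c"] that strictly_left_iff[of T "fst c" "snd c"]
      strictly_above_iff[of T "fst c" "snd c"] by simp
  ultimately show ?thesis using assms(1,2) unfolding small_iff root_def by blast
qed

context
  fixes n :: nat and T :: "cell set"
  assumes small: "small n T"
begin

text \<open>The border cell \<open>(Suc j, j)\<close> is nonempty, so it has exactly one of a left
  and an upper neighbour. This makes the two kinds of diagonal bits agree, as their common number in
  \<open>bits\<close> requires.\<close>

lemma no_left_diagonal:
  assumes "1 \<le> j" "j < n"
  shows "no_left T j j \<longleftrightarrow> occupied T j j"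
  using smallD(4)[OF small smallD(3)[OF small assms]] assms
  by (auto simp: no_left_def occupied_def less_Suc_eq_le)

text \<open>If the cell \<open>(Suc k, Suc j)\<close> is nonempty, it has nothing to its left and
  needs a cell above it; if it is empty, the left-arrow of the row lies further right.\<close>

lemma no_left_cell:
  assumes "1 \<le> k" "no_left T k (Suc j)"
  shows "no_left T k j \<or> occupied T k (Suc j)"
proof (rule disjCI)
  assume "\<not> occupied T k (Suc j)"
  then have "\<not> (\<exists>i<Suc k. (i, Suc j) \<in> T)" by (auto simp: occupied_def)
  moreover have "\<not> (\<exists>l>Suc j. (Suc k, l) \<in> T)" using assms(2) by (auto simp: no_left_def)
  ultimately have "(Suc k, Suc j) \<notin> T" using smallD(4)[OF small, of "Suc k" "Suc j"] assms(1) by auto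
  then show "no_left T k j" using assms(2) unfolding no_left_def by (metis Suc_lessI)
qed

lemma occupied_cell:
  assumes "no_left T k j" "occupied T (Suc k) (Suc j)"
  shows "occupied T k (Suc j)"
  using assms unfolding no_left_def occupied_def by (metis le_SucE lessI)

lemma rbit_bits: "d \<le> j \<Longrightarrow> j < n - 1 \<Longrightarrow> rbit j d \<in> bits n T \<longleftrightarrow> no_left T (Suc (j - d)) (Suc j)"
  using no_left_diagonal[of "Suc j"] unfolding bits_def by (auto simp: ix_eq_iff)

lemma cbit_bits: "d \<le> j \<Longrightarrow> j < n - 1 \<Longrightarrow> cbit j d \<in> bits n T \<longleftrightarrow> occupied T (Suc (j - d)) (Suc j)"
  using no_left_diagonal[of "Suc j"] unfolding bits_def by (auto simp: ix_eq_iff)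

lemma bits_tower: "bits n T \<in> tower can_set can_clear ((n - 1) * (n - 1))"
proof (rule tower_squareI)
  show "bits n T \<subseteq> {..<(n - 1) * (n - 1)}" unfolding bits_def using ix_less_square by auto
  fix j d assume d: "d \<le> j" and j: "Suc j < n - 1"
  have m: "rbit j d \<in> bits n T \<longleftrightarrow> no_left T (Suc (j - d)) (Suc j)"
    "rbit (Suc j) (Suc d) \<in> bits n T \<longleftrightarrow> no_left T (Suc (j - d)) (Suc (Suc j))"
    "cbit (Suc j) d \<in> bits n T \<longleftrightarrow> occupied T (Suc (Suc (j - d))) (Suc (Suc j))"
    "cbit (Suc j) (Suc d) \<in> bits n T \<longleftrightarrow> occupied T (Suc (j - d)) (Suc (Suc j))"
    using d j rbit_bits[of d j] rbit_bits[of "Suc d" "Suc j"] cbit_bits[of d "Suc j"] cbit_bits[of "Suc d" "Suc j"]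
    by (simp_all add: Suc_diff_le)
  show "cbit (Suc j) (Suc d) \<in> bits n T \<Longrightarrow> cbit (Suc j) d \<in> bits n T"
    unfolding m by (auto simp: occupied_def intro: le_SucI)
  show "rbit j d \<in> bits n T \<Longrightarrow> cbit (Suc j) d \<in> bits n T \<Longrightarrow> cbit (Suc j) (Suc d) \<in> bits n T"
    unfolding m by (rule occupied_cell)
  show "rbit (Suc j) (Suc d) \<in> bits n T \<Longrightarrow> rbit j d \<in> bits n T \<or> cbit (Suc j) (Suc d) \<in> bits n T"
    unfolding m by (rule no_left_cell) simp
  show "rbit j d \<in> bits n T \<Longrightarrow> rbit (Suc j) (Suc d) \<in> bits n T"
    unfolding m by (auto simp: no_left_def)
qed

lemma Col_iff:
  assumes "(i, j) \<in> board n"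
  shows "(i, j) \<in> Col n T \<longleftrightarrow> j = n \<or> occupied T i j"
proof
  assume "(i, j) \<in> Col n T"
  then obtain d where d: "up_arrow n T d \<or> d = root n" "d = (i, j) \<or> strictly_above d (i, j)"
    unfolding Col_def by blast
  then have "d \<in> T" using smallD(2)[OF small] by (auto simp: up_arrow_def root_def)
  moreover have "fst d \<le> i" "snd d = j" using d(2) by (auto simp: strictly_above_def)
  ultimately show "j = n \<or> occupied T i j" unfolding occupied_def by (metis prod.collapse)
next
  assume a: "j = n \<or> occupied T i j"
  show "(i, j) \<in> Col n T"
  proof (cases "j = n")
    case True
    then show ?thesis using assms unfolding Col_def
      by (intro CollectI conjI exI[of _ "root n"]) (auto simp: root_def strictly_above_def board_iff)
  next
    case False
    then obtain k where k: "k \<le> i" "(k, j) \<in> T" using a by (auto simp: occupied_def)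
    define e where "e = (LEAST e. (e, j) \<in> T)"
    have e: "(e, j) \<in> T" "e \<le> k" unfolding e_def using k(2) by (auto intro: LeastI Least_le)
    have "\<not> (\<exists>d\<in>T. strictly_above d (e, j))"
      unfolding strictly_above_iff e_def using not_less_Least by blast
    then have "up_arrow n T (e, j)" using e False by (auto simp: up_arrow_def root_def)
    moreover have "(e, j) = (i, j) \<or> strictly_above (e, j) (i, j)"
      using e(2) k(1) by (auto simp: strictly_above_def)
    ultimately show ?thesis using assms unfolding Col_def by blast
  qed
qed

lemma Row_iff:
  assumes "(i, j) \<in> board n"
  shows "(i, j) \<in> Row n T \<longleftrightarrow> i = 1 \<or> (\<exists>l\<ge>j. (i, l) \<in> T)"
proof
  assume "(i, j) \<in> Row n T"
  then obtain d where d: "left_arrow n T d \<or> d = root n" "d = (i, j) \<or> strictly_left d (i, j)"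
    unfolding Row_def by blast
  then have "d \<in> T" using smallD(2)[OF small] by (auto simp: left_arrow_def root_def)
  moreover have "fst d = i" "snd d \<ge> j" using d(2) by (auto simp: strictly_left_def)
  ultimately show "i = 1 \<or> (\<exists>l\<ge>j. (i, l) \<in> T)" by (metis prod.collapse)
next
  assume a: "i = 1 \<or> (\<exists>l\<ge>j. (i, l) \<in> T)"
  show "(i, j) \<in> Row n T"
  proof (cases "i = 1")
    case True
    then show ?thesis using assms unfolding Row_def
      by (intro CollectI conjI exI[of _ "root n"]) (auto simp: root_def strictly_left_def board_iff)
  next
    case False
    then obtain l where l: "j \<le> l" "(i, l) \<in> T" using a by auto
    have bd: "\<And>e. (i, e) \<in> T \<Longrightarrow> e \<le> n" using smallD(1)[OF small] board_iff by blast
    define e where "e = (GREATEST e. (i, e) \<in> T)"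
    have e: "(i, e) \<in> T" unfolding e_def using l(2) bd by (rule GreatestI_nat)
    have g: "f \<le> e" if "(i, f) \<in> T" for f unfolding e_def using that bd by (rule Greatest_le_nat)
    have "\<not> (\<exists>d\<in>T. strictly_left d (i, e))"
      unfolding strictly_left_iff using g by (auto simp: not_less)
    then have "left_arrow n T (i, e)" using e False by (auto simp: left_arrow_def root_def)
    moreover have "(i, e) = (i, j) \<or> strictly_left (i, e) (i, j)"
      using g[OF l(2)] l(1) by (auto simp: strictly_left_def)
    ultimately show ?thesis using assms unfolding Row_def by blast
  qed
qed

end

text \<open>The condition on dots is vacuous, as the only dot is the root and the root is not free.
  Column \<open>n\<close> and row \<open>1\<close> belong entirely to \<open>Col\<close> and
  \<open>Row\<close>, which leaves \<open>j < n\<close> and \<open>1 < i\<close>.\<close>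

lemma fb_le_iff_occupied:
  assumes S: "small n S" and T: "small n T"
  shows "fb_le n S T \<longleftrightarrow>
    (\<forall>i j. (i, j) \<in> board n \<and> j < n \<and> occupied S i j \<longrightarrow> occupied T i j) \<and>
    (\<forall>i j. (i, j) \<in> board n \<and> 1 < i \<and> (\<exists>l\<ge>j. (i, l) \<in> T) \<longrightarrow> (\<exists>l\<ge>j. (i, l) \<in> S))"
proof -
  have "\<not> free_cell n S (root n)"
  proof
    assume "free_cell n S (root n)"
    then obtain u where "u \<in> S" "strictly_above u (root n)" by (auto simp: free_cell_def up_arrow_def)
    then show False using smallD(1)[OF S] by (cases u) (auto simp: strictly_above_def root_def board_iff)
  qed
  then have "\<not> (free_cell n S c \<and> free_cell n T c \<and> dot n S c)" for c
    using S unfolding small_def by blast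
  then have "fb_le n S T \<longleftrightarrow> Col n S \<subseteq> Col n T \<and> Row n T \<subseteq> Row n S"
    unfolding fb_le_def by blast
  moreover have "Col n S \<subseteq> Col n T \<longleftrightarrow>
    (\<forall>i j. (i, j) \<in> board n \<and> j < n \<and> occupied S i j \<longrightarrow> occupied T i j)"
  proof
    assume a: "Col n S \<subseteq> Col n T"
    show "\<forall>i j. (i, j) \<in> board n \<and> j < n \<and> occupied S i j \<longrightarrow> occupied T i j"
      using a Col_iff[OF S] Col_iff[OF T] by (metis nat_neq_iff subsetD)
  next
    assume a: "\<forall>i j. (i, j) \<in> board n \<and> j < n \<and> occupied S i j \<longrightarrow> occupied T i j"
    show "Col n S \<subseteq> Col n T"
    proof
      fix c assume c: "c \<in> Col n S"
      obtain i j where ij: "c = (i, j)" by (cases c)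
      then have b: "(i, j) \<in> board n" using c by (simp add: Col_def)
      then have "j \<le> n" by (simp add: board_iff)
      then show "c \<in> Col n T" using c a b Col_iff[OF S b] Col_iff[OF T b] ij by (auto simp: le_less)
    qed
  qed
  moreover have "Row n T \<subseteq> Row n S \<longleftrightarrow>
    (\<forall>i j. (i, j) \<in> board n \<and> 1 < i \<and> (\<exists>l\<ge>j. (i, l) \<in> T) \<longrightarrow> (\<exists>l\<ge>j. (i, l) \<in> S))"
  proof
    assume a: "Row n T \<subseteq> Row n S"
    show "\<forall>i j. (i, j) \<in> board n \<and> 1 < i \<and> (\<exists>l\<ge>j. (i, l) \<in> T) \<longrightarrow> (\<exists>l\<ge>j. (i, l) \<in> S)"
      using a Row_iff[OF S] Row_iff[OF T] by (metis nat_neq_iff subsetD)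
  next
    assume a: "\<forall>i j. (i, j) \<in> board n \<and> 1 < i \<and> (\<exists>l\<ge>j. (i, l) \<in> T) \<longrightarrow> (\<exists>l\<ge>j. (i, l) \<in> S)"
    show "Row n T \<subseteq> Row n S"
    proof
      fix c assume c: "c \<in> Row n T"
      obtain i j where ij: "c = (i, j)" by (cases c)
      then have b: "(i, j) \<in> board n" using c by (simp add: Row_def)
      then have "1 \<le> i" by (simp add: board_iff)
      then show "c \<in> Row n S" using c a b Row_iff[OF S b] Row_iff[OF T b] ij by (auto simp: le_less)
    qed
  qed
  ultimately show ?thesis by blast
qed

lemma fb_le_iff_bits:
  assumes S: "small n S" and T: "small n T"
  shows "fb_le n S T \<longleftrightarrow> bits n S \<subseteq> bits n T"
proof
  assume le: "fb_le n S T"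
  note l = le[unfolded fb_le_iff_occupied[OF S T]]
  show "bits n S \<subseteq> bits n T"
  proof (rule square_subsetI)
    show "bits n S \<subseteq> {..<(n - 1) * (n - 1)}" using growth.tower_subset[OF bits_tower[OF S]] .
    fix j d assume d: "d \<le> j" and j: "j < n - 1"
    have b: "(Suc (Suc (j - d)), Suc (Suc j)) \<in> board n" "(Suc (j - d), Suc j) \<in> board n"
      using d j by (auto simp: board_iff)
    have "no_left T (Suc (j - d)) (Suc j)" if "no_left S (Suc (j - d)) (Suc j)"
    proof (rule ccontr)
      assume "\<not> ?thesis"
      then have "\<exists>l\<ge>Suc (Suc j). (Suc (Suc (j - d)), l) \<in> T" by (auto simp: no_left_def Suc_le_eq)
      then have "\<exists>l\<ge>Suc (Suc j). (Suc (Suc (j - d)), l) \<in> S" using l b(1) by simp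
      then show False using that by (auto simp: no_left_def Suc_le_eq)
    qed
    then show "rbit j d \<in> bits n S \<Longrightarrow> rbit j d \<in> bits n T"
      using rbit_bits[OF S d j] rbit_bits[OF T d j] by simp
    show "cbit j d \<in> bits n S \<Longrightarrow> cbit j d \<in> bits n T"
      using cbit_bits[OF S d j] cbit_bits[OF T d j] l b(2) j by simp
  qed
next
  assume sub: "bits n S \<subseteq> bits n T"
  show "fb_le n S T"
    unfolding fb_le_iff_occupied[OF S T]
  proof (intro conjI allI impI)
    fix i j assume a: "(i, j) \<in> board n \<and> j < n \<and> occupied S i j"
    then have b: "1 \<le> i" "1 \<le> j" "i \<le> Suc j" "j < n" by (auto simp: board_iff)
    show "occupied T i j"
    proof (cases "i = Suc j")
      \<comment> \<open>A cell \<open>(Suc j, j)\<close> has no bit of its own, but it is a border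
        cell and so nonempty in every tableau.\<close>
      case True
      then show ?thesis using smallD(3)[OF T b(2,4)] unfolding occupied_def by blast
    next
      case False
      then have e: "j - i \<le> j - 1" "j - 1 < n - 1" "Suc (j - 1 - (j - i)) = i" "Suc (j - 1) = j"
        using b by auto
      show ?thesis using cbit_bits[OF S e(1,2)] cbit_bits[OF T e(1,2)] sub a unfolding e(3,4) by blast
    qed
  next
    fix i j assume a: "(i, j) \<in> board n \<and> 1 < i \<and> (\<exists>l\<ge>j. (i, l) \<in> T)"
    then have b: "1 < i" "1 \<le> j" "i \<le> Suc j" "i \<le> n" "j \<le> n" by (auto simp: board_iff)
    define k where "k = i - 1"
    have k: "i = Suc k" "1 \<le> k" "k < n" "k \<le> j" using b by (auto simp: k_def)
    show "\<exists>l\<ge>j. (i, l) \<in> S"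
    proof (cases "j = k")
      case True
      then show ?thesis using smallD(3)[OF S k(2,3)] k(1) by blast
    next
      case False
      \<comment> \<open>A label that is at least \<open>j\<close> exceeds \<open>j - 1\<close>, so
        the bit to consult is the one of column \<open>j - 1\<close>, which is numbered
        \<open>j - 2\<close> from 0.\<close>
      then have e: "j - 1 - k \<le> j - 2" "j - 2 < n - 1" "Suc (j - 2 - (j - 1 - k)) = k" "Suc (j - 2) = j - 1"
        using b k by auto
      obtain l where l: "j \<le> l" "(Suc k, l) \<in> T" using a k(1) by auto
      then have "j - 1 < l" using b by simp
      then have "\<not> no_left T k (j - 1)" using l(2) by (auto simp: no_left_def)
      then have "\<not> no_left S k (j - 1)"
        using rbit_bits[OF S e(1,2)] rbit_bits[OF T e(1,2)] sub unfolding e(3,4) by blast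
      then obtain l where l: "j - 1 < l" "(Suc k, l) \<in> S" unfolding no_left_def by blast
      have "j \<le> l" using l(1) by simp
      then show ?thesis using k(1) l(2) by blast
    qed
  qed
qed

text \<open>Every cell but the root is the first one in its row or in its column. Mutual
  comparability gives both tableaux the same first cells, so they have the same cells.\<close>

lemma fb_le_antisym:
  assumes S: "small n S" and T: "small n T" and le: "fb_le n S T" "fb_le n T S"
  shows "S = T"
proof -
  have "A \<subseteq> B" if A: "small n A" and B: "small n B" and AB: "fb_le n A B" and BA: "fb_le n B A" for A B
  proof
    fix c assume c: "c \<in> A"
    obtain i j where ij: "c = (i, j)" by (cases c)
    note lAB = AB[unfolded fb_le_iff_occupied[OF A B]] and lBA = BA[unfolded fb_le_iff_occupied[OF B A]]
    have bA: "\<And>i j. (i, j) \<in> A \<Longrightarrow> (i, j) \<in> board n" and bB: "\<And>i j. (i, j) \<in> B \<Longrightarrow> (i, j) \<in> board n"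
      using smallD(1)[OF A] smallD(1)[OF B] by blast+
    show "c \<in> B"
    proof (cases "c = (1, n)")
      case True
      then show ?thesis using smallD(2)[OF B] by simp
    next
      case False
      have b: "(i, j) \<in> board n" using bA c ij by simp
      then have b': "1 \<le> i" "j \<le> n" by (auto simp: board_iff)
      have x: "(\<exists>l>j. (i, l) \<in> A) \<noteq> (\<exists>k<i. (k, j) \<in> A)" using smallD(4)[OF A] c ij False by simp
      show ?thesis
      proof (cases "\<exists>k<i. (k, j) \<in> A")
        case no: False
        have "j \<noteq> n"
        proof
          assume "j = n"
          then have "1 < i" using False ij b' by auto
          then show False using no smallD(2)[OF A] \<open>j = n\<close> by blast
        qed
        then have j: "j < n" using b' by simp
        have "occupied A i j" using c ij by (auto simp: occupied_def)
        then have "occupied B i j" using lAB b j by blast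
        then obtain k where k: "k \<le> i" "(k, j) \<in> B" by (auto simp: occupied_def)
        have "k = i"
        proof (rule ccontr)
          assume "k \<noteq> i"
          have "occupied B k j" using k(2) by (auto simp: occupied_def)
          then have "occupied A k j" using lBA bB[OF k(2)] j by blast
          then show False using no k(1) \<open>k \<noteq> i\<close> unfolding occupied_def by (metis le_less_trans le_neq_implies_less)
        qed
        then show ?thesis using k(2) ij by simp
      next
        case True
        then have no: "\<not> (\<exists>l>j. (i, l) \<in> A)" using x by blast
        have "i \<noteq> 1"
        proof
          assume "i = 1"
          then have "j < n" using False ij b' by auto
          then show False using no smallD(2)[OF A] \<open>i = 1\<close> by blast
        qed
        then have i: "1 < i" using b' by simp
        have "\<exists>l\<ge>j. (i, l) \<in> A" using c ij by auto
        then obtain l where l: "j \<le> l" "(i, l) \<in> B" using lBA b i by blast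
        have "l = j"
        proof (rule ccontr)
          assume "l \<noteq> j"
          have "\<exists>m\<ge>l. (i, m) \<in> A" using lAB bB[OF l(2)] i l(2) by blast
          then show False using no l(1) \<open>l \<noteq> j\<close> by (metis le_less_trans le_neq_implies_less less_le_trans)
        qed
        then show ?thesis using l(2) ij by simp
      qed
    qed
  qed
  from this[OF S T le] this[OF T S le(2,1)] show ?thesis by blast
qed

section \<open>Reconstructing a tableau from its bits\<close>

text \<open>The bits extended by their values off the board: an arrow lies at column \<open>n\<close> and at row
  \<open>j + 1\<close> at the latest. Row and column indices start at 1 here.\<close>

definition row_reached :: "nat \<Rightarrow> nat set \<Rightarrow> nat \<Rightarrow> nat \<Rightarrow> bool" where
  "row_reached n S k l \<longleftrightarrow> n \<le> l \<or> (k \<le> l \<and> rbit (l - 1) (l - k) \<in> S)"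

definition col_reached :: "nat set \<Rightarrow> nat \<Rightarrow> nat \<Rightarrow> bool" where
  "col_reached S i j \<longleftrightarrow> j < i \<or> (1 \<le> i \<and> cbit (j - 1) (j - i) \<in> S)"

text \<open>Besides the root, each column and each row receives an arrow at the place where its
  monotone condition first becomes true.\<close>

definition tableau_of :: "nat \<Rightarrow> nat set \<Rightarrow> cell set" where
  "tableau_of n S = {(1, n)} \<union>
     {(i, j). 1 \<le> j \<and> j < n \<and> i \<le> Suc j \<and> col_reached S i j \<and> \<not> col_reached S (i - 1) j} \<union>
     {(Suc k, l) | k l. 1 \<le> k \<and> k < n \<and> l \<le> n \<and> row_reached n S k l \<and> \<not> row_reached n S k (l - 1)}"

context
  fixes n :: nat and S :: "nat set"
  assumes n: "1 \<le> n" and S: "S \<in> tower can_set can_clear ((n - 1) * (n - 1))"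
begin

lemma reached_diagonal: "1 \<le> k \<Longrightarrow> k < n \<Longrightarrow> row_reached n S k k \<longleftrightarrow> col_reached S k k"
  by (simp add: row_reached_def col_reached_def rbit_0)

lemma bit_cell:
  assumes "1 \<le> k" "k < j" "j < n"
  shows "col_reached S k j \<Longrightarrow> col_reached S (Suc k) j"
    "row_reached n S k (j - 1) \<Longrightarrow> col_reached S (Suc k) j \<Longrightarrow> col_reached S k j"
    "row_reached n S k j \<Longrightarrow> row_reached n S k (j - 1) \<or> col_reached S k j"
    "row_reached n S k (j - 1) \<Longrightarrow> row_reached n S k j"
proof -
  define i d where "i = j - 2" and "d = j - 1 - k"
  have e: "d \<le> i" "j - 1 = Suc i" "j - k = Suc d" "j - Suc k = d" "j - 1 - 1 = i" "j - 1 - k = d"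
    "k \<le> Suc i"
    using assms by (auto simp: i_def d_def)
  have lt: "cbit (Suc i) (Suc d) < (n - 1) * (n - 1)" "rbit (Suc i) (Suc d) < (n - 1) * (n - 1)"
    using ix_less_square[of "Suc d" "Suc i" "n - 1"] e assms by auto
  have x: "row_reached n S k (j - 1) \<longleftrightarrow> rbit i d \<in> S" and a: "row_reached n S k j \<longleftrightarrow> rbit (Suc i) (Suc d) \<in> S"
    using assms e unfolding row_reached_def e(2,3,5,6) by auto
  have y: "col_reached S (Suc k) j \<longleftrightarrow> cbit (Suc i) d \<in> S" and c: "col_reached S k j \<longleftrightarrow> cbit (Suc i) (Suc d) \<in> S"
    using assms unfolding col_reached_def e(2,3,4) by auto
  show "col_reached S k j \<Longrightarrow> col_reached S (Suc k) j"
    "row_reached n S k (j - 1) \<Longrightarrow> col_reached S (Suc k) j \<Longrightarrow> col_reached S k j"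
    "row_reached n S k j \<Longrightarrow> row_reached n S k (j - 1) \<or> col_reached S k j"
    "row_reached n S k (j - 1) \<Longrightarrow> row_reached n S k j"
    unfolding x a y c using towerD[OF S e(1)] lt by blast+
qed

lemma col_reached_0: "\<not> col_reached S 0 j"
  by (simp add: col_reached_def)

lemma row_reached_less: "1 \<le> k \<Longrightarrow> k < n \<Longrightarrow> l < k \<Longrightarrow> \<not> row_reached n S k l"
  by (simp add: row_reached_def)

lemma col_reached_mono: "col_reached S i j \<Longrightarrow> i \<le> k \<Longrightarrow> 1 \<le> j \<Longrightarrow> j < n \<Longrightarrow> col_reached S k j"
proof (induction k)
  case 0
  then show ?case by simp
next
  case (Suc k)
  show ?case
  proof (cases "i = Suc k")
    case True
    then show ?thesis using Suc by simp
  next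
    case False
    then have c: "col_reached S k j" using Suc by simp
    show ?thesis
    proof (cases "k < j")
      case True
      moreover have "1 \<le> k" using c col_reached_0 by (cases k) auto
      ultimately show ?thesis using bit_cell(1) c Suc by simp
    next
      case False
      then show ?thesis by (simp add: col_reached_def)
    qed
  qed
qed

lemma row_reached_mono: "row_reached n S k l \<Longrightarrow> l \<le> m \<Longrightarrow> 1 \<le> k \<Longrightarrow> k < n \<Longrightarrow> row_reached n S k m"
proof (induction m)
  case 0
  then show ?case by simp
next
  case (Suc m)
  show ?case
  proof (cases "l = Suc m")
    case True
    then show ?thesis using Suc by simp
  next
    case False
    then have a: "row_reached n S k m" using Suc by simp
    show ?thesis
    proof (cases "Suc m < n")
      case True
      moreover have "k \<le> m" using a True by (simp add: row_reached_def)
      ultimately show ?thesis using bit_cell(4)[of k "Suc m"] a Suc by simp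
    next
      case False
      then show ?thesis by (simp add: row_reached_def)
    qed
  qed
qed

text \<open>This and the next lemma supply the exclusive condition on arrows: a left-arrow outside
  column \<open>n\<close> has a cell above it, and an up-arrow below row \<open>1\<close> has the
  left-arrow of its row strictly to its left.\<close>

lemma row_reached_col_reached:
  assumes "1 \<le> k" "k \<le> j" "j < n" "row_reached n S k j" "\<not> row_reached n S k (j - 1)"
  shows "col_reached S k j"
  using assms bit_cell(3)[of k j] reached_diagonal[of k] by (cases "k = j") auto

lemma col_reached_row_reached:
  assumes "1 \<le> k" "k \<le> j" "j < n" "col_reached S (Suc k) j" "\<not> col_reached S k j"
  shows "\<not> row_reached n S k j" "\<not> row_reached n S k (j - 1)"
proof -
  show "\<not> row_reached n S k (j - 1)"
    using assms bit_cell(2)[of k j] row_reached_less[of k "j - 1"] by (cases "k = j") auto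
  then show "\<not> row_reached n S k j"
    using assms bit_cell(3)[of k j] reached_diagonal[of k] by (cases "k = j") auto
qed

lemma tableau_ofE:
  assumes "(i, j) \<in> tableau_of n S"
  obtains (root) "i = 1" "j = n"
  | (up) "1 \<le> i" "i \<le> Suc j" "1 \<le> j" "j < n" "col_reached S i j" "\<not> col_reached S (i - 1) j"
  | (left) k where "i = Suc k" "1 \<le> k" "k < n" "k \<le> j" "j \<le> n" "row_reached n S k j" "\<not> row_reached n S k (j - 1)"
proof -
  from assms consider "i = 1 \<and> j = n"
    | "1 \<le> j \<and> j < n \<and> i \<le> Suc j \<and> col_reached S i j \<and> \<not> col_reached S (i - 1) j"
    | k where "i = Suc k \<and> 1 \<le> k \<and> k < n \<and> j \<le> n \<and> row_reached n S k j \<and> \<not> row_reached n S k (j - 1)"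
    unfolding tableau_of_def by blast
  then show thesis
  proof cases
    case 1
    then show thesis using root by simp
  next
    case 2
    then have "1 \<le> i" using col_reached_0 by (cases i) auto
    then show thesis using up 2 by simp
  next
    case (3 k)
    then have "k \<le> j" using row_reached_less[of k j] by (cases "j < k") auto
    then show thesis using left 3 by simp
  qed
qed

lemma tableau_of_up:
  "1 \<le> j \<Longrightarrow> j < n \<Longrightarrow> i \<le> Suc j \<Longrightarrow> col_reached S i j \<Longrightarrow> \<not> col_reached S (i - 1) j \<Longrightarrow> (i, j) \<in> tableau_of n S"
  by (simp add: tableau_of_def)

lemma tableau_of_left:
  "1 \<le> k \<Longrightarrow> k < n \<Longrightarrow> l \<le> n \<Longrightarrow> row_reached n S k l \<Longrightarrow> \<not> row_reached n S k (l - 1) \<Longrightarrow>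
    (Suc k, l) \<in> tableau_of n S"
  by (simp add: tableau_of_def)

text \<open>Left-arrows do not disturb the columns: where one stands, the column has already been
  reached in a higher row.\<close>

lemma occupied_tableau_of:
  assumes "1 \<le> j" "j < n" "k \<le> Suc j"
  shows "occupied (tableau_of n S) k j \<longleftrightarrow> col_reached S k j"
proof
  assume "occupied (tableau_of n S) k j"
  then obtain i where i: "i \<le> k" "(i, j) \<in> tableau_of n S" by (auto simp: occupied_def)
  from i(2) show "col_reached S k j"
  proof (cases rule: tableau_ofE)
    case root
    then show ?thesis using assms by simp
  next
    case up
    then show ?thesis using col_reached_mono i(1) by blast
  next
    case (left m)
    then have "col_reached S m j" using row_reached_col_reached assms by blast
    then show ?thesis using col_reached_mono[of m j k] left i(1) assms by simp
  qed
next
  assume c: "col_reached S k j"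
  define i where "i = (LEAST i. col_reached S i j)"
  have i: "col_reached S i j" "i \<le> k" unfolding i_def using c by (auto intro: LeastI Least_le)
  have "i \<noteq> 0" using i(1) col_reached_0 by (cases i) auto
  then have "\<not> col_reached S (i - 1) j" unfolding i_def using not_less_Least[of "i - 1" "\<lambda>i. col_reached S i j"] by (simp add: i_def)
  then have "(i, j) \<in> tableau_of n S" using tableau_of_up assms i by simp
  then show "occupied (tableau_of n S) k j" using i(2) by (auto simp: occupied_def)
qed

lemma no_left_tableau_of:
  assumes "1 \<le> k" "k < n"
  shows "no_left (tableau_of n S) k j \<longleftrightarrow> row_reached n S k j"
proof
  assume nl: "no_left (tableau_of n S) k j"
  show "row_reached n S k j"
  proof (rule ccontr)
    assume a: "\<not> row_reached n S k j"
    define l where "l = (LEAST l. row_reached n S k l)"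
    have An: "row_reached n S k n" by (simp add: row_reached_def)
    have l: "row_reached n S k l" "l \<le> n" unfolding l_def using An by (auto intro: LeastI Least_le)
    have "j < l"
    proof (rule ccontr)
      assume "\<not> j < l"
      then show False using row_reached_mono[OF l(1), of j] a assms by simp
    qed
    then have "\<not> row_reached n S k (l - 1)"
      using not_less_Least[of "l - 1" "\<lambda>l. row_reached n S k l"] by (simp add: l_def)
    then have "(Suc k, l) \<in> tableau_of n S" using tableau_of_left assms l by simp
    then show False using nl \<open>j < l\<close> by (simp add: no_left_def)
  qed
next
  assume a: "row_reached n S k j"
  have "(Suc k, l) \<notin> tableau_of n S" if l: "j < l" for l
  proof
    have a': "row_reached n S k (l - 1)" using row_reached_mono[OF a, of "l - 1"] l assms by simp
    assume "(Suc k, l) \<in> tableau_of n S"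
    then show False
    proof (cases rule: tableau_ofE)
      case root
      then show ?thesis using assms by simp
    next
      case up
      then show ?thesis using col_reached_row_reached(2)[of k l] a' assms by simp
    next
      case (left m)
      then show ?thesis using a' by simp
    qed
  qed
  then show "no_left (tableau_of n S) k j" by (simp add: no_left_def)
qed

lemma tableau_of_board: "tableau_of n S \<subseteq> board n"
proof
  fix c assume c: "c \<in> tableau_of n S"
  obtain i j where ij: "c = (i, j)" by (cases c)
  with c have "(i, j) \<in> tableau_of n S" by simp
  then have "(i, j) \<in> board n"
    by (cases rule: tableau_ofE) (use n in \<open>auto simp: board_iff\<close>)
  then show "c \<in> board n" using ij by simp
qed

lemma small_tableau_of: "small n (tableau_of n S)"
proof (rule smallI)
  let ?T = "tableau_of n S"
  show "?T \<subseteq> board n" by (rule tableau_of_board)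
  show T1: "(1, n) \<in> ?T" by (simp add: tableau_of_def)
  show "(Suc k, k) \<in> ?T" if k: "1 \<le> k" "k < n" for k
  proof (cases "row_reached n S k k")
    case True
    then show ?thesis using tableau_of_left[of k k] row_reached_less[of k "k - 1"] k by simp
  next
    case False
    then have "\<not> col_reached S k k" using reached_diagonal k by simp
    then show ?thesis using tableau_of_up[of k "Suc k"] k by (simp add: col_reached_def)
  qed
  fix i j assume ij: "(i, j) \<in> ?T" "(i, j) \<noteq> (1, n)"
  from ij(1) show "(\<exists>l>j. (i, l) \<in> ?T) \<noteq> (\<exists>k<i. (k, j) \<in> ?T)"
  proof (cases rule: tableau_ofE)
    case root
    then show ?thesis using ij by simp
  next
    case up
    have "\<not> occupied ?T (i - 1) j" using occupied_tableau_of up by simp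
    moreover have "k \<le> i - 1" if "k < i" for k using that by simp
    ultimately have "\<not> (\<exists>k<i. (k, j) \<in> ?T)" unfolding occupied_def by blast
    moreover have "\<exists>l>j. (i, l) \<in> ?T"
    proof (cases "i = 1")
      case True
      then show ?thesis using T1 up by auto
    next
      case False
      define k where "k = i - 1"
      have k: "i = Suc k" "1 \<le> k" "k \<le> j" "k < n" using False up by (auto simp: k_def)
      have "\<not> row_reached n S k j" using col_reached_row_reached(1)[of k j] up k by simp
      then show ?thesis using no_left_tableau_of[OF k(2,4)] k(1) by (auto simp: no_left_def)
    qed
    ultimately show ?thesis by blast
  next
    case (left k)
    have "\<not> (\<exists>l>j. (i, l) \<in> ?T)" using no_left_tableau_of[of k j] left by (auto simp: no_left_def)
    moreover have "\<exists>k<i. (k, j) \<in> ?T"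
    proof (cases "j = n")
      case True
      then show ?thesis using T1 left by (intro exI[of _ 1]) auto
    next
      case False
      then have "col_reached S k j" using row_reached_col_reached left by simp
      then have "occupied ?T k j" using occupied_tableau_of[of j k] left False by simp
      then show ?thesis using left(1) by (simp add: occupied_def less_Suc_eq_le)
    qed
    ultimately show ?thesis by blast
  qed
qed

lemma bits_tableau_of: "bits n (tableau_of n S) = S"
proof -
  note s = small_tableau_of
  have a: "rbit j d \<in> bits n (tableau_of n S) \<longleftrightarrow> rbit j d \<in> S"
    and c: "cbit j d \<in> bits n (tableau_of n S) \<longleftrightarrow> cbit j d \<in> S" if "d \<le> j" "j < n - 1" for j d
  proof -
    have e: "Suc j - Suc (j - d) = d" "Suc j - 1 = j" "Suc (j - d) \<le> Suc j" "\<not> n \<le> Suc j"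
      "\<not> Suc j < Suc (j - d)" using that by auto
    show "rbit j d \<in> bits n (tableau_of n S) \<longleftrightarrow> rbit j d \<in> S"
      using rbit_bits[OF s that] no_left_tableau_of[of "Suc (j - d)" "Suc j"] that e
      by (simp add: row_reached_def)
    show "cbit j d \<in> bits n (tableau_of n S) \<longleftrightarrow> cbit j d \<in> S"
      using cbit_bits[OF s that] occupied_tableau_of[of "Suc j" "Suc (j - d)"] that e
      by (simp add: col_reached_def)
  qed
  show ?thesis
  proof
    show "bits n (tableau_of n S) \<subseteq> S"
      using growth.tower_subset[OF bits_tower[OF s]] by (rule square_subsetI) (simp_all add: a c)
    show "S \<subseteq> bits n (tableau_of n S)"
      using growth.tower_subset[OF S] by (rule square_subsetI) (simp_all add: a c)
  qed
qed

end

lemma growth_lattice_sTam: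
  assumes "1 \<le> n"
  shows "growth_lattice (sTam n) (bits n) (n - 1)"
proof
  have carrier: "carrier (sTam n) = {T. small n T}" by (simp add: sTam_def)
  show "eq (sTam n) = (=)" by (simp add: sTam_def)
  show le: "S \<sqsubseteq>\<^bsub>sTam n\<^esub> T \<longleftrightarrow> bits n S \<subseteq> bits n T"
    if "S \<in> carrier (sTam n)" "T \<in> carrier (sTam n)" for S T
    using that fb_le_iff_bits[of n S T] by (simp add: sTam_def)
  show "bij_betw (bits n) (carrier (sTam n)) (growth.F ((n - 1) * (n - 1)))"
  proof (rule bij_betw_imageI)
    show "inj_on (bits n) (carrier (sTam n))"
      unfolding carrier by (rule inj_onI) (simp add: fb_le_antisym fb_le_iff_bits)
    show "bits n ` carrier (sTam n) = growth.F ((n - 1) * (n - 1))"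
    proof
      show "bits n ` carrier (sTam n) \<subseteq> growth.F ((n - 1) * (n - 1))"
        unfolding carrier using bits_tower by auto
      show "growth.F ((n - 1) * (n - 1)) \<subseteq> bits n ` carrier (sTam n)"
      proof
        fix S assume S: "S \<in> growth.F ((n - 1) * (n - 1))"
        show "S \<in> bits n ` carrier (sTam n)"
          unfolding carrier using bits_tableau_of[OF assms S] small_tableau_of[OF assms S]
          by (intro image_eqI[of _ _ "tableau_of n S"]) auto
      qed
    qed
  qed
qed

theorem theorem1p7:
  fixes n :: nat
  assumes "n \<ge> 1"
  shows "lattice (sTam n) \<and> finite (carrier (sTam n)) \<and>
    semidistributive (sTam n) \<and>
    extremal (sTam n) \<and>
    trim (sTam n) \<and>
    (polygonal (sTam n) \<and>
      (\<forall>x y. polygon (sTam n) x y \<longrightarrow> quadrilateral (sTam n) x y \<or> hexagon (sTam n) x y)) \<and>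
    congruence_uniform (sTam n)"
proof -
  let ?L = "sTam n"
  interpret G: growth_lattice ?L "bits n" "n - 1" using growth_lattice_sTam[OF assms] .
  \<comment> \<open>The dual interpretation supplies the statements about meets, meet-irreducibles
    and lower covers. The length of the longest chain is the same in both orders, so one computation
    serves both halves of extremality.\<close>
  interpret G': growth_lattice "inv_gorder ?L" "reflect (n - 1) \<circ> bits n" "n - 1"
    using G.growth_lattice_dual .
  note e = G.eq_L
  have SD: "semidistributive ?L"
    unfolding semidistributive_def
    using G.join_semidistributive G'.join_semidistributive[unfolded join_dual meet_dual] by auto
  have JI: "card {j. join_irreducible ?L j} = (n - 1) * (n - 1)"
    and MI: "card {m. meet_irreducible ?L m} = (n - 1) * (n - 1)"
    using G.card_join_irreducible G'.card_join_irreducible unfolding join_irreducible_dual[OF e] .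
  have ext: "extremal ?L" unfolding extremal_def JI MI using G.extremal_half by simp
  have "polygon ?L (y \<sqinter>\<^bsub>?L\<^esub> z) x" if "covers ?L x y" "covers ?L x z" "y \<noteq> z" for x y z
    using G'.covers_polygon[unfolded covers_dual[OF e] polygon_dual join_dual, OF that] .
  then have pol: "polygonal ?L" unfolding polygonal_def using G.covers_polygon by blast
  have CU: "congruence_uniform ?L"
    unfolding congruence_uniform_def
    using G.con_bij_join_irreducible
      G'.con_bij_join_irreducible[unfolded join_irreducible_dual[OF e] lower_cover_dual[OF e] con_dual Con_dual]
    by blast
  show ?thesis
    using G.lattice_axioms G.finite_L SD ext G.left_modular_L pol CU G.polygon_quadrilateral_or_hexagon
    unfolding trim_def by blast
qed

end
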